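(* Let $k$ be a field and let $\mathcal{C}$ be a finite groupoid or a finite poset (viewed as a category). Then the Hochschild cohomology $\mathrm{HH}^{\bullet}(k\mathcal{C})$ of the category algebra $k\mathcal{C}$ is isomorphic, as a graded $k$-vector space, to the simplicial cohomology $\mathrm{H}^{\bullet}(F^{\mathrm{ad}}(\mathcal{C}),k)$ of the category $F^{\mathrm{ad}}(\mathcal{C})$.
   Context: A category is finite if it has finitely many objects and all its sets of morphisms are finite. A poset is viewed as a category with exactly one morphism between two comparable elements (in the direction given by the order) and no other morphisms. For a morphism $a$, $s(a)$ and $t(a)$ are its source and target. The category algebra $k\mathcal{C}$ is the $k$-vector space with basis $\mathrm{Mor}(\mathcal{C})$ and product $ab=a\circ b$ if $s(a)=t(b)$, and $ab=0$ otherwise. $\mathrm{HH}^{\bullet}(k\mathcal{C})$ is the usual Hochschild cohomology of the $k$-algebra $k\mathcal{C}$ with coefficients in itself. The adjoint category $F^{\mathrm{ad}}(\mathcal{C})$ has as objects all endomorphisms in $\mathcal{C}$; a morphism from $a\in\mathrm{End}_{\mathcal{C}}(x_1)$ to $b\in\mathrm{End}_{\mathcal{C}}(x_2)$ is a $g\in\mathrm{Hom}_{\mathcal{C}}(x_1,x_2)$ with $g\circ a=b\circ g$; composition is that of $\mathcal{C}$. For a small category $\mathcal{D}$, $\mathrm{H}^{\bullet}(\mathcal{D},k)$ is the cohomology of the nerve of $\mathcal{D}$ with coefficients in $k$: let $N\mathcal{D}_m$ be the set of chains $a_0\xrightarrow{g_0}a_1\to\cdots\xrightarrow{g_{m-1}}a_m$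 of $m$ composable morphisms ($N\mathcal{D}_0=\mathrm{Ob}(\mathcal{D})$), let $C^m=\mathrm{Hom}_k(kN\mathcal{D}_m,k)$, and $\delta^m(f)=\sum_{i=0}^{m+1}(-1)^i f\circ d_i^m$, where $d_i^m:N\mathcal{D}_{m+1}\to N\mathcal{D}_m$ drops $a_0$ (and $g_0$) if $i=0$, drops $a_{m+1}$ (and $g_m$) if $i=m+1$, and composes at $a_i$ (replacing $g_{i-1},g_i$ by $g_i\circ g_{i-1}$) if $1\le i\le m$. *)

theory Defs
  imports Complex_Main "HOL-Library.FuncSet" "HOL-Library.Poly_Mapping" "HOL-Library.Function_Algebras"
    "HOL-Library.Set_Algebras"
begin

section \<open>Vector spaces and their cohomology\<close>

text \<open>
  A vector space is given by its carrier inside an ambient type and its scalar multiplication;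
  its addition is always the one of the ambient type. For quotient spaces the ambient type is
  a type of sets and the addition is the elementwise addition of sets (theory
  \<^theory>\<open>HOL-Library.Set_Algebras\<close>), which on cosets is
  \<open>(x + W) + (y + W) = (x + y) + W\<close>.
\<close>

record ('k, 'v) vspace =
  carr :: "'v set"
  scl :: "'k \<Rightarrow> 'v \<Rightarrow> 'v"

definition linear_map :: "('k, 'v::plus, 'x) vspace_scheme \<Rightarrow> ('k, 'w::plus, 'y) vspace_scheme
    \<Rightarrow> ('v \<Rightarrow> 'w) \<Rightarrow> bool"
  where "linear_map V W f \<longleftrightarrow> f \<in> carr V \<rightarrow> carr W \<and>
    (\<forall>x\<in>carr V. \<forall>y\<in>carr V. f (x + y) = f x + f y) \<and>
    (\<forall>c. \<forall>x\<in>carr V. f (scl V c x) = scl W c (f x))"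

definition linear_iso :: "('k, 'v::plus, 'x) vspace_scheme \<Rightarrow> ('k, 'w::plus, 'y) vspace_scheme
    \<Rightarrow> ('v \<Rightarrow> 'w) \<Rightarrow> bool"
  where "linear_iso V W f \<longleftrightarrow> linear_map V W f \<and> bij_betw f (carr V) (carr W)"

definition graded_isomorphic :: "(nat \<Rightarrow> ('k, 'v::plus) vspace) \<Rightarrow> (nat \<Rightarrow> ('k, 'w::plus) vspace) \<Rightarrow> bool"
  where "graded_isomorphic V W \<longleftrightarrow> (\<exists>\<phi>. \<forall>n. linear_iso (V n) (W n) (\<phi> n))"

text \<open>
  In \<open>c \<cdot> (x + W)\<close> the summand \<open>W\<close> is added once more so that
  the result is a coset also for \<open>c = 0\<close>.
\<close>

definition quotient_space :: "('k, 'v::ab_group_add, 'x) vspace_scheme \<Rightarrow> 'v set \<Rightarrow> ('k, 'v set) vspace"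
  where "quotient_space V W =
    \<lparr>carr = (\<lambda>x. x +o W) ` carr V, scl = (\<lambda>c X. scl V c ` X + W)\<rparr>"

definition cocycles :: "(nat \<Rightarrow> ('k, 'v::ab_group_add) vspace) \<Rightarrow> (nat \<Rightarrow> 'v \<Rightarrow> 'v) \<Rightarrow> nat
    \<Rightarrow> ('k, 'v) vspace"
  where "cocycles C d n = \<lparr>carr = {f \<in> carr (C n). d n f = 0}, scl = scl (C n)\<rparr>"

definition coboundaries :: "(nat \<Rightarrow> ('k, 'v::ab_group_add) vspace) \<Rightarrow> (nat \<Rightarrow> 'v \<Rightarrow> 'v) \<Rightarrow> nat \<Rightarrow> 'v set"
  where "coboundaries C d n = (case n of 0 \<Rightarrow> {0} | Suc m \<Rightarrow> d m ` carr (C m))"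

definition cohomology :: "(nat \<Rightarrow> ('k, 'v::ab_group_add) vspace) \<Rightarrow> (nat \<Rightarrow> 'v \<Rightarrow> 'v) \<Rightarrow> nat
    \<Rightarrow> ('k, 'v set) vspace"
  where "cohomology C d n = quotient_space (cocycles C d n) (coboundaries C d n)"

definition ground_space :: "('k::field, 'k) vspace"
  where "ground_space = \<lparr>carr = UNIV, scl = (*)\<rparr>"

text \<open>Linear maps are represented by functions vanishing outside the carrier of the domain.\<close>

definition hom_space :: "('k, 'v::plus, 'x) vspace_scheme \<Rightarrow> ('k, 'w::{plus,zero}, 'y) vspace_scheme
    \<Rightarrow> ('k, 'v \<Rightarrow> 'w) vspace"
  where "hom_space V W =
    \<lparr>carr = {f. linear_map V W f \<and> (\<forall>x. x \<notin> carr V \<longrightarrow> f x = 0)},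
     scl = (\<lambda>c f x. scl W c (f x))\<rparr>"

definition free_space :: "'x set \<Rightarrow> ('k::field, 'x \<Rightarrow>\<^sub>0 'k) vspace"
  where "free_space X =
    \<lparr>carr = {v. Poly_Mapping.keys v \<subseteq> X}, scl = (\<lambda>c. Poly_Mapping.map ((*) c))\<rparr>"

definition free_map :: "('x \<Rightarrow> 'y) \<Rightarrow> ('x \<Rightarrow>\<^sub>0 'k) \<Rightarrow> ('y \<Rightarrow>\<^sub>0 'k::field)"
  where "free_map h v =
    (\<Sum>x\<in>Poly_Mapping.keys v. Poly_Mapping.single (h x) (Poly_Mapping.lookup v x))"

text \<open>
  \<open>merge mu i [x\<^sub>0, \<dots>]\<close> replaces the two entries \<open>x\<^bsub>i-1\<^esub>, x\<^sub>i\<close> by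
  \<open>mu x\<^bsub>i-1\<^esub> x\<^sub>i\<close>, for \<open>i \<ge> 1\<close>.
\<close>

definition merge :: "('a \<Rightarrow> 'a \<Rightarrow> 'a) \<Rightarrow> nat \<Rightarrow> 'a list \<Rightarrow> 'a list"
  where "merge mu i xs = take (i - 1) xs @ [mu (xs ! (i - 1)) (xs ! i)] @ drop (Suc i) xs"


section \<open>Hochschild cohomology\<close>

record ('k, 'a) alg = "('k, 'a) vspace" +
  mul :: "'a \<Rightarrow> 'a \<Rightarrow> 'a"

text \<open>
  The space \<open>Hom\<^sub>k(A\<^bsup>\<otimes>n\<^esup>, A)\<close> of \<open>n\<close>-linear maps
  \<open>A\<^sup>n \<rightarrow> A\<close>, whose arguments form a list of length \<open>n\<close>.
\<close>

definition hochschild_dom :: "('k, 'a, 'x) alg_scheme \<Rightarrow> nat \<Rightarrow> 'a list set"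
  where "hochschild_dom A n = {xs. length xs = n \<and> set xs \<subseteq> carr A}"

definition multilinear :: "('k, 'a::plus, 'x) alg_scheme \<Rightarrow> nat \<Rightarrow> ('a list \<Rightarrow> 'a) \<Rightarrow> bool"
  where "multilinear A n f \<longleftrightarrow>
    (\<forall>xs\<in>hochschild_dom A n. f xs \<in> carr A \<and> (\<forall>i<n. linear_map A A (\<lambda>x. f (xs[i := x]))))"

definition hochschild_cochains :: "('k, 'a::ab_group_add, 'x) alg_scheme \<Rightarrow> nat
    \<Rightarrow> ('k, 'a list \<Rightarrow> 'a) vspace"
  where "hochschild_cochains A n =
    \<lparr>carr = {f. multilinear A n f \<and> (\<forall>xs. xs \<notin> hochschild_dom A n \<longrightarrow> f xs = 0)},
     scl = (\<lambda>c f xs. scl A c (f xs))\<rparr>"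

definition hochschild_diff :: "('k::field, 'a::ab_group_add, 'x) alg_scheme \<Rightarrow> nat
    \<Rightarrow> ('a list \<Rightarrow> 'a) \<Rightarrow> 'a list \<Rightarrow> 'a"
  where "hochschild_diff A n f xs =
    (if xs \<in> hochschild_dom A (Suc n)
     then mul A (hd xs) (f (tl xs))
       + (\<Sum>i=1..n. scl A ((-1) ^ i) (f (merge (mul A) i xs)))
       + scl A ((-1) ^ (n + 1)) (mul A (f (butlast xs)) (last xs))
     else 0)"

definition HH :: "('k::field, 'a::ab_group_add, 'x) alg_scheme \<Rightarrow> nat \<Rightarrow> ('k, ('a list \<Rightarrow> 'a) set) vspace"
  where "HH A = cohomology (hochschild_cochains A) (hochschild_diff A)"


section \<open>Categories\<close>

text \<open>The value \<open>cmp C g f\<close> is \<open>g \<circ> f\<close>; it is only meaningful if \<open>src C g = tgt C f\<close>.\<close>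

record ('o, 'm) cat =
  Ob :: "'o set"
  Mor :: "'m set"
  src :: "'m \<Rightarrow> 'o"
  tgt :: "'m \<Rightarrow> 'o"
  idm :: "'o \<Rightarrow> 'm"
  cmp :: "'m \<Rightarrow> 'm \<Rightarrow> 'm"

definition Hom :: "('o, 'm) cat \<Rightarrow> 'o \<Rightarrow> 'o \<Rightarrow> 'm set"
  where "Hom C x y = {f \<in> Mor C. src C f = x \<and> tgt C f = y}"

locale category =
  fixes C :: "('o, 'm) cat"
  assumes src_in_Ob: "f \<in> Mor C \<Longrightarrow> src C f \<in> Ob C"
    and tgt_in_Ob: "f \<in> Mor C \<Longrightarrow> tgt C f \<in> Ob C"
    and idm_in_Hom: "x \<in> Ob C \<Longrightarrow> idm C x \<in> Hom C x x"
    and cmp_in_Hom: "f \<in> Hom C x y \<Longrightarrow> g \<in> Hom C y z \<Longrightarrow> cmp C g f \<in> Hom C x z"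
    and cmp_idm_right: "f \<in> Hom C x y \<Longrightarrow> cmp C f (idm C x) = f"
    and cmp_idm_left: "f \<in> Hom C x y \<Longrightarrow> cmp C (idm C y) f = f"
    and cmp_assoc: "f \<in> Hom C w x \<Longrightarrow> g \<in> Hom C x y \<Longrightarrow> h \<in> Hom C y z
      \<Longrightarrow> cmp C h (cmp C g f) = cmp C (cmp C h g) f"

locale finite_category = category +
  assumes finite_Ob: "finite (Ob C)"
    and finite_Hom: "x \<in> Ob C \<Longrightarrow> y \<in> Ob C \<Longrightarrow> finite (Hom C x y)"

locale groupoid = category +
  assumes invertible: "f \<in> Hom C x y
    \<Longrightarrow> \<exists>g\<in>Hom C y x. cmp C g f = idm C x \<and> cmp C f g = idm C y"

locale poset_category = category +
  assumes partial_order: "\<exists>r. partial_order_on (Ob C) r \<and>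
    (\<forall>x\<in>Ob C. \<forall>y\<in>Ob C. if (x, y) \<in> r then \<exists>!f. f \<in> Hom C x y else Hom C x y = {})"

definition category_algebra :: "'k::field itself \<Rightarrow> ('o, 'm) cat \<Rightarrow> ('k, 'm \<Rightarrow>\<^sub>0 'k) alg"
  where "category_algebra k C =
    \<lparr>carr = carr (free_space (Mor C) :: ('k, 'm \<Rightarrow>\<^sub>0 'k) vspace),
     scl = scl (free_space (Mor C) :: ('k, 'm \<Rightarrow>\<^sub>0 'k) vspace),
     mul = (\<lambda>u v. \<Sum>a\<in>Poly_Mapping.keys u. \<Sum>b\<in>Poly_Mapping.keys v.
       if src C a = tgt C b
       then Poly_Mapping.single (cmp C a b) (Poly_Mapping.lookup u a * Poly_Mapping.lookup v b)
       else 0)\<rparr>"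

text \<open>
  A morphism \<open>g\<close> of the adjoint category from \<open>a\<close> to \<open>b\<close> is the triple \<open>(a, g, b)\<close>, since
  \<open>g\<close> alone determines neither \<open>a\<close> nor \<open>b\<close>.
\<close>

definition endos :: "('o, 'm) cat \<Rightarrow> 'm set"
  where "endos C = {a \<in> Mor C. src C a = tgt C a}"

definition adjoint_category :: "('o, 'm) cat \<Rightarrow> ('m, 'm \<times> 'm \<times> 'm) cat"
  where "adjoint_category C =
    \<lparr>Ob = endos C,
     Mor = {(a, g, b). a \<in> endos C \<and> b \<in> endos C \<and> g \<in> Hom C (src C a) (src C b) \<and>
       cmp C g a = cmp C b g},
     src = (\<lambda>(a, g, b). a),
     tgt = (\<lambda>(a, g, b). b),
     idm = (\<lambda>a. (a, idm C (src C a), a)),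
     cmp = (\<lambda>(b', h, c) (a, g, b). (a, cmp C h g, c))\<rparr>"

lemma (in category) category_adjoint_category: "category (adjoint_category C)"
proof -
  let ?D = "adjoint_category C"
  have hom: "t \<in> Hom ?D a b \<longleftrightarrow> (\<exists>g. t = (a, g, b) \<and> a \<in> endos C \<and> b \<in> endos C \<and>
      g \<in> Hom C (src C a) (src C b) \<and> cmp C g a = cmp C b g)" for t a b
    by (auto simp: Hom_def adjoint_category_def)
  have endo: "a \<in> Hom C (src C a) (src C a)" if "a \<in> endos C" for a
    using that by (auto simp: endos_def Hom_def)
  show ?thesis
  proof
    fix x assume "x \<in> Ob ?D"
    then have x: "x \<in> endos C" by (simp add: adjoint_category_def)
    then have "src C x \<in> Ob C" using tgt_in_Ob by (auto simp: endos_def)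
    then show "idm ?D x \<in> Hom ?D x x"
      unfolding hom using x endo[OF x] cmp_idm_left cmp_idm_right idm_in_Hom
      by (auto simp: adjoint_category_def)
  next
    fix f x y g z assume "f \<in> Hom ?D x y" "g \<in> Hom ?D y z"
    then obtain p q where p: "f = (x, p, y)" "x \<in> endos C" "y \<in> endos C"
        "p \<in> Hom C (src C x) (src C y)" "cmp C p x = cmp C y p"
      and q: "g = (y, q, z)" "z \<in> endos C" "q \<in> Hom C (src C y) (src C z)" "cmp C q y = cmp C z q"
      unfolding hom by blast
    have "cmp C (cmp C q p) x = cmp C z (cmp C q p)"
      using cmp_assoc p q endo by metis
    then show "cmp ?D g f \<in> Hom ?D x z"
      unfolding hom using p q cmp_in_Hom by (auto simp: adjoint_category_def)
  next
    fix f w x g y h z assume "f \<in> Hom ?D w x" "g \<in> Hom ?D x y" "h \<in> Hom ?D y z"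
    then show "cmp ?D h (cmp ?D g f) = cmp ?D (cmp ?D h g) f"
      unfolding hom using cmp_assoc by (auto simp: adjoint_category_def)
  next
    fix f x y assume "f \<in> Hom ?D x y"
    then show "cmp ?D f (idm ?D x) = f" "cmp ?D (idm ?D y) f = f"
      unfolding hom using cmp_idm_left cmp_idm_right by (auto simp: adjoint_category_def)
  qed (auto simp: adjoint_category_def)
qed


section \<open>Cohomology of the nerve\<close>

text \<open>
  The chain \<open>a\<^sub>0 \<rightarrow> \<dots> \<rightarrow> a\<^sub>m\<close> with morphisms \<open>g\<^sub>i : a\<^sub>i \<rightarrow> a\<^bsub>i+1\<^esub>\<close> is the pair of lists
  \<open>([a\<^sub>0, \<dots>, a\<^sub>m], [g\<^sub>0, \<dots>, g\<^bsub>m-1\<^esub>])\<close>.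
\<close>

definition nerve :: "('o, 'm) cat \<Rightarrow> nat \<Rightarrow> ('o list \<times> 'm list) set"
  where "nerve D m = {(as, gs). length as = Suc m \<and> length gs = m \<and> set as \<subseteq> Ob D \<and>
    (\<forall>i<m. gs ! i \<in> Hom D (as ! i) (as ! Suc i))}"

text \<open>The map \<open>face D m i\<close> is \<open>d\<^sub>i\<^sup>m\<close> from chains of length \<open>m + 1\<close> to chains of length \<open>m\<close>.\<close>

definition face :: "('o, 'm) cat \<Rightarrow> nat \<Rightarrow> nat \<Rightarrow> 'o list \<times> 'm list \<Rightarrow> 'o list \<times> 'm list"
  where "face D m i = (\<lambda>(as, gs).
    if i = 0 then (tl as, tl gs)
    else if i = m + 1 then (butlast as, butlast gs)
    else (take i as @ drop (Suc i) as, merge (\<lambda>f g. cmp D g f) i gs))"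

definition nerve_cochains :: "'k::field itself \<Rightarrow> ('o, 'm) cat \<Rightarrow> nat
    \<Rightarrow> ('k, ('o list \<times> 'm list \<Rightarrow>\<^sub>0 'k) \<Rightarrow> 'k) vspace"
  where "nerve_cochains k D m = hom_space (free_space (nerve D m)) ground_space"

definition nerve_diff :: "('o, 'm) cat \<Rightarrow> nat \<Rightarrow> (('o list \<times> 'm list \<Rightarrow>\<^sub>0 'k) \<Rightarrow> 'k)
    \<Rightarrow> ('o list \<times> 'm list \<Rightarrow>\<^sub>0 'k) \<Rightarrow> 'k::field"
  where "nerve_diff D m f v =
    (if v \<in> carr (free_space (nerve D (Suc m)) :: ('k, 'o list \<times> 'm list \<Rightarrow>\<^sub>0 'k) vspace)
     then \<Sum>i=0..m+1. (-1) ^ i * f (free_map (face D m i) v)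
     else 0)"

definition simplicial_cohomology :: "'k::field itself \<Rightarrow> ('o, 'm) cat \<Rightarrow> nat
    \<Rightarrow> ('k, (('o list \<times> 'm list \<Rightarrow>\<^sub>0 'k) \<Rightarrow> 'k) set) vspace"
  where "simplicial_cohomology k D = cohomology (nerve_cochains k D) (nerve_diff D)"

end

theory Submission
  imports Defs
begin

text \<open>
  In the basis of morphisms a Hochschild \<open>n\<close>-cochain of \<open>kC\<close> is a function on pairs of a list
  \<open>g\<^sub>1, \<dots>, g\<^sub>n\<close> and a morphism \<open>h\<close>. The functions supported on the pairs for which \<open>g\<^sub>1 \<cdots> g\<^sub>n\<close> is
  composable and parallel to \<open>h\<close> form a direct summand of the complex, and inserting an identity at the
  first non-composable place contracts the complementary summand. In a groupoid or a poset there is a unique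
  endomorphism \<open>a\<close> with \<open>h = g\<^sub>1 \<cdots> g\<^sub>n a\<close>, and a chain of the adjoint category is determined by its
  first object \<open>a\<close> and its morphisms \<open>g\<^sub>i\<close>; so the remaining summand is the cochain complex of the nerve.
\<close>

section \<open>Comparing the cohomology of complexes\<close>

text \<open>Functions on closed words are the cochains relative to the subalgebra of
  \<open>kC\<close> spanned by the identities, a product of copies of \<open>k\<close>. Separability
  of this subalgebra stands behind the contraction, which therefore works in every category.
  Groupoids and posets matter for the second half, through cancellation: the outer terms of the
  Hochschild differential sum over all \<open>h'\<close> with \<open>g h' = h\<close> or with
  \<open>h' g = h\<close>, and a single face of a chain can replace such a sum only if it has
  exactly one term. The commuting squares of the adjoint category come from the last of these terms.
  To split \<open>g_n\<close> off \<open>h = g_1 ... g_n a\<close> on the right, \<open>a\<close>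
  must be moved across \<open>g_n\<close>, that is, replaced by a \<open>b\<close> with
  \<open>g_n a = b g_n\<close>; then \<open>h' = g_1 ... g_{n-1} b\<close>. Finiteness of
  \<open>C\<close> is what lets coordinates describe Hochschild cochains: every family of
  coefficients then defines a multilinear map.\<close>

definition vspace_on :: "('k, 'v::ab_group_add, 'x) vspace_scheme \<Rightarrow> bool"
  where "vspace_on V \<longleftrightarrow> 0 \<in> carr V \<and>
    (\<forall>x\<in>carr V. \<forall>y\<in>carr V. x + y \<in> carr V \<and> x - y \<in> carr V) \<and>
    (\<forall>c. \<forall>x\<in>carr V. scl V c x \<in> carr V) \<and>
    (\<forall>c. \<forall>x\<in>carr V. \<forall>y\<in>carr V. scl V c (x + y) = scl V c x + scl V c y)"

lemma linear_map_closed: "linear_map V W f \<Longrightarrow> x \<in> carr V \<Longrightarrow> f x \<in> carr W"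
  unfolding linear_map_def by blast

lemma linear_map_diff:
  fixes f :: "'v::ab_group_add \<Rightarrow> 'w::ab_group_add"
  assumes "vspace_on V" "linear_map V W f" "x \<in> carr V" "y \<in> carr V"
  shows "f (x - y) = f x - f y"
proof -
  have "f ((x - y) + y) = f (x - y) + f y"
    using assms unfolding vspace_on_def linear_map_def by blast
  then show ?thesis by (simp add: algebra_simps)
qed

lemma linear_map_zero:
  fixes f :: "'v::ab_group_add \<Rightarrow> 'w::ab_group_add"
  assumes "vspace_on V" "linear_map V W f"
  shows "f 0 = 0"
  using linear_map_diff[OF assms, of 0 0] assms(1) by (simp add: vspace_on_def)

lemma scl_zero:
  assumes "vspace_on V"
  shows "scl V c 0 = 0"
proof -
  have "scl V c (0 + 0) = scl V c 0 + scl V c 0"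
    using assms unfolding vspace_on_def by blast
  then show ?thesis by simp
qed

text \<open>
  The identity \<open>d \<circ> d = 0\<close> is not demanded: nothing below depends on it, since
  cocycles and coboundaries enter the comparison of cohomologies only through the linear maps \<open>d\<close>.
\<close>

definition cochain_complex :: "(nat \<Rightarrow> ('k, 'v::ab_group_add) vspace) \<Rightarrow> (nat \<Rightarrow> 'v \<Rightarrow> 'v) \<Rightarrow> bool"
  where "cochain_complex C d \<longleftrightarrow> (\<forall>n. vspace_on (C n) \<and> linear_map (C n) (C (Suc n)) (d n))"

lemma coboundaries_subspace:
  assumes "cochain_complex C d"
  shows "0 \<in> coboundaries C d n"
    and "x \<in> coboundaries C d n \<Longrightarrow> y \<in> coboundaries C d n \<Longrightarrow> x + y \<in> coboundaries C d n"
    and "x \<in> coboundaries C d n \<Longrightarrow> y \<in> coboundaries C d n \<Longrightarrow> x - y \<in> coboundaries C d n"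
    and "x \<in> coboundaries C d n \<Longrightarrow> scl (C n) c x \<in> coboundaries C d n"
    and "coboundaries C d n \<subseteq> carr (C n)"
proof -
  have V: "vspace_on (C m)" and L: "linear_map (C m) (C (Suc m)) (d m)" for m
    using assms by (auto simp: cochain_complex_def)
  have dz: "d m 0 = 0" and zc: "0 \<in> carr (C m)" for m
    using linear_map_zero[OF V L] V by (auto simp: vspace_on_def)
  have dsum: "d m (u + v) = d m u + d m v" "d m (u - v) = d m u - d m v"
    "u + v \<in> carr (C m)" "u - v \<in> carr (C m)"
    if "u \<in> carr (C m)" "v \<in> carr (C m)" for m u v
    using that L[of m] V[of m] linear_map_diff[OF V L]
    by (auto simp: linear_map_def vspace_on_def)
  have dscl: "d m (scl (C m) a u) = scl (C (Suc m)) a (d m u)" "scl (C m) a u \<in> carr (C m)"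
    "d m u \<in> carr (C (Suc m))" if "u \<in> carr (C m)" for m u a
    using that L[of m] V[of m] by (auto simp: linear_map_def vspace_on_def)
  have B: "coboundaries C d (Suc m) = d m ` carr (C m)" "coboundaries C d 0 = {0}" for m
    by (auto simp: coboundaries_def)
  show "0 \<in> coboundaries C d n"
    by (cases n) (use dz zc in \<open>auto simp: B image_iff intro: bexI[of _ 0]\<close>)
  show "x + y \<in> coboundaries C d n" if "x \<in> coboundaries C d n" "y \<in> coboundaries C d n"
    using that dsum by (cases n) (auto simp: B simp flip: dsum(1))
  show "x - y \<in> coboundaries C d n" if "x \<in> coboundaries C d n" "y \<in> coboundaries C d n"
    using that dsum by (cases n) (auto simp: B simp flip: dsum(2))
  show "scl (C n) c x \<in> coboundaries C d n" if "x \<in> coboundaries C d n"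
    using that dscl scl_zero[OF V] by (cases n) (auto simp: B simp flip: dscl(1))
  show "coboundaries C d n \<subseteq> carr (C n)"
    using dscl zc by (cases n) (auto simp: B)
qed

section \<open>Cosets and the maps they induce\<close>

lemma coset_eq_iff:
  fixes B :: "'v::ab_group_add set"
  assumes "0 \<in> B" "\<And>x y. x \<in> B \<Longrightarrow> y \<in> B \<Longrightarrow> x + y \<in> B" "\<And>x y. x \<in> B \<Longrightarrow> y \<in> B \<Longrightarrow> x - y \<in> B"
  shows "x +o B = y +o B \<longleftrightarrow> x - y \<in> B"
proof
  assume "x +o B = y +o B"
  then have "x + 0 \<in> y +o B" using assms(1) by (auto simp: elt_set_plus_def)
  then show "x - y \<in> B" by (auto simp: elt_set_plus_def)
next
  assume d: "x - y \<in> B"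
  have "x + b = y + ((x - y) + b)" "y + b = x + (b - (x - y))" for b by simp_all
  then show "x +o B = y +o B" using d assms(2,3) unfolding elt_set_plus_def by blast
qed

lemma coset_add:
  fixes B :: "'v::ab_group_add set"
  assumes "0 \<in> B" "\<And>x y. x \<in> B \<Longrightarrow> y \<in> B \<Longrightarrow> x + y \<in> B"
  shows "(x +o B) + (y +o B) = (x + y) +o B"
proof -
  have "B + B = B"
  proof (intro equalityI subsetI)
    show "b \<in> B + B" if "b \<in> B" for b
      using set_plus_intro[OF assms(1) that] by simp
  qed (use assms(2) in \<open>auto elim: set_plus_elim\<close>)
  then show ?thesis by (simp add: set_plus_rearrange)
qed

text \<open>The image of a coset is only a coset of the image of \<open>B\<close>; adding
  \<open>B'\<close> completes it. With \<open>f = F n\<close> this computes the induced map on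
  cohomology, with \<open>f\<close> a scaling and \<open>B' = B\<close> the scalar multiplication of
  a quotient.\<close>

lemma coset_image_add:
  fixes B :: "'v::ab_group_add set" and B' :: "'w::ab_group_add set"
  assumes "\<And>b. b \<in> B \<Longrightarrow> f (x + b) = f x + f b" "0 \<in> B" "f ` B \<subseteq> B'" "0 \<in> B'"
    "\<And>x y. x \<in> B' \<Longrightarrow> y \<in> B' \<Longrightarrow> x + y \<in> B'" "f 0 = 0"
  shows "f ` (x +o B) + B' = f x +o B'"
proof -
  have "f ` (x +o B) = f x +o f ` B"
  proof (intro equalityI subsetI)
    fix z assume "z \<in> f ` (x +o B)"
    then obtain b where "b \<in> B" "z = f (x + b)" by (auto simp: elt_set_plus_def)
    then show "z \<in> f x +o f ` B" using assms(1) by auto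
  next
    fix z assume "z \<in> f x +o f ` B"
    then obtain b where "b \<in> B" "z = f x + f b" by (auto simp: elt_set_plus_def)
    then show "z \<in> f ` (x +o B)" using assms(1)[of b] by (auto intro!: image_eqI[of _ _ "x + b"])
  qed
  moreover have "f ` B + B' = B'"
  proof (intro equalityI subsetI)
    fix z assume "z \<in> B'"
    moreover have "0 \<in> f ` B" using assms(2,6) by force
    ultimately show "z \<in> f ` B + B'" using set_plus_intro[of 0 "f ` B" z B'] by simp
  next
    fix z assume "z \<in> f ` B + B'"
    then show "z \<in> B'" using assms(3,5) by (auto elim!: set_plus_elim)
  qed
  ultimately show ?thesis by (simp add: set_plus_rearrange3)
qed

text \<open>Made for a chain map that is far from injective, since restricting word cochains to
  closed words forgets all other words. Surjectivity is asked for cocycles rather than for classes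
  because extension by zero provides exactly that.\<close>

lemma cohomology_linear_iso:
  assumes V: "cochain_complex V dV" and W: "cochain_complex W dW"
    and F: "\<And>n. linear_map (V n) (W n) (F n)"
    and chain: "\<And>n x. x \<in> carr (V n) \<Longrightarrow> F (Suc n) (dV n x) = dW n (F n x)"
    and surj: "\<And>n w. w \<in> carr (W n) \<Longrightarrow> dW n w = 0 \<Longrightarrow> \<exists>v\<in>carr (V n). dV n v = 0 \<and> F n v = w"
    and inj: "\<And>n v. v \<in> carr (V n) \<Longrightarrow> dV n v = 0 \<Longrightarrow> F n v \<in> coboundaries W dW n \<Longrightarrow>
      v \<in> coboundaries V dV n"
  shows "graded_isomorphic (cohomology V dV) (cohomology W dW)"
  unfolding graded_isomorphic_def
proof (intro exI allI)
  fix n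
  let ?BV = "coboundaries V dV n" and ?BW = "coboundaries W dW n"
  let ?Z = "{x \<in> carr (V n). dV n x = 0}" and ?Y = "{x \<in> carr (W n). dW n x = 0}"
  let ?\<phi> = "\<lambda>X. F n ` X + ?BW"
  note BV = coboundaries_subspace[OF V, where n = n] and BW = coboundaries_subspace[OF W, where n = n]
  have vV: "vspace_on (V n)" and vW: "vspace_on (W n)" and
    LV: "linear_map (V m) (V (Suc m)) (dV m)" and LW: "linear_map (W m) (W (Suc m)) (dW m)" for m
    using V W by (auto simp: cochain_complex_def)
  have vV': "vspace_on (V m)" for m using V by (auto simp: cochain_complex_def)
  have FB: "F n ` ?BV \<subseteq> ?BW"
  proof (cases n)
    case 0
    then show ?thesis using linear_map_zero[OF vV' F] by (auto simp: coboundaries_def)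
  next
    case (Suc m)
    then show ?thesis
      using chain[of _ m] F[of m] by (auto simp: coboundaries_def linear_map_def image_iff)
  qed
  note sclV0 = scl_zero[OF vV] and sclW0 = scl_zero[OF vW]
  have \<phi>: "?\<phi> (x +o ?BV) = F n x +o ?BW" if "x \<in> carr (V n)" for x
    using that BV(5) F[of n] linear_map_zero[OF vV F] FB BV(1) BW(1,2)
    by (intro coset_image_add) (auto simp: linear_map_def)
  have sV: "scl (V n) c ` (x +o ?BV) + ?BV = scl (V n) c x +o ?BV" if "x \<in> carr (V n)" for x c
    using that vV BV sclV0 by (intro coset_image_add) (auto simp: vspace_on_def)
  have sW: "scl (W n) c ` (x +o ?BW) + ?BW = scl (W n) c x +o ?BW" if "x \<in> carr (W n)" for x c
    using that vW BW sclW0 by (intro coset_image_add) (auto simp: vspace_on_def)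
  have eqV: "x +o ?BV = y +o ?BV \<longleftrightarrow> x - y \<in> ?BV" for x y
    using BV by (intro coset_eq_iff) auto
  have eqW: "x +o ?BW = y +o ?BW \<longleftrightarrow> x - y \<in> ?BW" for x y
    using BW by (intro coset_eq_iff) auto
  have FZ: "F n x \<in> ?Y" if "x \<in> ?Z" for x
    using that F[of n] chain[of x n] linear_map_zero[OF vV' F] by (auto simp: linear_map_def)
  have carrV: "carr (cohomology V dV n) = (\<lambda>x. x +o ?BV) ` ?Z"
    and carrW: "carr (cohomology W dW n) = (\<lambda>x. x +o ?BW) ` ?Y"
    and sclV: "scl (cohomology V dV n) = (\<lambda>c X. scl (V n) c ` X + ?BV)"
    and sclW: "scl (cohomology W dW n) = (\<lambda>c X. scl (W n) c ` X + ?BW)"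
    by (auto simp: cohomology_def quotient_space_def cocycles_def)
  have addV: "(x +o ?BV) + (y +o ?BV) = (x + y) +o ?BV"
    and addW: "(x' +o ?BW) + (y' +o ?BW) = (x' + y') +o ?BW" for x y x' y'
    using BV BW by (auto intro!: coset_add)
  have "linear_map (cohomology V dV n) (cohomology W dW n) ?\<phi>"
    unfolding linear_map_def carrV carrW sclV sclW
  proof (intro conjI allI ballI)
    show "?\<phi> \<in> (\<lambda>x. x +o ?BV) ` ?Z \<rightarrow> (\<lambda>x. x +o ?BW) ` ?Y"
      using FZ \<phi> by fastforce
  next
    fix X Y assume "X \<in> (\<lambda>x. x +o ?BV) ` ?Z" "Y \<in> (\<lambda>x. x +o ?BV) ` ?Z"
    then obtain x y where x: "X = x +o ?BV" "x \<in> carr (V n)" and y: "Y = y +o ?BV" "y \<in> carr (V n)"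
      by auto
    have "x + y \<in> carr (V n)" using x y vV by (auto simp: vspace_on_def)
    then show "?\<phi> (X + Y) = ?\<phi> X + ?\<phi> Y"
      using x y F[of n] by (simp add: addV addW \<phi> linear_map_def)
  next
    fix c X assume "X \<in> (\<lambda>x. x +o ?BV) ` ?Z"
    then obtain x where x: "X = x +o ?BV" "x \<in> carr (V n)" by auto
    have "scl (V n) c x \<in> carr (V n)" "F n x \<in> carr (W n)"
      using x vV F[of n] by (auto simp: vspace_on_def linear_map_def)
    then show "?\<phi> (scl (V n) c ` X + ?BV) = scl (W n) c ` ?\<phi> X + ?BW"
      using x F[of n] by (simp add: sV sW \<phi> linear_map_def)
  qed
  moreover have "bij_betw ?\<phi> ((\<lambda>x. x +o ?BV) ` ?Z) ((\<lambda>x. x +o ?BW) ` ?Y)"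
  proof (rule bij_betw_imageI)
    show "inj_on ?\<phi> ((\<lambda>x. x +o ?BV) ` ?Z)"
    proof (rule inj_onI)
      fix X Y assume "X \<in> (\<lambda>x. x +o ?BV) ` ?Z" "Y \<in> (\<lambda>x. x +o ?BV) ` ?Z" and eq: "?\<phi> X = ?\<phi> Y"
      then obtain x y where x: "X = x +o ?BV" "x \<in> ?Z" and y: "Y = y +o ?BV" "y \<in> ?Z"
        by auto
      have "F n x - F n y \<in> ?BW" using eq x y by (simp add: \<phi> eqW)
      then have "F n (x - y) \<in> ?BW" using x y linear_map_diff[OF vV F] by simp
      moreover have "x - y \<in> carr (V n)" "dV n (x - y) = 0"
        using x y vV linear_map_diff[OF vV LV] by (auto simp: vspace_on_def)
      ultimately show "X = Y" using inj x y by (simp add: eqV)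
    qed
    show "?\<phi> ` (\<lambda>x. x +o ?BV) ` ?Z = (\<lambda>x. x +o ?BW) ` ?Y"
    proof (intro equalityI subsetI)
      fix X assume "X \<in> ?\<phi> ` (\<lambda>x. x +o ?BV) ` ?Z"
      then show "X \<in> (\<lambda>x. x +o ?BW) ` ?Y" using FZ \<phi> by fastforce
    next
      fix Y assume "Y \<in> (\<lambda>x. x +o ?BW) ` ?Y"
      then obtain y where y: "Y = y +o ?BW" "y \<in> ?Y" by auto
      then obtain v where "v \<in> ?Z" "F n v = y" using surj by blast
      then have "v +o ?BV \<in> (\<lambda>x. x +o ?BV) ` ?Z" "Y = ?\<phi> (v +o ?BV)" using y \<phi> by auto
      then show "Y \<in> ?\<phi> ` (\<lambda>x. x +o ?BV) ` ?Z" by (rule rev_image_eqI)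
    qed
  qed
  ultimately show "linear_iso (cohomology V dV n) (cohomology W dW n) ?\<phi>"
    unfolding linear_iso_def carrV carrW by blast
qed

text \<open>Being a cocycle is pulled back by injectivity in degree \<open>n + 1\<close>, being a
  coboundary by surjectivity in degree \<open>n - 1\<close> together with injectivity in degree
  \<open>n\<close>.\<close>

lemma cohomology_linear_iso_of_complex_iso:
  assumes V: "cochain_complex V dV" and W: "cochain_complex W dW"
    and F: "\<And>n. linear_iso (V n) (W n) (F n)"
    and chain: "\<And>n x. x \<in> carr (V n) \<Longrightarrow> F (Suc n) (dV n x) = dW n (F n x)"
  shows "graded_isomorphic (cohomology V dV) (cohomology W dW)"
proof (rule cohomology_linear_iso[where F = F, OF V W])
  have vV: "vspace_on (V n)" and LV: "linear_map (V n) (V (Suc n)) (dV n)" for n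
    using V by (auto simp: cochain_complex_def)
  show lin: "linear_map (V n) (W n) (F n)" for n using F by (simp add: linear_iso_def)
  have inj: "inj_on (F n) (carr (V n))" and surj: "F n ` carr (V n) = carr (W n)" for n
    using F by (auto simp: linear_iso_def bij_betw_def)
  have z: "F n 0 = 0" "0 \<in> carr (V n)" for n
    using linear_map_zero[OF vV lin] vV by (auto simp: vspace_on_def)
  have d: "dV n x \<in> carr (V (Suc n))" if "x \<in> carr (V n)" for n x
    using LV that by (rule linear_map_closed)
  show "\<exists>v\<in>carr (V n). dV n v = 0 \<and> F n v = w" if w: "w \<in> carr (W n)" "dW n w = 0" for n w
  proof -
    have "w \<in> F n ` carr (V n)" using w(1) surj[of n] by simp
    then obtain v where v: "v \<in> carr (V n)" "F n v = w" by blast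
    have "F (Suc n) (dV n v) = F (Suc n) 0"
      unfolding chain[OF v(1)] v(2) w(2) z(1) ..
    then have "dV n v = 0" by (rule inj_onD[OF inj _ d[OF v(1)] z(2)])
    then show ?thesis using v by blast
  qed
  show "v \<in> coboundaries V dV n"
    if v: "v \<in> carr (V n)" and b: "F n v \<in> coboundaries W dW n" for n v
  proof (cases n)
    case 0
    then have "F 0 v = F 0 0" using b z by (simp add: coboundaries_def)
    then have "v = 0" using v 0 by (intro inj_onD[OF inj[of 0] _ _ z(2)]) auto
    then show ?thesis using 0 by (simp add: coboundaries_def)
  next
    case (Suc m)
    then obtain w where w: "w \<in> carr (W m)" "F n v = dW m w" using b by (auto simp: coboundaries_def)
    have "w \<in> F m ` carr (V m)" using w(1) surj[of m] by simp
    then obtain u where u: "u \<in> carr (V m)" "F m u = w" by blast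
    then have "F n v = F n (dV m u)" using chain[of u m] w Suc by simp
    then have "v = dV m u" using d[OF u(1)] v Suc by (intro inj_onD[OF inj[of n]]) auto
    then show ?thesis using u Suc by (auto simp: coboundaries_def)
  qed
qed (use chain in blast)

lemma graded_isomorphic_trans:
  assumes "graded_isomorphic U V" "graded_isomorphic V W"
  shows "graded_isomorphic U W"
proof -
  obtain f g where "\<And>n. linear_iso (U n) (V n) (f n)" "\<And>n. linear_iso (V n) (W n) (g n)"
    using assms by (auto simp: graded_isomorphic_def)
  then have "linear_iso (U n) (W n) (g n \<circ> f n)" for n
    using bij_betw_trans[of "f n" "carr (U n)" "carr (V n)" "g n" "carr (W n)"]
    by (auto simp: linear_iso_def linear_map_def Pi_iff)
  then show ?thesis unfolding graded_isomorphic_def by (intro exI[of _ "\<lambda>n. g n \<circ> f n"]) simp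
qed

text \<open>The coordinate model in which both complexes are compared. Vanishing off
  \<open>X\<close> makes equality of cochains plain equality of functions.\<close>

definition fun_space :: "'x set \<Rightarrow> ('k::field, 'x \<Rightarrow> 'k) vspace"
  where "fun_space X = \<lparr>carr = {f. \<forall>x. x \<notin> X \<longrightarrow> f x = 0}, scl = (\<lambda>c f x. c * f x)\<rparr>"

lemma vspace_on_fun_space: "vspace_on (fun_space X)"
  by (auto simp: vspace_on_def fun_space_def fun_eq_iff algebra_simps)

section \<open>Reduction of the Hochschild complex to closed words\<close>

lemma merge_append: "merge f (Suc (length us)) (us @ p # q # vs) = us @ f p q # vs"
  by (simp add: merge_def nth_append)

text \<open>Trades the index of \<open>merge\<close> for a decomposition of the list, the form in
  which recursive functions such as \<open>foldr\<close> and \<open>linked\<close> can be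
  evaluated.\<close>

lemma split_at_merge:
  assumes "1 \<le> i" "i < length xs"
  obtains us p q vs where "xs = us @ p # q # vs" "i = Suc (length us)"
proof
  have "xs = take (i - 1) xs @ xs ! (i - 1) # drop i xs"
    using id_take_nth_drop[of "i - 1" xs] assms by simp
  also have "drop i xs = xs ! i # drop (Suc i) xs" using assms(2) by (simp add: Cons_nth_drop_Suc)
  finally show "xs = take (i - 1) xs @ xs ! (i - 1) # xs ! i # drop (Suc i) xs" .
  show "i = Suc (length (take (i - 1) xs))" using assms by simp
qed

lemma length_merge: "1 \<le> i \<Longrightarrow> i < length xs \<Longrightarrow> length (merge f i xs) = length xs - 1"
  by (simp add: merge_def)

lemma nth_merge:
  "1 \<le> i \<Longrightarrow> i < length xs \<Longrightarrow> k < length xs - 1 \<Longrightarrow>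
    merge f i xs ! k = (if k < i - 1 then xs ! k else if k = i - 1 then f (xs ! (i - 1)) (xs ! i) else xs ! Suc k)"
  by (auto simp: merge_def nth_append nth_Cons' min_def)

text \<open>
  A Hochschild cochain \<open>f\<close> is encoded by its coefficients: \<open>\<Phi> (gs, h)\<close> is the coefficient
  of \<open>h\<close> in \<open>f [g\<^sub>1, \<dots>, g\<^sub>n]\<close> for basis elements \<open>g\<^sub>i\<close>, and \<open>word_diff\<close> is
  the Hochschild differential in these coordinates.
\<close>

definition word_dom :: "('o, 'm) cat \<Rightarrow> nat \<Rightarrow> ('m list \<times> 'm) set"
  where "word_dom C n = {(gs, h). length gs = n \<and> set gs \<subseteq> Mor C \<and> h \<in> Mor C}"

definition word_diff :: "('o, 'm) cat \<Rightarrow> nat \<Rightarrow> ('m list \<times> 'm \<Rightarrow> 'k) \<Rightarrow> 'm list \<times> 'm \<Rightarrow> 'k::field"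
  where "word_diff C n \<Phi> = (\<lambda>(gs, h). if (gs, h) \<in> word_dom C (Suc n) then
    (\<Sum>h' | h' \<in> Mor C \<and> src C (hd gs) = tgt C h' \<and> cmp C (hd gs) h' = h. \<Phi> (tl gs, h'))
    + (\<Sum>i=1..n. (-1) ^ i *
        (if src C (gs ! (i - 1)) = tgt C (gs ! i) then \<Phi> (merge (cmp C) i gs, h) else 0))
    + (-1) ^ (n + 1) *
        (\<Sum>h' | h' \<in> Mor C \<and> src C h' = tgt C (last gs) \<and> cmp C h' (last gs) = h. \<Phi> (butlast gs, h'))
    else 0)"

lemma cochain_complex_word: "cochain_complex (\<lambda>n. fun_space (word_dom C n) :: ('k::field, _) vspace) (word_diff C)"
  unfolding cochain_complex_def
proof (intro allI conjI vspace_on_fun_space)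
  fix n
  have "word_diff C n (x + y) = word_diff C n x + word_diff C n y" for x y :: "_ \<Rightarrow> 'k"
  proof -
    have *: "(if c then a + b else 0) = (if c then a else 0) + (if c then b else 0)" for c and a b :: 'k
      by simp
    show ?thesis
      by (auto simp: word_diff_def fun_eq_iff * sum.distrib distrib_left cong: if_cong)
  qed
  moreover have "word_diff C n (\<lambda>x. c * f x) = (\<lambda>x. c * word_diff C n f x)"
    for c and f :: "_ \<Rightarrow> 'k"
    by (auto simp: word_diff_def fun_eq_iff sum_distrib_left algebra_simps intro!: sum.cong)
  ultimately show "linear_map (fun_space (word_dom C n)) (fun_space (word_dom C (Suc n)))
      (word_diff C n :: (_ \<Rightarrow> 'k) \<Rightarrow> _)"
    by (auto simp: linear_map_def fun_space_def word_diff_def)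
qed

text \<open>
  \<open>lend\<close> and \<open>rend\<close> are the two objects meeting at position \<open>i \<le> n\<close> of the sequence
  \<open>(h, g\<^sub>1, \<dots>, g\<^sub>n, h)\<close>; in a closed word they agree everywhere, so \<open>g\<^sub>1 \<cdots> g\<^sub>n\<close> is
  composable and parallel to \<open>h\<close>.
\<close>

definition lend :: "('o, 'm) cat \<Rightarrow> 'm list \<times> 'm \<Rightarrow> nat \<Rightarrow> 'o"
  where "lend C = (\<lambda>(gs, h) i. if i = 0 then tgt C h else src C (gs ! (i - 1)))"

definition rend :: "('o, 'm) cat \<Rightarrow> 'm list \<times> 'm \<Rightarrow> nat \<Rightarrow> 'o"
  where "rend C = (\<lambda>(gs, h) i. if i < length gs then tgt C (gs ! i) else src C h)"

definition first_gap :: "('o, 'm) cat \<Rightarrow> 'm list \<times> 'm \<Rightarrow> nat \<Rightarrow> bool"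
  where "first_gap C w i \<longleftrightarrow> i \<le> length (fst w) \<and> lend C w i \<noteq> rend C w i \<and>
    (\<forall>j<i. lend C w j = rend C w j)"

definition closed_words :: "('o, 'm) cat \<Rightarrow> nat \<Rightarrow> ('m list \<times> 'm) set"
  where "closed_words C n = {w \<in> word_dom C n. \<forall>i\<le>n. lend C w i = rend C w i}"

text \<open>The identity belongs to the left object of the gap. So if \<open>i\<close> is the first
  gap of a word, the filled word matches at place \<open>i\<close> and has its first gap at place
  \<open>i + 1\<close>.\<close>

definition fill :: "('o, 'm) cat \<Rightarrow> nat \<Rightarrow> 'm list \<times> 'm \<Rightarrow> 'm list"
  where "fill C i = (\<lambda>(gs, h). take i gs @ [idm C (lend C (gs, h) i)] @ drop i gs)"

text \<open>
  On words that are not closed, inserting an identity at the first gap is a contracting homotopy: composing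
  it with its left neighbour gives back the word, composing it with its right neighbour gives \<open>0\<close>.
\<close>

definition word_htpy :: "('o, 'm) cat \<Rightarrow> nat \<Rightarrow> ('m list \<times> 'm \<Rightarrow> 'k) \<Rightarrow> 'm list \<times> 'm \<Rightarrow> 'k::field"
  where "word_htpy C n \<Phi> w = (if w \<in> word_dom C n \<and> w \<notin> closed_words C n
    then let i = (LEAST i. i \<le> n \<and> lend C w i \<noteq> rend C w i) in (-1) ^ i * \<Phi> (fill C i w, snd w) else 0)"

lemma first_gap_exists:
  assumes "w \<in> word_dom C n" "w \<notin> closed_words C n"
  shows "\<exists>i\<le>n. first_gap C w i"
proof -
  define P where "P i \<longleftrightarrow> i \<le> n \<and> lend C w i \<noteq> rend C w i" for i
  define i where "i = (LEAST i. P i)"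
  have "\<exists>i. P i" using assms by (auto simp: closed_words_def P_def)
  then have i: "P i" unfolding i_def by (rule LeastI_ex)
  have "\<not> P j" if "j < i" for j using that unfolding i_def by (rule not_less_Least)
  moreover have "length (fst w) = n" using assms(1) by (auto simp: word_dom_def)
  ultimately have "first_gap C w i"
    using i by (auto simp: first_gap_def P_def)
  then show ?thesis using i by (auto simp: P_def)
qed

lemma word_htpy_first_gap:
  assumes "w \<in> word_dom C n" "first_gap C w i"
  shows "word_htpy C n \<Phi> w = (-1) ^ i * \<Phi> (fill C i w, snd w)"
proof -
  have len: "length (fst w) = n" using assms by (auto simp: word_dom_def)
  have "(LEAST i. i \<le> n \<and> lend C w i \<noteq> rend C w i) = i"
    using assms(2) len by (intro Least_equality) (auto simp: first_gap_def intro: leI)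
  then show ?thesis
    using assms len by (auto simp: word_htpy_def Let_def first_gap_def closed_words_def)
qed

lemma word_htpy_closed: "w \<in> closed_words C n \<Longrightarrow> word_htpy C n \<Phi> w = 0"
  by (simp add: word_htpy_def)

section \<open>Effect of the terms of the differential on the places of a word\<close>

lemma (in category) cmp_ends:
  assumes "f \<in> Mor C" "g \<in> Mor C" "src C g = tgt C f"
  shows "cmp C g f \<in> Mor C" "src C (cmp C g f) = src C f" "tgt C (cmp C g f) = tgt C g"
  using cmp_in_Hom[of f "src C f" "tgt C f" g "tgt C g"] assms by (auto simp: Hom_def)

lemma (in category) idm_ends:
  assumes "x \<in> Ob C"
  shows "idm C x \<in> Mor C" "src C (idm C x) = x" "tgt C (idm C x) = x"
  using idm_in_Hom[OF assms] by (auto simp: Hom_def)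

context category
begin

lemma cmp_idm_tgt: "f \<in> Mor C \<Longrightarrow> cmp C (idm C (tgt C f)) f = f"
  using cmp_idm_left[of f "src C f" "tgt C f"] by (simp add: Hom_def)

lemma cmp_idm_src: "f \<in> Mor C \<Longrightarrow> cmp C f (idm C (src C f)) = f"
  using cmp_idm_right[of f "src C f" "tgt C f"] by (simp add: Hom_def)

lemma merge_word:
  assumes "(gs, h) \<in> word_dom C (Suc n)" "1 \<le> j" "j \<le> n" "src C (gs ! (j - 1)) = tgt C (gs ! j)"
  shows "(merge (cmp C) j gs, h) \<in> word_dom C n"
proof -
  have "gs ! (j - 1) \<in> Mor C" "gs ! j \<in> Mor C" using assms by (auto simp: word_dom_def)
  then have "cmp C (gs ! (j - 1)) (gs ! j) \<in> Mor C" using cmp_ends assms by auto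
  then show ?thesis using assms
    by (auto simp: word_dom_def merge_def dest: in_set_takeD in_set_dropD)
qed

text \<open>A composite keeps the outer ends of its two factors, so merging at \<open>j\<close>
  erases the place \<open>j\<close> and nothing else; the index on the right-hand side skips
  it.\<close>

lemma lend_rend_merge:
  assumes "(gs, h) \<in> word_dom C (Suc n)" "1 \<le> j" "j \<le> n" "src C (gs ! (j - 1)) = tgt C (gs ! j)" "i \<le> n"
  shows "lend C (merge (cmp C) j gs, h) i = lend C (gs, h) (if i < j then i else Suc i)"
    and "rend C (merge (cmp C) j gs, h) i = rend C (gs, h) (if i < j then i else Suc i)"
proof -
  have m: "gs ! (j - 1) \<in> Mor C" "gs ! j \<in> Mor C" "length gs = Suc n"
    using assms by (auto simp: word_dom_def)
  note e = cmp_ends[OF m(2,1) assms(4)]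
  show "lend C (merge (cmp C) j gs, h) i = lend C (gs, h) (if i < j then i else Suc i)"
    using assms m e
    by (cases "i < j"; cases "i = j") (auto simp: lend_def nth_merge)
  have "i = j - 1 \<longleftrightarrow> Suc i = j" using assms by auto
  then show "rend C (merge (cmp C) j gs, h) i = rend C (gs, h) (if i < j then i else Suc i)"
    using assms m e by (auto simp: rend_def nth_merge length_merge)
qed

text \<open>Splitting \<open>h = g_1 h'\<close> acts like a merge at place 0: \<open>h'\<close> has
  the source of \<open>h\<close>, and its target is the source of \<open>g_1\<close>. The erased
  place was no gap, since \<open>g_1\<close> and \<open>h\<close> share their target.
  \<open>lend_rend_butlast\<close> is the mirror image at the last place.\<close>

lemma lend_rend_tl:
  assumes "(gs, h) \<in> word_dom C (Suc n)" "h' \<in> Mor C" "src C (hd gs) = tgt C h'" "cmp C (hd gs) h' = h"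
    "i \<le> n"
  shows "(tl gs, h') \<in> word_dom C n"
    and "lend C (tl gs, h') i = lend C (gs, h) (Suc i)"
    and "rend C (tl gs, h') i = rend C (gs, h) (Suc i)"
    and "lend C (gs, h) 0 = rend C (gs, h) 0"
proof -
  obtain g gs' where g: "gs = g # gs'" using assms by (cases gs) (auto simp: word_dom_def)
  have m: "g \<in> Mor C" "length gs' = n" using assms g by (auto simp: word_dom_def)
  show "(tl gs, h') \<in> word_dom C n" using assms g by (auto simp: word_dom_def)
  show "lend C (tl gs, h') i = lend C (gs, h) (Suc i)"
    using assms g by (auto simp: lend_def nth_Cons')
  show "rend C (tl gs, h') i = rend C (gs, h) (Suc i)" "lend C (gs, h) 0 = rend C (gs, h) 0"
    using assms g m cmp_ends[of h' g] by (auto simp: rend_def lend_def)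
qed

lemma lend_rend_butlast:
  assumes "(gs, h) \<in> word_dom C (Suc n)" "h' \<in> Mor C" "src C h' = tgt C (last gs)" "cmp C h' (last gs) = h"
    "i \<le> n"
  shows "(butlast gs, h') \<in> word_dom C n"
    and "lend C (butlast gs, h') i = lend C (gs, h) i"
    and "rend C (butlast gs, h') i = rend C (gs, h) i"
    and "lend C (gs, h) (Suc n) = rend C (gs, h) (Suc n)"
proof -
  have len: "length gs = Suc n" using assms by (simp add: word_dom_def)
  then have "gs \<noteq> []" by auto
  then have m: "last gs \<in> Mor C" "length gs = Suc n" "last gs = gs ! n"
    using assms(1) len by (auto simp: word_dom_def last_conv_nth)
  note e = cmp_ends[OF m(1) assms(2,3)]
  show "(butlast gs, h') \<in> word_dom C n"
    using assms by (auto simp: word_dom_def dest: in_set_butlastD)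
  show "lend C (butlast gs, h') i = lend C (gs, h) i"
    using assms m e by (auto simp: lend_def nth_butlast)
  show "rend C (butlast gs, h') i = rend C (gs, h) i"
    using assms m e by (auto simp: rend_def nth_butlast)
  show "lend C (gs, h) (Suc n) = rend C (gs, h) (Suc n)"
    using assms m e by (auto simp: rend_def lend_def)
qed

text \<open>Every term of the differential erases a place at which the ends agree, so a gap of
  \<open>w\<close> survives in each word at which \<open>\<Phi>\<close> is evaluated. With the next
  lemma this splits the complex into two summands.\<close>

lemma word_diff_closed_support:
  assumes \<Phi>: "\<And>w. w \<notin> closed_words C n \<Longrightarrow> \<Phi> w = 0" and w: "w \<notin> closed_words C (Suc n)"
  shows "word_diff C n \<Phi> w = 0"
proof (cases "w \<in> word_dom C (Suc n)")
  case True
  obtain gs h where gh: "w = (gs, h)" by (cases w)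
  obtain i where i: "i \<le> Suc n" "lend C (gs, h) i \<noteq> rend C (gs, h) i"
    using True w gh by (auto simp: closed_words_def)
  have dom: "(gs, h) \<in> word_dom C (Suc n)" using True gh by simp
  have 1: "\<Phi> (tl gs, h') = 0" if "h' \<in> Mor C" "src C (hd gs) = tgt C h'" "cmp C (hd gs) h' = h" for h'
  proof -
    note t = lend_rend_tl[OF dom that]
    have "i \<noteq> 0" using i t(4) by (cases i) auto
    then have "lend C (tl gs, h') (i - 1) \<noteq> rend C (tl gs, h') (i - 1)" "i - 1 \<le> n"
      using t(2,3)[of "i - 1"] i by auto
    then show ?thesis using \<Phi> by (auto simp: closed_words_def)
  qed
  have 2: "\<Phi> (merge (cmp C) j gs, h) = 0"
    if "j \<in> {1..n}" "src C (gs ! (j - 1)) = tgt C (gs ! j)" for j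
  proof -
    \<comment> \<open>The place to which the gap \<open>i\<close> moves once place \<open>j\<close>
      is erased.\<close>
    let ?i = "if i < j then i else i - 1"
    have "length gs = Suc n" using dom by (auto simp: word_dom_def)
    then have "i \<noteq> j" using i that by (auto simp: lend_def rend_def)
    then have "?i \<le> n" "(if ?i < j then ?i else Suc ?i) = i" using i that by auto
    then have "lend C (merge (cmp C) j gs, h) ?i \<noteq> rend C (merge (cmp C) j gs, h) ?i"
      using lend_rend_merge[OF dom, of j ?i] that i by auto
    then show ?thesis using \<Phi> \<open>?i \<le> n\<close> unfolding closed_words_def by blast
  qed
  have 3: "\<Phi> (butlast gs, h') = 0" if "h' \<in> Mor C" "src C h' = tgt C (last gs)" "cmp C h' (last gs) = h" for h'
  proof -
    note t = lend_rend_butlast[OF dom that]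
    have "i \<noteq> Suc n" using i t(4) by auto
    then have "lend C (butlast gs, h') i \<noteq> rend C (butlast gs, h') i" "i \<le> n"
      using t(2,3)[of i] i by auto
    then show ?thesis using \<Phi> by (auto simp: closed_words_def)
  qed
  show ?thesis
    unfolding word_diff_def gh using 1 2 3 by (simp add: sum.neutral)
qed (auto simp: word_diff_def split: prod.splits)


text \<open>Erasing a place cannot create a gap, so from a closed word the differential reaches
  closed words only.\<close>

lemma word_diff_closed_zero:
  assumes \<Phi>: "\<And>w. w \<in> closed_words C n \<Longrightarrow> \<Phi> w = 0" and w: "w \<in> closed_words C (Suc n)"
  shows "word_diff C n \<Phi> w = 0"
proof -
  obtain gs h where gh: "w = (gs, h)" by (cases w)
  have dom: "(gs, h) \<in> word_dom C (Suc n)" using w gh by (simp add: closed_words_def)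
  have cl: "lend C (gs, h) i = rend C (gs, h) i" if "i \<le> Suc n" for i
    using w that gh by (simp add: closed_words_def)
  have 1: "\<Phi> (tl gs, h') = 0" if "h' \<in> Mor C" "src C (hd gs) = tgt C h'" "cmp C (hd gs) h' = h" for h'
    using lend_rend_tl[OF dom that] cl by (intro \<Phi>) (auto simp: closed_words_def)
  have 2: "\<Phi> (merge (cmp C) j gs, h) = 0"
    if "j \<in> {1..n}" "src C (gs ! (j - 1)) = tgt C (gs ! j)" for j
    using lend_rend_merge[OF dom, of j] merge_word[OF dom, of j] cl that
    by (intro \<Phi>) (auto simp: closed_words_def)
  have 3: "\<Phi> (butlast gs, h') = 0" if "h' \<in> Mor C" "src C h' = tgt C (last gs)" "cmp C h' (last gs) = h" for h'
    using lend_rend_butlast[OF dom that] cl by (intro \<Phi>) (auto simp: closed_words_def)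
  show ?thesis
    unfolding word_diff_def gh using 1 2 3 by (simp add: sum.neutral)
qed

end

section \<open>The contraction on words with a gap\<close>

lemma sum_skip:
  fixes f :: "nat \<Rightarrow> 'a::comm_monoid_add"
  assumes "1 \<le> i" "i \<le> Suc m"
  shows "(\<Sum>j=1..Suc m. f j) = f i + (\<Sum>j=1..m. if j < i then f j else f (Suc j))"
  using assms
proof (induction m)
  case (Suc m)
  show ?case
  proof (cases "i \<le> Suc m")
    case True
    then show ?thesis using Suc by (simp add: ac_simps)
  next
    case False
    then have "i = Suc (Suc m)" using Suc by simp
    moreover have "(\<Sum>j=1..Suc m. if j < i then f j else f (Suc j)) = (\<Sum>j=1..Suc m. f j)"
      using calculation by (intro sum.cong) auto
    ultimately show ?thesis by (simp add: ac_simps)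
  qed
qed simp

lemma length_fill: "i \<le> length gs \<Longrightarrow> length (fill C i (gs, h)) = Suc (length gs)"
  by (simp add: fill_def)

lemma nth_fill:
  "i \<le> length gs \<Longrightarrow> k \<le> length gs \<Longrightarrow> fill C i (gs, h) ! k =
    (if k < i then gs ! k else if k = i then idm C (lend C (gs, h) i) else gs ! (k - 1))"
  by (auto simp: fill_def nth_append nth_Cons' min_def)

context category
begin

lemma lend_in_Ob:
  assumes "(gs, h) \<in> word_dom C n" "i \<le> n"
  shows "lend C (gs, h) i \<in> Ob C"
  using assms by (cases i) (auto simp: lend_def word_dom_def intro!: src_in_Ob tgt_in_Ob)

lemma fill_word_dom:
  assumes "(gs, h) \<in> word_dom C n" "i \<le> n"
  shows "(fill C i (gs, h), h) \<in> word_dom C (Suc n)"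
  using assms lend_in_Ob[OF assms] idm_ends
  by (auto simp: word_dom_def fill_def dest: in_set_takeD in_set_dropD)

text \<open>Evaluate the cocycle condition at the filled word. Place \<open>i\<close> gives back the
  word and place \<open>i + 1\<close> gives 0. All other terms commute with filling: composing in
  front of the gap moves it to \<open>i - 1\<close>, which costs a sign, while composing behind it
  leaves it at \<open>i\<close> but has its own index shifted by the inserted letter, which costs
  the same sign.\<close>

lemma word_htpy_homotopy:
  fixes \<Phi> :: "'m list \<times> 'm \<Rightarrow> 'k::field"
  assumes dom: "(gs, h) \<in> word_dom C (Suc m)" and gap: "first_gap C (gs, h) i"
    and cocycle: "word_diff C (Suc m) \<Phi> = 0"
  shows "word_diff C m (word_htpy C m \<Phi>) (gs, h) = \<Phi> (gs, h)"
proof -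
  let ?n = "Suc m" and ?gs = "fill C i (gs, h)" and ?\<Theta> = "word_htpy C m \<Phi>"
  define x where "x = lend C (gs, h) i"
  have len: "length gs = ?n" and mor: "\<And>k. k < ?n \<Longrightarrow> gs ! k \<in> Mor C" and h: "h \<in> Mor C"
    using dom by (auto simp: word_dom_def)
  have i: "i \<le> ?n" "x \<noteq> rend C (gs, h) i" "\<And>j. j < i \<Longrightarrow> lend C (gs, h) j = rend C (gs, h) j"
    using gap len by (auto simp: first_gap_def x_def)
  note idx = idm_ends[OF lend_in_Ob[OF dom i(1), folded x_def]]
  note fdom = fill_word_dom[OF dom i(1)]
  have flen: "length ?gs = Suc ?n" using length_fill[of i gs] i len by simp
  have fnth: "?gs ! k = (if k < i then gs ! k else if k = i then idm C x else gs ! (k - 1))"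
    if "k \<le> ?n" for k
    using nth_fill[of i gs k C h] i(1) len that by (simp add: x_def)
  have ne: "gs \<noteq> []" "?gs \<noteq> []" using len flen by auto
  have hdgs: "hd gs = gs ! 0" "last gs = gs ! m" and hdf: "hd ?gs = ?gs ! 0" "last ?gs = ?gs ! ?n"
    using ne len flen by (auto simp: hd_conv_nth last_conv_nth)
  define A where "A = (\<Sum>h' | h' \<in> Mor C \<and> src C (hd gs) = tgt C h' \<and> cmp C (hd gs) h' = h. ?\<Theta> (tl gs, h'))"
  define A' where "A' = (\<Sum>h' | h' \<in> Mor C \<and> src C (hd ?gs) = tgt C h' \<and> cmp C (hd ?gs) h' = h. \<Phi> (tl ?gs, h'))"
  define S where "S j = (if src C (gs ! (j - 1)) = tgt C (gs ! j) then ?\<Theta> (merge (cmp C) j gs, h) else 0)" for j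
  define T where "T j = (if src C (?gs ! (j - 1)) = tgt C (?gs ! j) then \<Phi> (merge (cmp C) j ?gs, h) else 0)" for j
  define Z where "Z = (\<Sum>h' | h' \<in> Mor C \<and> src C h' = tgt C (last gs) \<and> cmp C h' (last gs) = h. ?\<Theta> (butlast gs, h'))"
  define Z' where "Z' = (\<Sum>h' | h' \<in> Mor C \<and> src C h' = tgt C (last ?gs) \<and> cmp C h' (last ?gs) = h. \<Phi> (butlast ?gs, h'))"
  have diff: "word_diff C m ?\<Theta> (gs, h) = A + (\<Sum>j=1..m. (-1) ^ j * S j) + (-1) ^ (m + 1) * Z"
    using dom by (simp add: word_diff_def A_def S_def Z_def)
  have "word_diff C (Suc m) \<Phi> (?gs, h) = A' + (\<Sum>j=1..Suc m. (-1) ^ j * T j) + (-1) ^ (Suc m + 1) * Z'"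
    using fdom by (simp add: word_diff_def A'_def T_def Z'_def)
  then have diff': "A' + (\<Sum>j=1..Suc m. (-1) ^ j * T j) + (-1) ^ (Suc m + 1) * Z' = 0"
    by (simp add: cocycle)
  \<comment> \<open>A gap at place 0 puts the identity of \<open>tgt C h\<close> in front, and the
    only \<open>h'\<close> that it multiplies to \<open>h\<close> is \<open>h\<close>; the first
    letter of \<open>gs\<close> has another target than \<open>h\<close> and divides it in no
    way.\<close>
  have A0: "A' = \<Phi> (gs, h)" "A = 0" if "i = 0"
  proof -
    have e: "hd ?gs = idm C x" "tl ?gs = gs" using that by (auto simp: fill_def x_def)
    have "x = tgt C h" using that by (simp add: x_def lend_def)
    then have "x = tgt C h' \<and> cmp C (idm C x) h' = h \<longleftrightarrow> h' = h" if "h' \<in> Mor C" for h'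
      using cmp_idm_tgt[OF that] cmp_idm_tgt[OF h] by metis
    then have e': "{h' \<in> Mor C. x = tgt C h' \<and> cmp C (idm C x) h' = h} = {h}"
      using h by blast
    show "A' = \<Phi> (gs, h)" unfolding A'_def e idx(2) e' by simp
    show "A = 0"
    proof -
      have e: "{h' \<in> Mor C. src C (hd gs) = tgt C h' \<and> cmp C (hd gs) h' = h} = {}"
        using lend_rend_tl(4)[OF dom, where i = 0] i(2) that by (auto simp: x_def)
      show ?thesis unfolding A_def e by simp
    qed
  qed
  \<comment> \<open>Otherwise the first letter is the same in both words; removing it lowers the
    position of the gap by one, hence the minus sign.\<close>
  have A1: "(-1) ^ i * A' = - A" if "i \<noteq> 0"
  proof -
    have hd: "hd ?gs = hd gs" using that hdf hdgs fnth by simp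
    have "?\<Theta> (tl gs, h') = - ((-1) ^ i * \<Phi> (tl ?gs, h'))"
      if h': "h' \<in> Mor C" "src C (hd gs) = tgt C h'" "cmp C (hd gs) h' = h" for h'
    proof -
      note t = lend_rend_tl[OF dom h']
      have x: "lend C (tl gs, h') (i - 1) = x"
        using t(2)[of "i - 1"] i \<open>i \<noteq> 0\<close> by (simp add: x_def)
      have "first_gap C (tl gs, h') (i - 1)"
        unfolding first_gap_def using t(2,3) i \<open>i \<noteq> 0\<close> len x by (auto simp: x_def)
      then have "?\<Theta> (tl gs, h') = (-1) ^ (i - 1) * \<Phi> (fill C (i - 1) (tl gs, h'), h')"
        using word_htpy_first_gap[OF t(1)] by fastforce
      moreover have "fill C (i - 1) (tl gs, h') = tl ?gs"
        using \<open>i \<noteq> 0\<close> ne x by (cases gs; cases i) (auto simp: fill_def x_def)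
      ultimately show ?thesis using \<open>i \<noteq> 0\<close> by (cases i) auto
    qed
    then have "A = (\<Sum>h' | h' \<in> Mor C \<and> src C (hd gs) = tgt C h' \<and> cmp C (hd gs) h' = h.
        - ((-1) ^ i * \<Phi> (tl ?gs, h')))"
      unfolding A_def by (intro sum.cong) auto
    then show ?thesis by (simp add: A'_def hd sum_negf sum_distrib_left)
  qed
  \<comment> \<open>With the gap at the end, both the inserted identity and the last letter of
    \<open>gs\<close> have source \<open>x\<close>, which differs from \<open>src C h\<close>; so
    neither is a right factor of \<open>h\<close>.\<close>
  have Z0: "Z' = 0" "Z = 0" if "i = ?n"
  proof -
    have "src C (cmp C h' (idm C x)) \<noteq> src C h \<or> src C h' \<noteq> x" if "h' \<in> Mor C" for h'
      using cmp_ends(2)[OF idx(1) that] idx \<open>i = ?n\<close> i(2) len by (auto simp: rend_def)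
    moreover have "last ?gs = idm C x" using hdf fnth that by simp
    ultimately have e: "{h' \<in> Mor C. src C h' = tgt C (last ?gs) \<and> cmp C h' (last ?gs) = h} = {}"
      using idx by auto
    show "Z' = 0" unfolding Z'_def e by simp
    have e: "{h' \<in> Mor C. src C h' = tgt C (last gs) \<and> cmp C h' (last gs) = h} = {}"
      using lend_rend_butlast(4)[OF dom, where i = 0] i(2) that by (auto simp: x_def)
    show "Z = 0" unfolding Z_def e by simp
  qed
  have Z1: "(-1) ^ i * Z' = Z" if "i \<noteq> ?n"
  proof -
    have lst: "last ?gs = last gs" using that hdf hdgs fnth i by simp
    have "?\<Theta> (butlast gs, h') = (-1) ^ i * \<Phi> (butlast ?gs, h')"
      if h': "h' \<in> Mor C" "src C h' = tgt C (last gs)" "cmp C h' (last gs) = h" for h'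
    proof -
      note t = lend_rend_butlast[OF dom h']
      have x: "lend C (butlast gs, h') i = x"
        using t(2)[of i] i \<open>i \<noteq> ?n\<close> by (simp add: x_def)
      have "first_gap C (butlast gs, h') i"
        unfolding first_gap_def using t(2,3) i \<open>i \<noteq> ?n\<close> len x by (auto simp: x_def)
      then have "?\<Theta> (butlast gs, h') = (-1) ^ i * \<Phi> (fill C i (butlast gs, h'), h')"
        using word_htpy_first_gap[OF t(1)] by fastforce
      moreover have "fill C i (butlast gs, h') = butlast ?gs"
        using \<open>i \<noteq> ?n\<close> i(1) len x by (auto simp: fill_def x_def butlast_append take_butlast drop_butlast)
      ultimately show ?thesis by simp
    qed
    then have "Z = (\<Sum>h' | h' \<in> Mor C \<and> src C h' = tgt C (last gs) \<and> cmp C h' (last gs) = h.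
        (-1) ^ i * \<Phi> (butlast ?gs, h'))"
      unfolding Z_def by (intro sum.cong) auto
    then show ?thesis by (simp add: Z'_def lst sum_distrib_left)
  qed
  have Ti: "T i = \<Phi> (gs, h)" if "i \<noteq> 0"
  proof -
    have g: "src C (gs ! (i - 1)) = x" using that by (simp add: x_def lend_def)
    have g': "gs ! (i - 1) \<in> Mor C" using mor i that by simp
    then have "cmp C (gs ! (i - 1)) (idm C x) = gs ! (i - 1)"
      using cmp_idm_src[OF g'] g by simp
    then have "merge (cmp C) i ?gs = gs"
      using that i len flen by (intro nth_equalityI) (auto simp: length_merge nth_merge fnth)
    then show ?thesis using that i idx g by (simp add: T_def fnth)
  qed
  \<comment> \<open>Here and in \<open>Si\<close> one would have to compose across the gap: in the
    filled word the identity with its right neighbour, in \<open>gs\<close> the two letters around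
    the gap.\<close>
  have Ti1: "T (Suc i) = 0" if "i \<noteq> ?n"
    using that i idx len by (simp add: T_def fnth rend_def)
  have Si: "S i = 0" if "i \<noteq> 0" "i \<noteq> ?n"
    using that i len by (simp add: S_def rend_def lend_def x_def)
  \<comment> \<open>In front of the first gap all places match, so this term is present in both
    sums.\<close>
  have T1: "T j = - ((-1) ^ i * S j)" if j: "1 \<le> j" "j < i" "j \<le> m" for j
  proof -
    have c: "src C (gs ! (j - 1)) = tgt C (gs ! j)"
      using i(3)[OF j(2)] j len by (simp add: lend_def rend_def)
    note t = lend_rend_merge[OF dom j(1,3) c]
    have x: "lend C (merge (cmp C) j gs, h) (i - 1) = x"
      using t(1)[of "i - 1"] i(1) j by (cases i) (auto simp: x_def)
    have "first_gap C (merge (cmp C) j gs, h) (i - 1)"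
      unfolding first_gap_def using t i j len x by (auto simp: x_def length_merge)
    then have "?\<Theta> (merge (cmp C) j gs, h) = (-1) ^ (i - 1) * \<Phi> (fill C (i - 1) (merge (cmp C) j gs, h), h)"
      using word_htpy_first_gap[OF merge_word[OF dom j(1,3) c]] by fastforce
    moreover have "fill C (i - 1) (merge (cmp C) j gs, h) = merge (cmp C) j ?gs"
    proof (rule nth_equalityI)
      obtain j' i' where s: "j = Suc j'" "i = Suc i'" using j by (cases j; cases i) auto

      have lm: "length (merge (cmp C) j gs) = m" using j len by (simp add: length_merge)
      then show "length (fill C (i - 1) (merge (cmp C) j gs, h)) = length (merge (cmp C) j ?gs)"
        using j i(1) flen by (simp add: length_fill length_merge)
      fix k assume "k < length (fill C (i - 1) (merge (cmp C) j gs, h))"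
      then have k: "k \<le> m" using lm j i(1) by (simp add: length_fill)
      have f1: "fill C (i - 1) (merge (cmp C) j gs, h) ! k = (if k < (i - 1) then merge (cmp C) j gs ! k
          else if k = (i - 1) then idm C x else merge (cmp C) j gs ! (k - 1))"
        using nth_fill[of "i - 1" "merge (cmp C) j gs" k C h] lm j i(1) k x by simp
      have f2: "merge (cmp C) j ?gs ! k = (if k < j - 1 then ?gs ! k
          else if k = j - 1 then cmp C (?gs ! (j - 1)) (?gs ! j) else ?gs ! Suc k)"
        using nth_merge[of "j" ?gs k] flen j i(1) k by simp
      have f3: "merge (cmp C) j gs ! l = (if l < j - 1 then gs ! l
          else if l = j - 1 then cmp C (gs ! (j - 1)) (gs ! j) else gs ! Suc l)" if "l < m" for l
        using nth_merge[of j gs l] len j that by simp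
      consider "k < j - 1" | "k = j - 1" | "j \<le> k" "k < i - 1" | "j \<le> k" "k = i - 1" | "i - 1 < k"
        using j i(1) by linarith
      then show "fill C (i - 1) (merge (cmp C) j gs, h) ! k = merge (cmp C) j ?gs ! k"
        using j i(1) k unfolding f1 f2 unfolding s by cases (auto simp add: f3[unfolded s] fnth[unfolded s])
    qed
    moreover have "?gs ! (j - 1) = gs ! (j - 1)" "?gs ! j = gs ! j" using j i(1) by (auto simp: fnth)
    ultimately have "T j = \<Phi> (merge (cmp C) j ?gs, h)" "S j = (-1) ^ (i - 1) * \<Phi> (merge (cmp C) j ?gs, h)"
      using c by (simp_all add: S_def T_def)
    moreover obtain i' where "i = Suc i'" using j by (cases i) auto
    ultimately show ?thesis by (simp flip: power_add mult.assoc)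
  qed
  \<comment> \<open>Behind the first gap there may be further gaps; if place \<open>j\<close> is one
    of them, the terms vanish in both sums.\<close>
  have T2: "T (Suc j) = (-1) ^ i * S j" if j: "i < j" "j \<le> m" for j
  proof (cases "src C (gs ! (j - 1)) = tgt C (gs ! j)")
    case c: True
    have j1: "1 \<le> j" using j by simp
    note t = lend_rend_merge[OF dom j1 j(2) c]
    have x: "lend C (merge (cmp C) j gs, h) i = x"
      using t(1)[of i] i(1) j by (simp add: x_def)
    have "first_gap C (merge (cmp C) j gs, h) i"
      unfolding first_gap_def using t i j len x by (auto simp: x_def length_merge)
    then have "?\<Theta> (merge (cmp C) j gs, h) = (-1) ^ i * \<Phi> (fill C i (merge (cmp C) j gs, h), h)"
      using word_htpy_first_gap[OF merge_word[OF dom j1 j(2) c]] by fastforce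
    moreover have "fill C i (merge (cmp C) j gs, h) = merge (cmp C) (Suc j) ?gs"
    proof (rule nth_equalityI)
      obtain j' where s: "j = Suc j'" using j by (cases j) auto

      have lm: "length (merge (cmp C) j gs) = m" using j len by (simp add: length_merge)
      then show "length (fill C i (merge (cmp C) j gs, h)) = length (merge (cmp C) (Suc j) ?gs)"
        using j i(1) flen by (simp add: length_fill length_merge)
      fix k assume "k < length (fill C i (merge (cmp C) j gs, h))"
      then have k: "k \<le> m" using lm j i(1) by (simp add: length_fill)
      have f1: "fill C i (merge (cmp C) j gs, h) ! k = (if k < i then merge (cmp C) j gs ! k
          else if k = i then idm C x else merge (cmp C) j gs ! (k - 1))"
        using nth_fill[of "i" "merge (cmp C) j gs" k C h] lm j i(1) k x by simp
      have f2: "merge (cmp C) (Suc j) ?gs ! k = (if k < (Suc j) - 1 then ?gs ! k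
          else if k = (Suc j) - 1 then cmp C (?gs ! ((Suc j) - 1)) (?gs ! (Suc j)) else ?gs ! Suc k)"
        using nth_merge[of "Suc j" ?gs k] flen j i(1) k by simp
      have f3: "merge (cmp C) j gs ! l = (if l < j - 1 then gs ! l
          else if l = j - 1 then cmp C (gs ! (j - 1)) (gs ! j) else gs ! Suc l)" if "l < m" for l
        using nth_merge[of j gs l] len j that by simp
      consider "k < i" | "k = i" | "i < k" "k < j" | "k = j" | "j < k"
        using j i(1) by linarith
      then show "fill C i (merge (cmp C) j gs, h) ! k = merge (cmp C) (Suc j) ?gs ! k"
        using j i(1) k unfolding f1 f2 unfolding s by cases (auto simp add: f3[unfolded s] fnth)
    qed
    moreover have "?gs ! j = gs ! (j - 1)" "?gs ! Suc j = gs ! j" using j by (auto simp: fnth)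
    ultimately have "T (Suc j) = \<Phi> (merge (cmp C) (Suc j) ?gs, h)"
      "S j = (-1) ^ i * \<Phi> (merge (cmp C) (Suc j) ?gs, h)"
      using c by (simp_all add: S_def T_def)
    then show ?thesis by (simp flip: power_add mult.assoc)
  next
    case False
    then show ?thesis using j i by (simp add: S_def T_def fnth)
  qed
  have sgn: "(-1) ^ i * ((-1) ^ i * y) = (y :: 'k)" for y
    by (simp flip: power_add mult.assoc)
  have sum: "(\<Sum>j=1..Suc m. (-1) ^ j * T j) =
      (if i = 0 then 0 else (-1) ^ i * \<Phi> (gs, h)) - (-1) ^ i * (\<Sum>j=1..m. (-1) ^ j * S j)"
  proof -
    \<comment> \<open>For \<open>i = 0\<close> the term that gives back the word is
      \<open>A'\<close>, outside the inner sum. Place 1 is then split off instead, where the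
      identity meets the gap and the term is 0.\<close>
    define i' where "i' = (if i = 0 then 1 else i)"
    have i': "1 \<le> i'" "i' \<le> Suc m" using i by (auto simp: i'_def)
    have "(if j < i' then (-1) ^ j * T j else (-1) ^ Suc j * T (Suc j)) = - ((-1) ^ i * ((-1) ^ j * S j))"
      if "j \<in> {1..m}" for j
    proof -
      consider "j < i" | "j = i" | "i < j" by linarith
      then show ?thesis
        using that T1[of j] T2[of j] Ti1 Si by cases (auto simp: i'_def)
    qed
    then have "(\<Sum>j=1..Suc m. (-1) ^ j * T j) =
        (-1) ^ i' * T i' + (\<Sum>j=1..m. - ((-1) ^ i * ((-1) ^ j * S j)))"
      unfolding sum_skip[OF i'] by (intro arg_cong2[where f = "(+)"] sum.cong) auto
    then show ?thesis using Ti Ti1 by (auto simp: i'_def sum_negf sum_distrib_left)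
  qed
  have Z: "(-1) ^ i * Z' = Z" using Z0 Z1 by (cases "i = ?n") auto
  have A: "(-1) ^ i * A' = (if i = 0 then \<Phi> (gs, h) else 0) - A" using A0 A1 by auto
  \<comment> \<open>The right-hand side is the homotopy applied to
    \<open>word_diff C (Suc m) \<Phi>\<close>, evaluated at \<open>(gs, h)\<close>.\<close>
  have "0 = (-1) ^ i * (A' + (\<Sum>j=1..Suc m. (-1) ^ j * T j) + (-1) ^ (Suc m + 1) * Z')"
    unfolding diff' by simp
  also have "\<dots> = (-1) ^ i * A' + (-1) ^ i * (\<Sum>j=1..Suc m. (-1) ^ j * T j) + (-1) ^ m * ((-1) ^ i * Z')"
    by (simp add: distrib_left)
  also have "\<dots> = \<Phi> (gs, h) - word_diff C m ?\<Theta> (gs, h)"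
    unfolding sum A Z diff right_diff_distrib sgn by (auto simp: sgn)
  finally show ?thesis by simp
qed

end

section \<open>Closed words and the nerve of the adjoint category\<close>

text \<open>
  The property of groupoids and posets that the comparison uses: a nonempty \<open>Hom C x y\<close> is a torsor under
  the endomorphisms of \<open>x\<close> and under those of \<open>y\<close>.
\<close>

locale torsor_category = category +
  assumes right_quotient: "g \<in> Hom C x y \<Longrightarrow> h \<in> Hom C x y \<Longrightarrow> \<exists>!a. a \<in> Hom C x x \<and> cmp C g a = h"
    and left_quotient: "g \<in> Hom C x y \<Longrightarrow> h \<in> Hom C x y \<Longrightarrow> \<exists>!b. b \<in> Hom C y y \<and> cmp C b g = h"

lemma groupoid_torsor:
  assumes "groupoid C"
  shows "torsor_category C"
proof -
  interpret groupoid C by fact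
  show ?thesis
  proof
    fix g h x y assume g: "g \<in> Hom C x y" and h: "h \<in> Hom C x y"
    obtain g' where g': "g' \<in> Hom C y x" "cmp C g' g = idm C x" "cmp C g g' = idm C y"
      using invertible[OF g] by blast
    show "\<exists>!a. a \<in> Hom C x x \<and> cmp C g a = h"
    proof (rule ex1I[of _ "cmp C g' h"])
      show "cmp C g' h \<in> Hom C x x \<and> cmp C g (cmp C g' h) = h"
        using cmp_in_Hom[OF h g'(1)] cmp_assoc[OF h g'(1) g] cmp_idm_left[OF h] g'(3) by simp
      show "a = cmp C g' h" if "a \<in> Hom C x x \<and> cmp C g a = h" for a
        using that cmp_assoc[of a x x g y g' x] g g'(1,2) cmp_idm_left[of a x x] by auto
    qed
    show "\<exists>!b. b \<in> Hom C y y \<and> cmp C b g = h"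
    proof (rule ex1I[of _ "cmp C h g'"])
      show "cmp C h g' \<in> Hom C y y \<and> cmp C (cmp C h g') g = h"
        using cmp_in_Hom[OF g'(1) h] cmp_assoc[OF g g'(1) h] cmp_idm_right[OF h] g'(2) by simp
      show "b = cmp C h g'" if "b \<in> Hom C y y \<and> cmp C b g = h" for b
        using that cmp_assoc[of g' y x g y b y] g g'(1,3) cmp_idm_right[of b y y] by auto
    qed
  qed
qed

text \<open>Hom sets have at most one element, so the identity is the only endomorphism of its
  object and the quotient of any two parallel morphisms.\<close>

lemma poset_torsor:
  assumes "poset_category C"
  shows "torsor_category C"
proof -
  interpret poset_category C by fact
  have Ob: "x \<in> Ob C" "y \<in> Ob C" if "f \<in> Hom C x y" for f x y
    using that src_in_Ob tgt_in_Ob by (auto simp: Hom_def)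
  have unique: "f = g" if f: "f \<in> Hom C x y" and g: "g \<in> Hom C x y" for f g x y
  proof -
    obtain r where "if (x, y) \<in> r then \<exists>!f. f \<in> Hom C x y else Hom C x y = {}"
      using partial_order Ob[OF f] by blast
    then have "\<exists>!f. f \<in> Hom C x y" using f by (auto split: if_splits)
    then show ?thesis using f g by blast
  qed
  show ?thesis
  proof
    fix g h x y assume g: "g \<in> Hom C x y" and h: "h \<in> Hom C x y"
    note id = idm_in_Hom[OF Ob(1)[OF g]] idm_in_Hom[OF Ob(2)[OF g]]
    have "cmp C g (idm C x) = h" "cmp C (idm C y) g = h"
      using unique[OF g h] cmp_idm_right[OF g] cmp_idm_left[OF g] by simp_all
    then show "\<exists>!a. a \<in> Hom C x x \<and> cmp C g a = h" "\<exists>!b. b \<in> Hom C y y \<and> cmp C b g = h"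
      using id unique by blast+
  qed
qed

section \<open>Cancellation\<close>

context torsor_category
begin

text \<open>The torsor axioms cancel a morphism against endomorphisms only. So write
  \<open>b = a c\<close> with an endomorphism \<open>c\<close>; then \<open>(u a) c = u a\<close>,
  and uniqueness of the quotient of \<open>u a\<close> by itself forces \<open>c\<close> to be an
  identity. \<open>cmp_epi\<close> is the mirror image.\<close>

lemma cmp_mono:
  assumes "u \<in> Mor C" "a \<in> Mor C" "b \<in> Mor C" "src C u = tgt C a" "src C u = tgt C b" "cmp C u a = cmp C u b"
  shows "a = b"
proof -
  have s: "src C a = src C b" using cmp_ends(2) assms by metis
  have ab: "a \<in> Hom C (src C a) (tgt C a)" "b \<in> Hom C (src C a) (tgt C a)"
    using assms s by (auto simp: Hom_def)
  then obtain c where c: "c \<in> Hom C (src C a) (src C a)" "cmp C a c = b"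
    using right_quotient by blast
  have ua: "cmp C u a \<in> Hom C (src C a) (tgt C u)" using cmp_ends[of a u] assms by (simp add: Hom_def)
  have "cmp C (cmp C u a) c = cmp C u a"
    using cmp_assoc[OF c(1), of a "tgt C a" u "tgt C u"] c(2) assms by (auto simp: Hom_def)
  then have "c = idm C (src C a)"
    using right_quotient[OF ua ua] c(1) cmp_idm_right[OF ua] idm_in_Hom[OF src_in_Ob[OF assms(2)]] by blast
  then show ?thesis using c(2) cmp_idm_src[OF assms(2)] by simp
qed

lemma cmp_epi:
  assumes "u \<in> Mor C" "a \<in> Mor C" "b \<in> Mor C" "src C a = tgt C u" "src C b = tgt C u" "cmp C a u = cmp C b u"
  shows "a = b"
proof -
  have s: "tgt C a = tgt C b" using cmp_ends(3) assms by metis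
  have ab: "a \<in> Hom C (src C a) (tgt C a)" "b \<in> Hom C (src C a) (tgt C a)"
    using assms s by (auto simp: Hom_def)
  then obtain c where c: "c \<in> Hom C (tgt C a) (tgt C a)" "cmp C c a = b"
    using left_quotient by blast
  have au: "cmp C a u \<in> Hom C (src C u) (tgt C a)" using cmp_ends[of u a] assms by (simp add: Hom_def)
  have "cmp C c (cmp C a u) = cmp C a u"
    using cmp_assoc[OF _ _ c(1), of u "src C u" "tgt C u" a] c(2) assms by (auto simp: Hom_def)
  then have "c = idm C (tgt C a)"
    using left_quotient[OF au au] c(1) cmp_idm_left[OF au] idm_in_Hom[OF tgt_in_Ob[OF assms(2)]] by blast
  then show ?thesis using c(2) cmp_idm_tgt[OF assms(2)] by simp
qed

end

section \<open>Paths and their composites\<close>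

fun linked :: "('o, 'm) cat \<Rightarrow> 'm list \<Rightarrow> 'o \<Rightarrow> 'o \<Rightarrow> bool"
  where "linked C [] x y \<longleftrightarrow> x = y"
  | "linked C (g # gs) x y \<longleftrightarrow> g \<in> Mor C \<and> tgt C g = x \<and> linked C gs (src C g) y"

lemma linked_append: "linked C (us @ vs) x y \<longleftrightarrow> (\<exists>z. linked C us x z \<and> linked C vs z y)"
  by (induction us arbitrary: x) auto

text \<open>These are the equations of \<open>closed_words\<close> with the outer objects
  \<open>tgt C h\<close> and \<open>src C h\<close> freed to \<open>x\<close> and \<open>y\<close>,
  so that an induction on the letters can move \<open>x\<close>.\<close>

lemma linked_iff:
  "linked C gs x y \<longleftrightarrow> set gs \<subseteq> Mor C \<and>
    (\<forall>i\<le>length gs. (if i = 0 then x else src C (gs ! (i - 1))) = (if i < length gs then tgt C (gs ! i) else y))"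
proof (induction gs arbitrary: x)
  case (Cons g gs)
  have "(\<forall>i\<le>Suc n. P i) \<longleftrightarrow> P 0 \<and> (\<forall>i\<le>n. P (Suc i))" for P and n :: nat
    by (metis Suc_le_mono le0 not0_implies_Suc)
  then show ?case
    by (auto simp: Cons nth_Cons')
qed simp

lemma closed_words_iff:
  "(gs, h) \<in> closed_words C n \<longleftrightarrow> length gs = n \<and> h \<in> Mor C \<and> linked C gs (tgt C h) (src C h)"
  unfolding closed_words_def linked_iff word_dom_def lend_def rend_def 
  by (simp only: mem_Collect_eq prod.case) blast

context category
begin

text \<open>The fold is \<open>g_1 (g_2 ( ... (g_n a)))\<close>. Starting it with \<open>a\<close>
  covers the empty word as well, whose value is then \<open>a\<close>.\<close>

lemma linked_foldr:
  assumes "linked C gs x y" "a \<in> Mor C" "tgt C a = y"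
  shows "foldr (cmp C) gs a \<in> Mor C \<and> src C (foldr (cmp C) gs a) = src C a \<and> tgt C (foldr (cmp C) gs a) = x"
  using assms by (induction gs arbitrary: x) (auto simp: cmp_ends)

lemma cmp_assoc_Mor:
  assumes "f \<in> Mor C" "g \<in> Mor C" "h \<in> Mor C" "src C g = tgt C f" "src C h = tgt C g"
  shows "cmp C (cmp C h g) f = cmp C h (cmp C g f)"
  using cmp_assoc[of f "src C f" "tgt C f" g "tgt C g" h "tgt C h"] assms by (auto simp: Hom_def)

lemma linked_foldr_cmp:
  assumes "linked C gs x y" "a \<in> Mor C" "tgt C a = y" "b \<in> Mor C" "src C a = tgt C b"
  shows "foldr (cmp C) gs (cmp C a b) = cmp C (foldr (cmp C) gs a) b"
  using assms
proof (induction gs arbitrary: x)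
  case (Cons g gs)
  then show ?case
    using linked_foldr[of gs "src C g" y a] Cons.IH[of "src C g"] by (simp add: cmp_assoc_Mor)
qed simp

lemma linked_foldr_merge:
  assumes "linked C gs x y" "a \<in> Mor C" "tgt C a = y" "1 \<le> j" "j < length gs"
  shows "foldr (cmp C) (merge (cmp C) j gs) a = foldr (cmp C) gs a" "linked C (merge (cmp C) j gs) x y"
proof -
  obtain us p q vs where gs: "gs = us @ p # q # vs" "j = Suc (length us)"
    using split_at_merge[OF assms(4,5)] .
  have m: "merge (cmp C) j gs = us @ cmp C p q # vs"
    unfolding gs by (rule merge_append)
  from assms(1) have l: "p \<in> Mor C" "q \<in> Mor C" "tgt C q = src C p" "linked C vs (src C q) y"
    "linked C us x (tgt C p)"
    unfolding gs(1) by (auto simp: linked_append)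
  show "foldr (cmp C) (merge (cmp C) j gs) a = foldr (cmp C) gs a"
    unfolding m unfolding gs(1) using linked_foldr[OF l(4) assms(2,3)] l by (simp add: cmp_assoc_Mor)
  show "linked C (merge (cmp C) j gs) x y"
    unfolding m using l by (auto simp: linked_append cmp_ends)
qed

end

text \<open>The letters are monic and are cancelled one by one from the left. With the next lemma
  this gives the unique endomorphism \<open>a\<close> with \<open>h = g_1 ... g_n a\<close>.\<close>

lemma (in torsor_category) linked_foldr_inj:
  assumes "linked C gs x y" "a \<in> Mor C" "tgt C a = y" "b \<in> Mor C" "tgt C b = y"
    "foldr (cmp C) gs a = foldr (cmp C) gs b"
  shows "a = b"
  using assms
proof (induction gs arbitrary: x)
  case (Cons g gs)
  from Cons.prems have l: "g \<in> Mor C" "tgt C g = x" "linked C gs (src C g) y" by auto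
  note lf = linked_foldr[OF l(3)]
  have "cmp C g (foldr (cmp C) gs a) = cmp C g (foldr (cmp C) gs b)"
    using Cons.prems(6) by simp
  then have "foldr (cmp C) gs a = foldr (cmp C) gs b"
    using cmp_mono[OF l(1)] lf[OF Cons.prems(2,3)] lf[OF Cons.prems(4,5)] by metis
  then show ?case using Cons.IH[OF l(3) Cons.prems(2-5)] by blast
qed simp

lemma (in torsor_category) linked_foldr_surj:
  assumes "linked C gs x y" "h \<in> Mor C" "tgt C h = x" "src C h = y"
  shows "\<exists>a. a \<in> Mor C \<and> src C a = y \<and> tgt C a = y \<and> foldr (cmp C) gs a = h"
proof -
  have y: "y \<in> Ob C" using src_in_Ob assms by auto
  \<comment> \<open>Started with an identity, the fold is the composite of the word itself, which is
    parallel to \<open>h\<close>; their quotient is then moved into the start of the fold by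
    associativity.\<close>
  let ?u = "foldr (cmp C) gs (idm C y)"
  have "?u \<in> Hom C y x" "h \<in> Hom C y x"
    using linked_foldr[OF assms(1), of "idm C y"] idm_ends[OF y] assms by (auto simp: Hom_def)
  then obtain a where a: "a \<in> Hom C y y" "cmp C ?u a = h" using right_quotient by blast
  then have "foldr (cmp C) gs (cmp C (idm C y) a) = h"
    using linked_foldr_cmp[OF assms(1), of "idm C y" a] idm_ends[OF y] by (auto simp: Hom_def)
  then show ?thesis using a cmp_idm_left[OF a(1)] by (auto simp: Hom_def)
qed

section \<open>The nerve complex in coordinates\<close>

definition nerve_fun_diff :: "('o, 'm) cat \<Rightarrow> nat \<Rightarrow> ('o list \<times> 'm list \<Rightarrow> 'k) \<Rightarrow> 'o list \<times> 'm list \<Rightarrow> 'k::field"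
  where "nerve_fun_diff D m \<phi> c =
    (if c \<in> nerve D (Suc m) then \<Sum>i=0..m+1. (-1) ^ i * \<phi> (face D m i c) else 0)"

lemma cochain_complex_nerve:
  "cochain_complex (\<lambda>n. fun_space (nerve D n) :: ('k::field, _) vspace) (nerve_fun_diff D)"
  unfolding cochain_complex_def
proof (intro allI conjI vspace_on_fun_space)
  fix n
  show "linear_map (fun_space (nerve D n)) (fun_space (nerve D (Suc n))) (nerve_fun_diff D n :: (_ \<Rightarrow> 'k) \<Rightarrow> _)"
    unfolding linear_map_def
    by (auto simp: fun_space_def nerve_fun_diff_def fun_eq_iff sum.distrib distrib_left sum_distrib_left
      mult.left_commute right_diff_distrib)
qed

lemma (in category) face_nerve:
  assumes "c \<in> nerve C (Suc m)" "i \<le> m + 1"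
  shows "face C m i c \<in> nerve C m"
proof -
  obtain as gs where c: "c = (as, gs)" by (cases c)
  have as: "length as = Suc (Suc m)" "set as \<subseteq> Ob C" and gs: "length gs = Suc m"
    using assms(1) c by (auto simp: nerve_def)
  have hom: "gs ! k \<in> Hom C (as ! k) (as ! Suc k)" if "k \<le> m" for k
    using assms(1) c that by (auto simp: nerve_def)
  consider "i = 0" | "i = m + 1" | "1 \<le> i" "i \<le> m" using assms(2) by linarith
  then show ?thesis
  proof cases
    case 1
    moreover have "set (tl as) \<subseteq> set as" by (cases as) auto
    ultimately show ?thesis using as gs hom c
      by (auto simp: face_def nerve_def nth_tl)
  next
    case 2
    then show ?thesis using as gs hom c
      by (auto simp: face_def nerve_def nth_butlast dest: in_set_butlastD)
  next
    case 3
    let ?as = "take i as @ drop (Suc i) as" and ?gs = "merge (\<lambda>f g. cmp C g f) i gs"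
    have "?gs ! k \<in> Hom C (?as ! k) (?as ! Suc k)" if k: "k < m" for k
    proof -
      have g: "?gs ! k = (if k < i - 1 then gs ! k else if k = i - 1 then cmp C (gs ! i) (gs ! (i - 1)) else gs ! Suc k)"
        using nth_merge[of i gs k] 3 gs k by simp
      have a: "?as ! l = (if l < i then as ! l else as ! Suc l)" if "l \<le> m" for l
        using that as(1) 3 by (auto simp: nth_append)
      obtain i' where i': "i = Suc i'" using 3 by (cases i) auto
      consider "k < i'" | "k = i'" | "i' < k" by linarith
      then show ?thesis
        using cmp_in_Hom[OF hom[of i'] hom[of "Suc i'"]] hom[of k] hom[of "Suc k"] k 3 i'
        unfolding g unfolding i' by cases (simp_all add: a[unfolded i'])
    qed
    moreover have "length ?as = Suc m" "set ?as \<subseteq> Ob C" "length ?gs = m"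
      using as gs 3 by (auto simp: length_merge dest: in_set_takeD in_set_dropD)
    ultimately show ?thesis using 3 c by (simp add: face_def nerve_def)
  qed
qed

section \<open>Chains of the adjoint category as words\<close>

abbreviation arrow :: "'a \<times> 'b \<times> 'c \<Rightarrow> 'b"
  where "arrow t \<equiv> fst (snd t)"

text \<open>A product in \<open>kC\<close> has the morphism applied last on its left, hence the
  reversal. The objects of the chain are recorded only through
  \<open>h = g_{m-1} ... g_0 a_0\<close>.\<close>

definition nerve_word :: "('o, 'm) cat \<Rightarrow> 'm list \<times> ('m \<times> 'm \<times> 'm) list \<Rightarrow> 'm list \<times> 'm"
  where "nerve_word C = (\<lambda>(as, ts). (rev (map arrow ts), foldr (cmp C) (rev (map arrow ts)) (hd as)))"

lemma nerve_0: "(as, ts) \<in> nerve D 0 \<longleftrightarrow> (\<exists>a\<in>Ob D. as = [a]) \<and> ts = []"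
  by (auto simp: nerve_def length_Suc_conv)

text \<open>Chains are taken apart at their last arrow: it becomes the head of the reversed list of
  letters, and the first object stays fixed during the induction.\<close>

lemma nerve_Suc:
  "(as, ts) \<in> nerve D (Suc m) \<longleftrightarrow> (\<exists>as' ts' b t. as = as' @ [b] \<and> ts = ts' @ [t] \<and>
    (as', ts') \<in> nerve D m \<and> b \<in> Ob D \<and> t \<in> Hom D (last as') b)" (is "?L \<longleftrightarrow> ?R")
proof
  assume L: ?L
  then have "as \<noteq> []" "ts \<noteq> []" by (auto simp: nerve_def)
  then obtain as' b ts' t where e: "as = as' @ [b]" "ts = ts' @ [t]" by (metis rev_exhaust)
  have len: "length as' = Suc m" "length ts' = m" and h: "\<And>i. i < Suc m \<Longrightarrow> ts ! i \<in> Hom D (as ! i) (as ! Suc i)"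
    and s: "set as \<subseteq> Ob D"
    using L e by (auto simp: nerve_def)
  have "ts' ! i \<in> Hom D (as' ! i) (as' ! Suc i)" if "i < m" for i
    using h[of i] that len by (simp add: e nth_append)
  moreover have "t \<in> Hom D (as' ! m) b" using h[of m] len by (simp add: e nth_append)
  moreover have "last as' = as' ! m" using len by (cases as' rule: rev_cases) auto
  ultimately show ?R using e len s by (intro exI[of _ as'] exI[of _ ts'] exI[of _ b] exI[of _ t]) (auto simp: nerve_def)
next
  assume ?R
  then obtain as' b ts' t where e: "as = as' @ [b]" "ts = ts' @ [t]" "(as', ts') \<in> nerve D m" "b \<in> Ob D"
    "t \<in> Hom D (last as') b" by blast
  have len: "length as' = Suc m" "length ts' = m" using e by (auto simp: nerve_def)
  have "last as' = as' ! m" using len by (cases as' rule: rev_cases) auto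
  then show ?L using e len by (auto simp: nerve_def nth_append less_Suc_eq)
qed

lemma hom_adjoint: "t \<in> Hom (adjoint_category C) a b \<longleftrightarrow>
    (\<exists>g. t = (a, g, b) \<and> a \<in> endos C \<and> b \<in> endos C \<and> g \<in> Hom C (src C a) (src C b) \<and> cmp C g a = cmp C b g)"
  by (auto simp: Hom_def adjoint_category_def)

lemma Ob_adjoint: "Ob (adjoint_category C) = endos C"
  by (simp add: adjoint_category_def)

lemma nerve_adjoint_linked:
  assumes "(as, ts) \<in> nerve (adjoint_category C) m"
  shows "linked C (rev (map arrow ts)) (src C (last as)) (src C (hd as)) \<and>
    hd as \<in> endos C \<and> last as \<in> endos C \<and> length as = Suc m \<and> length ts = m"
  using assms
proof (induction m arbitrary: as ts)
  case 0
  then show ?case by (auto simp: nerve_0 Ob_adjoint)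
next
  case (Suc m)
  then obtain as' b ts' t where e: "as = as' @ [b]" "ts = ts' @ [t]" "(as', ts') \<in> nerve (adjoint_category C) m"
    "t \<in> Hom (adjoint_category C) (last as') b" unfolding nerve_Suc by blast
  obtain g where t: "t = (last as', g, b)" "b \<in> endos C" "g \<in> Mor C" "src C g = src C (last as')" "tgt C g = src C b"
    using e(4) unfolding hom_adjoint by (auto simp: Hom_def)
  have "hd as = hd as'" using e by (cases as') (auto simp: nerve_def)
  then show ?case using Suc.IH[OF e(3)] e(1,2) t by simp
qed

lemma endos_Mor: "a \<in> endos C \<Longrightarrow> a \<in> Mor C \<and> tgt C a = src C a"
  by (simp add: endos_def)

context torsor_category
begin

text \<open>If \<open>a\<close> is the object reached and \<open>g\<close> the next arrow, the next
  object \<open>b\<close> satisfies \<open>b g = g a\<close>; as \<open>g\<close> is epic, this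
  determines \<open>b\<close>.\<close>

lemma nerve_adjoint_unique:
  assumes "(as, ts) \<in> nerve (adjoint_category C) m" "(as', ts') \<in> nerve (adjoint_category C) m"
    "hd as = hd as'" "map arrow ts = map arrow ts'"
  shows "as = as' \<and> ts = ts'"
  using assms
proof (induction m arbitrary: as ts as' ts')
  case 0
  then show ?case by (auto simp: nerve_0)
next
  case (Suc m)
  obtain bs b us u where e: "as = bs @ [b]" "ts = us @ [u]" "(bs, us) \<in> nerve (adjoint_category C) m"
    "u \<in> Hom (adjoint_category C) (last bs) b" using Suc.prems(1) unfolding nerve_Suc by blast
  obtain bs' b' us' u' where e': "as' = bs' @ [b']" "ts' = us' @ [u']" "(bs', us') \<in> nerve (adjoint_category C) m"
    "u' \<in> Hom (adjoint_category C) (last bs') b'" using Suc.prems(2) unfolding nerve_Suc by blast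
  have "bs \<noteq> []" "bs' \<noteq> []" using e(3) e'(3) by (auto simp: nerve_def)
  then have "bs = bs' \<and> us = us'" "arrow u = arrow u'"
    using Suc.IH[OF e(3) e'(3)] Suc.prems(3,4) e(1,2) e'(1,2) by auto
  then obtain g where u: "u = (last bs, g, b)" "u' = (last bs, g, b')" "b \<in> endos C" "b' \<in> endos C"
    "g \<in> Hom C (src C (last bs)) (src C b)" "g \<in> Hom C (src C (last bs)) (src C b')"
    "cmp C g (last bs) = cmp C b g" "cmp C g (last bs) = cmp C b' g"
    using e(4) e'(4) by (auto simp: hom_adjoint)
  then have "g \<in> Mor C" "b \<in> Mor C" "b' \<in> Mor C" "src C b = tgt C g" "src C b' = tgt C g"
    "cmp C b g = cmp C b' g"
    by (simp_all add: endos_def Hom_def)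
  then have "b = b'" by (rule cmp_epi)
  then show ?case using u e e' \<open>bs = bs' \<and> us = us'\<close> by simp
qed

lemma nerve_adjoint_exists:
  assumes "linked C gs x (src C a)" "a \<in> endos C"
  shows "\<exists>as ts. (as, ts) \<in> nerve (adjoint_category C) (length gs) \<and> hd as = a \<and> rev (map arrow ts) = gs \<and>
    src C (last as) = x"
  using assms(1)
proof (induction gs arbitrary: x)
  case Nil
  then show ?case using assms(2) by (intro exI[of _ "[a]"] exI[of _ "[]"]) (auto simp: nerve_0 Ob_adjoint)
next
  case (Cons g gs)
  then have g: "g \<in> Mor C" "tgt C g = x" "linked C gs (src C g) (src C a)" by auto
  obtain as ts where n: "(as, ts) \<in> nerve (adjoint_category C) (length gs)" "hd as = a"
    "rev (map arrow ts) = gs" "src C (last as) = src C g" using Cons.IH[OF g(3)] by blast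
  have l: "last as \<in> endos C" and ne: "as \<noteq> []" using nerve_adjoint_linked[OF n(1)] by auto
  \<comment> \<open>\<open>g\<close> and \<open>g a\<close>, with \<open>a = last as\<close>, are
    parallel; their left quotient is the next object of the chain, in a groupoid the conjugate of
    \<open>a\<close> by \<open>g\<close>.\<close>
  have "g \<in> Hom C (src C g) x" "cmp C g (last as) \<in> Hom C (src C g) x"
    using g n(4) cmp_ends[of "last as" g] l by (auto simp: endos_def Hom_def)
  then obtain b where b: "b \<in> Hom C x x" "cmp C b g = cmp C g (last as)"
    using left_quotient by blast
  have be: "b \<in> endos C" "src C b = x" using b by (auto simp: endos_def Hom_def)
  have h: "(last as, g, b) \<in> Hom (adjoint_category C) (last as) b"
    unfolding hom_adjoint using l be b n(4) g by (auto simp: Hom_def)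
  have "(as @ [b], ts @ [(last as, g, b)]) \<in> nerve (adjoint_category C) (Suc (length gs))"
    unfolding nerve_Suc using n(1) h be by (auto simp: Ob_adjoint)
  then show ?case using n be ne by (intro exI[of _ "as @ [b]"] exI[of _ "ts @ [(last as, g, b)]"]) auto
qed

text \<open>Both sides amount to a composable list of letters together with an endomorphism at its
  source: a chain unfolds from its first object along the letters, and for a closed word the
  endomorphism is the quotient of \<open>h\<close> by the composite of the letters.\<close>

lemma bij_betw_nerve_word:
  "bij_betw (nerve_word C) (nerve (adjoint_category C) n) (closed_words C n)"
proof (rule bij_betw_imageI)
  show "inj_on (nerve_word C) (nerve (adjoint_category C) n)"
  proof (rule inj_onI)
    fix c c' assume c: "c \<in> nerve (adjoint_category C) n" and c': "c' \<in> nerve (adjoint_category C) n"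
      and eq: "nerve_word C c = nerve_word C c'"
    obtain as ts as' ts' where e: "c = (as, ts)" "c' = (as', ts')" by (cases c; cases c')
    have r: "map arrow ts = map arrow ts'"
      and f: "foldr (cmp C) (rev (map arrow ts)) (hd as) = foldr (cmp C) (rev (map arrow ts)) (hd as')"
      using eq e by (auto simp: nerve_word_def)
    note l = nerve_adjoint_linked[OF c[unfolded e]] and l' = nerve_adjoint_linked[OF c'[unfolded e]]
    \<comment> \<open>The fold has the source of the morphism it starts with, so both chains begin
      with endomorphisms of the same object, as \<open>linked_foldr_inj\<close> requires.\<close>
    have "src C (hd as) = src C (hd as')"
      using linked_foldr[of "rev (map arrow ts)" _ _ "hd as"] linked_foldr[of "rev (map arrow ts)" _ _ "hd as'"]
        l l' r f endos_Mor by metis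
    then have "hd as = hd as'"
      using linked_foldr_inj[of "rev (map arrow ts)" "src C (last as)" "src C (hd as)" "hd as" "hd as'"] l l' f
        endos_Mor by metis
    then show "c = c'"
      using nerve_adjoint_unique[OF c[unfolded e] c'[unfolded e] _ r] e by simp
  qed
  show "nerve_word C ` nerve (adjoint_category C) n = closed_words C n"
  proof (intro equalityI subsetI)
    fix w assume "w \<in> nerve_word C ` nerve (adjoint_category C) n"
    then obtain as ts where c: "(as, ts) \<in> nerve (adjoint_category C) n" "w = nerve_word C (as, ts)" by auto
    note l = nerve_adjoint_linked[OF c(1)]
    then have m: "hd as \<in> Mor C" "tgt C (hd as) = src C (hd as)" using endos_Mor[of "hd as" C] by auto
    show "w \<in> closed_words C n"
      using l linked_foldr[OF conjunct1[OF l] m] m by (simp add: c(2) nerve_word_def closed_words_iff)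
  next
    fix w assume "w \<in> closed_words C n"
    then obtain gs h where w: "w = (gs, h)" "length gs = n" "h \<in> Mor C" "linked C gs (tgt C h) (src C h)"
      by (cases w) (auto simp: closed_words_iff)
    obtain a where a: "a \<in> Mor C" "src C a = src C h" "tgt C a = src C h" "foldr (cmp C) gs a = h"
      using linked_foldr_surj[OF w(4,3)] by auto
    then have ae: "a \<in> endos C" by (simp add: endos_def)
    obtain as ts where n: "(as, ts) \<in> nerve (adjoint_category C) n" "hd as = a" "rev (map arrow ts) = gs"
      using nerve_adjoint_exists[of gs "tgt C h" a] w a ae by auto
    have "w = nerve_word C (as, ts)" using n a w by (simp add: nerve_word_def)
    then show "w \<in> nerve_word C ` nerve (adjoint_category C) n" using n(1) by blast
  qed
qed

end

text \<open>
  The arrows of a chain in the nerve occur in a word in reverse order; reversing the faces of an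
  \<open>n\<close>-simplex is compensated by the sign \<open>(-1)\<^bsup>n(n+1)/2\<^esup>\<close>.
\<close>

definition rev_sign :: "nat \<Rightarrow> 'k::field"
  where "rev_sign n = (\<Prod>i=1..n. (-1) ^ i)"

lemma rev_sign_Suc: "rev_sign (Suc n) = rev_sign n * (-1) ^ Suc n"
  by (simp add: rev_sign_def)

lemma rev_sign_square: "rev_sign n * rev_sign n = (1 :: 'k::field)"
  by (simp add: rev_sign_def flip: prod.distrib power_add mult_2)

section \<open>Faces of a chain and terms of the Hochschild differential\<close>

lemma rev_merge:
  assumes "1 \<le> i" "i < length xs"
  shows "rev (merge (\<lambda>f g. mu g f) i xs) = merge mu (length xs - i) (rev xs)"
proof -
  obtain us p q vs where xs: "xs = us @ p # q # vs" "i = Suc (length us)"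
    using split_at_merge[OF assms] .
  have "length xs - i = Suc (length (rev vs))" "rev xs = rev vs @ q # p # rev us"
    by (simp_all add: xs)
  then show ?thesis unfolding xs(2) by (simp only: xs(1) merge_append) simp
qed

lemma map_arrow_merge:
  assumes "1 \<le> i" "i < length ts"
  shows "map arrow (merge (\<lambda>f g. cmp (adjoint_category C) g f) i ts) =
    merge (\<lambda>f g. cmp C g f) i (map arrow ts)"
proof -
  have "arrow (cmp (adjoint_category C) s t) = cmp C (arrow s) (arrow t)" for s t
    by (cases s; cases t) (simp add: adjoint_category_def)
  then show ?thesis using assms by (simp add: merge_def take_map drop_map)
qed

context category
begin

text \<open>Below degree 0 there is no cochain for the homotopy to produce, so the cocycle itself
  has to vanish. Take the identity of \<open>tgt C h\<close> as a single letter: multiplying by it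
  on the left yields \<open>h\<close> exactly from \<open>h\<close>, on the right never. In other
  words, central elements of \<open>kC\<close> are supported on endomorphisms.\<close>

lemma word_cocycle_0:
  assumes "w \<in> word_dom C 0" "w \<notin> closed_words C 0" "word_diff C 0 \<Phi> = 0"
  shows "\<Phi> w = 0"
proof -
  obtain h where w: "w = ([], h)" "h \<in> Mor C" "tgt C h \<noteq> src C h"
    using assms(1,2) by (cases w) (auto simp: word_dom_def closed_words_def lend_def rend_def)
  let ?e = "idm C (tgt C h)"
  note e = idm_ends[OF tgt_in_Ob[OF w(2)]]
  have "tgt C h = tgt C h' \<and> cmp C ?e h' = h \<longleftrightarrow> h' = h" if "h' \<in> Mor C" for h'
    using cmp_idm_tgt[OF that] cmp_idm_tgt[OF w(2)] by metis
  then have 1: "{h' \<in> Mor C. tgt C h = tgt C h' \<and> cmp C ?e h' = h} = {h}" using w(2) by blast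
  have 2: "{h' \<in> Mor C. src C h' = tgt C h \<and> cmp C h' ?e = h} = {}"
    using cmp_ends(2)[OF e(1)] e w(3) by fastforce
  have "([?e], h) \<in> word_dom C (Suc 0)" using e w by (simp add: word_dom_def)
  then have "word_diff C 0 \<Phi> ([?e], h) = \<Phi> ([], h)"
    by (simp add: word_diff_def e 1 2)
  then show ?thesis using assms(3) w by simp
qed

text \<open>The last arrow of the chain is the first letter of the word, so dropping the last object
  yields the first Hochschild term; \<open>h'\<close> is the composite of the remaining letters with
  the unchanged first object.\<close>

lemma nerve_word_last_face:
  assumes "c \<in> nerve (adjoint_category C) (Suc n)" "nerve_word C c = (gs, h)"
  obtains h' where "nerve_word C (face (adjoint_category C) n (n + 1) c) = (tl gs, h')"
    "h' \<in> Mor C" "src C (hd gs) = tgt C h'" "cmp C (hd gs) h' = h"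
proof -
  obtain as b ts t where c: "c = (as @ [b], ts @ [t])" "(as, ts) \<in> nerve (adjoint_category C) n"
    "t \<in> Hom (adjoint_category C) (last as) b" using assms(1) by (cases c) (auto simp: nerve_Suc)
  note l = nerve_adjoint_linked[OF c(2)]
  let ?h' = "foldr (cmp C) (rev (map arrow ts)) (hd as)"
  have ne: "as \<noteq> []" using l by auto
  have gs: "gs = arrow t # rev (map arrow ts)" "h = cmp C (arrow t) ?h'"
    using assms(2) c(1) ne by (auto simp: nerve_word_def)
  have "hd as \<in> Mor C" "tgt C (hd as) = src C (hd as)" using l endos_Mor[of "hd as" C] by auto
  then have "?h' \<in> Mor C" "tgt C ?h' = src C (last as)" using linked_foldr[OF conjunct1[OF l]] by auto
  moreover have "src C (arrow t) = src C (last as)" using c(3) unfolding hom_adjoint by (auto simp: Hom_def)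
  ultimately show thesis
    using gs c(1) ne by (intro that[of ?h']) (auto simp: face_def nerve_word_def)
qed

text \<open>Dropping \<open>a_0\<close> makes \<open>a_1\<close> the start of the fold and yields
  the last Hochschild term. The square \<open>g_0 a_0 = a_1 g_0\<close> of the adjoint category is
  exactly what makes the shorter composite a left factor of \<open>h\<close>.\<close>

lemma nerve_word_first_face:
  assumes "c \<in> nerve (adjoint_category C) (Suc n)" "nerve_word C c = (gs, h)"
  obtains h' where "nerve_word C (face (adjoint_category C) n 0 c) = (butlast gs, h')"
    "h' \<in> Mor C" "src C h' = tgt C (last gs)" "cmp C h' (last gs) = h"
proof -
  obtain as0 ts0 where c0: "c = (as0, ts0)" by (cases c)
  then have "length as0 = Suc (Suc n)" "length ts0 = Suc n" using assms(1) by (auto simp: nerve_def)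
  then obtain a b as t ts where c: "c = (a # b # as, t # ts)" using c0 by (auto simp: length_Suc_conv)
  have "t \<in> Hom (adjoint_category C) a b" using assms(1) by (auto simp: c nerve_def)
  then obtain g where t: "t = (a, g, b)" "a \<in> endos C" "b \<in> endos C" "g \<in> Hom C (src C a) (src C b)"
    "cmp C g a = cmp C b g" by (auto simp: hom_adjoint)
  have "face (adjoint_category C) n 0 c \<in> nerve (adjoint_category C) n"
    using category.face_nerve[OF category_adjoint_category assms(1)] by simp
  then have l: "linked C (rev (map arrow ts)) (src C (last (b # as))) (src C b)"
    using nerve_adjoint_linked[of "b # as" ts C n] by (simp add: c face_def)
  let ?h' = "foldr (cmp C) (rev (map arrow ts)) b"
  have gs: "gs = rev (map arrow ts) @ [g]" "h = foldr (cmp C) (rev (map arrow ts)) (cmp C g a)"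
    using assms(2) c t(1) by (auto simp: nerve_word_def)
  have b: "b \<in> Mor C" "tgt C b = src C b" using endos_Mor[OF t(3)] by auto
  have g: "g \<in> Mor C" "src C b = tgt C g" using t by (auto simp: Hom_def)
  have "h = cmp C ?h' g" unfolding gs(2) t(5) using linked_foldr_cmp[OF l b g] .
  moreover have "?h' \<in> Mor C" "src C ?h' = tgt C g" using linked_foldr[OF l b] g by auto
  ultimately show thesis
    using gs(1) c by (intro that[of ?h']) (auto simp: face_def nerve_word_def)
qed

text \<open>The first object and the total composite survive an inner composition, while reversal
  turns the place \<open>i\<close> into \<open>Suc n - i\<close>.\<close>

lemma nerve_word_inner_face:
  assumes "c \<in> nerve (adjoint_category C) (Suc n)" "nerve_word C c = (gs, h)" "1 \<le> i" "i \<le> n"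
  shows "nerve_word C (face (adjoint_category C) n i c) = (merge (cmp C) (Suc n - i) gs, h)"
proof -
  obtain as ts where c: "c = (as, ts)" by (cases c)
  note l = nerve_adjoint_linked[OF assms(1)[unfolded c]]
  have gs: "gs = rev (map arrow ts)" "h = foldr (cmp C) gs (hd as)"
    using assms(2) by (auto simp: c nerve_word_def)
  have i: "1 \<le> i" "i < length ts" "i < length as" using l assms by auto
  have a: "hd as \<in> Mor C" "tgt C (hd as) = src C (hd as)" using l endos_Mor[of "hd as" C] by auto
  have "rev (map arrow (merge (\<lambda>f g. cmp (adjoint_category C) g f) i ts)) = merge (cmp C) (Suc n - i) gs"
    unfolding map_arrow_merge[OF i(1,2)] gs(1) using rev_merge[of i "map arrow ts" "cmp C"] i l by simp
  moreover have "hd (take i as @ drop (Suc i) as) = hd as" using i by (cases as; cases i) auto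
  moreover have "foldr (cmp C) (merge (cmp C) (Suc n - i) gs) (hd as) = h"
    unfolding gs(2) using linked_foldr_merge(1)[OF conjunct1[OF l] a, of "Suc n - i"] gs(1) assms(3,4) l by simp
  ultimately show ?thesis using i l assms(3,4) by (simp add: c face_def nerve_word_def)
qed

end

text \<open>Up to sign this is restriction to closed words, read through the bijection with chains;
  the values at words with a gap are lost.\<close>

definition word_pullback :: "('o, 'm) cat \<Rightarrow> nat \<Rightarrow> ('m list \<times> 'm \<Rightarrow> 'k) \<Rightarrow>
    'm list \<times> ('m \<times> 'm \<times> 'm) list \<Rightarrow> 'k::field"
  where "word_pullback C n \<Phi> c =
    (if c \<in> nerve (adjoint_category C) n then rev_sign n * \<Phi> (nerve_word C c) else 0)"

context torsor_category
begin

lemma nerve_word_closed: "c \<in> nerve (adjoint_category C) n \<Longrightarrow> nerve_word C c \<in> closed_words C n"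
  using bij_betw_nerve_word by (meson bij_betwE)

text \<open>Face \<open>i\<close> of the chain becomes term \<open>Suc n - i\<close> of the
  Hochschild differential. The overall sign \<open>(-1) ^ Suc n\<close> that this produces is the
  quotient of \<open>rev_sign (Suc n)\<close> by \<open>rev_sign n\<close>.\<close>

lemma word_pullback_diff:
  fixes \<Phi> :: "'b list \<times> 'b \<Rightarrow> 'k::field"
  shows "word_pullback C (Suc n) (word_diff C n \<Phi>) = nerve_fun_diff (adjoint_category C) n (word_pullback C n \<Phi>)"
proof
  fix c
  let ?D = "adjoint_category C"
  show "word_pullback C (Suc n) (word_diff C n \<Phi>) c = nerve_fun_diff ?D n (word_pullback C n \<Phi>) c"
  proof (cases "c \<in> nerve ?D (Suc n)")
    case c: True
    obtain gs h where gh: "nerve_word C c = (gs, h)" by (cases "nerve_word C c")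
    have w: "(gs, h) \<in> closed_words C (Suc n)" using nerve_word_closed[OF c] gh by simp
    then have dom: "(gs, h) \<in> word_dom C (Suc n)" and len: "length gs = Suc n"
      and gsM: "set gs \<subseteq> Mor C" by (auto simp: closed_words_def word_dom_def)
    have "gs \<noteq> []" using len by auto
    then have M: "hd gs \<in> Mor C" "last gs \<in> Mor C" using gsM by auto
    obtain h1 where h1: "nerve_word C (face ?D n (n + 1) c) = (tl gs, h1)"
      "h1 \<in> Mor C" "src C (hd gs) = tgt C h1" "cmp C (hd gs) h1 = h"
      using nerve_word_last_face[OF c gh] by blast
    obtain h2 where h2: "nerve_word C (face ?D n 0 c) = (butlast gs, h2)"
      "h2 \<in> Mor C" "src C h2 = tgt C (last gs)" "cmp C h2 (last gs) = h"
      using nerve_word_first_face[OF c gh] by blast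
    \<comment> \<open>Cancellation shrinks the sum over \<open>h'\<close> to the one term that the
      face supplies; the same happens at the other end with \<open>h2\<close>.\<close>
    have "h' = h1" if "h' \<in> Mor C" "src C (hd gs) = tgt C h'" "cmp C (hd gs) h' = h" for h'
      using cmp_mono[OF M(1) that(1) h1(2) that(2) h1(3)] that(3) h1(4) by simp
    then have e1: "{h' \<in> Mor C. src C (hd gs) = tgt C h' \<and> cmp C (hd gs) h' = h} = {h1}"
      using h1(2-4) by blast
    have "h' = h2" if "h' \<in> Mor C" "src C h' = tgt C (last gs)" "cmp C h' (last gs) = h" for h'
      using cmp_epi[OF M(2) that(1) h2(2) that(2) h2(3)] that(3) h2(4) by simp
    then have e2: "{h' \<in> Mor C. src C h' = tgt C (last gs) \<and> cmp C h' (last gs) = h} = {h2}"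
      using h2(2-4) by blast
    have fd: "face ?D n i c \<in> nerve ?D n" if "i \<le> n + 1" for i
      using category.face_nerve[OF category_adjoint_category c that] .
    have comp: "src C (gs ! (j - 1)) = tgt C (gs ! j)" if "1 \<le> j" "j \<le> n" for j
    proof -
      have "lend C (gs, h) j = rend C (gs, h) j" using w that by (simp add: closed_words_def)
      then show ?thesis using that len by (simp add: lend_def rend_def)
    qed
    define P where "P i = \<Phi> (nerve_word C (face ?D n i c))" for i
    have P: "P 0 = \<Phi> (butlast gs, h2)" "P (Suc n) = \<Phi> (tl gs, h1)"
      "\<And>i. 1 \<le> i \<Longrightarrow> i \<le> n \<Longrightarrow> P i = \<Phi> (merge (cmp C) (Suc n - i) gs, h)"
      using h1(1) h2(1) nerve_word_inner_face[OF c gh] by (auto simp: P_def)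
    have "word_diff C n \<Phi> (gs, h) = P (Suc n) +
        (\<Sum>i=1..n. (-1) ^ i * \<Phi> (merge (cmp C) i gs, h)) + (-1) ^ (n + 1) * P 0"
      using dom comp by (simp add: word_diff_def e1 e2 P)
    also have "(\<Sum>i=1..n. (-1) ^ i * \<Phi> (merge (cmp C) i gs, h)) = (\<Sum>i=1..n. (-1) ^ (Suc n - i) * P i)"
      by (rule sum.reindex_bij_witness[of _ "\<lambda>i. Suc n - i" "\<lambda>i. Suc n - i"]) (auto simp: P(3) Suc_diff_le)
    also have "P (Suc n) + (\<Sum>i=1..n. (-1) ^ (Suc n - i) * P i) + (-1) ^ (n + 1) * P 0 =
        (\<Sum>i=0..Suc n. (-1) ^ (Suc n - i) * P i)"
      by (simp add: sum.atLeast_Suc_atMost[of 0 n] Suc_diff_le)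
    also have "\<dots> = (-1) ^ Suc n * (\<Sum>i=0..Suc n. (-1) ^ i * P i)"
      unfolding sum_distrib_left
    proof (rule sum.cong)
      fix i assume "i \<in> {0..Suc n}"
      \<comment> \<open>Writing \<open>Suc n = i + k\<close> avoids the truncated subtraction in the
        exponent.\<close>
      then obtain k where k: "Suc n = i + k" by (metis atLeastAtMost_iff le_Suc_ex)
      have "(-1) ^ (i + k) * ((-1) ^ i * P i) = ((-1) ^ i * (-1) ^ i) * ((-1) ^ k * P i)"
        by (simp add: power_add mult_ac)
      also have "(-1) ^ i * (-1) ^ i = (1 :: 'k)" by (simp flip: power_add)
      finally show "(-1) ^ (Suc n - i) * P i = (-1) ^ Suc n * ((-1) ^ i * P i)"
        by (simp only: k add_diff_cancel_left' mult_1_left)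
    qed simp
    finally have "rev_sign (Suc n) * word_diff C n \<Phi> (gs, h) =
        rev_sign n * (((-1) ^ Suc n * (-1) ^ Suc n) * (\<Sum>i=0..Suc n. (-1) ^ i * P i))"
      by (simp only: rev_sign_Suc mult.assoc)
    also have "\<dots> = (\<Sum>i=0..n + 1. (-1) ^ i * (rev_sign n * P i))"
      by (simp add: sum_distrib_left right_diff_distrib mult.left_commute flip: power_add)
    finally show ?thesis
      using c gh fd by (auto simp: word_pullback_def nerve_fun_diff_def P_def intro!: sum.cong)
  qed (simp add: word_pullback_def nerve_fun_diff_def)
qed

lemma word_cohomology_iso_nerve:
  "graded_isomorphic
    (cohomology (\<lambda>n. fun_space (word_dom C n) :: ('k::field, _) vspace) (word_diff C))
    (cohomology (\<lambda>n. fun_space (nerve (adjoint_category C) n)) (nerve_fun_diff (adjoint_category C)))"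
proof (rule cohomology_linear_iso[where F = "word_pullback C", OF cochain_complex_word cochain_complex_nerve])
  let ?D = "adjoint_category C"
  let ?K = "\<lambda>n. fun_space (word_dom C n) :: ('k, _) vspace" and ?N = "\<lambda>n. fun_space (nerve ?D n) :: ('k, _) vspace"
  \<comment> \<open>Extension by zero, a right inverse of \<open>word_pullback\<close>; the same
    sign reappears because \<open>rev_sign n\<close> is its own inverse.\<close>
  define push :: "nat \<Rightarrow> _ \<Rightarrow> _ \<Rightarrow> 'k" where "push n \<phi> w =
    (if w \<in> closed_words C n then rev_sign n * \<phi> (inv_into (nerve ?D n) (nerve_word C) w) else 0)" for n \<phi> w
  have dom0: "word_diff C n \<Phi> w = 0" if "w \<notin> word_dom C (Suc n)" for n w and \<Phi> :: "_ \<Rightarrow> 'k"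
    using that by (cases w) (auto simp: word_diff_def)
  have pull_push: "word_pullback C n (push n \<phi>) = \<phi>" if "\<phi> \<in> carr (?N n)" for n \<phi>
  proof
    fix c
    show "word_pullback C n (push n \<phi>) c = \<phi> c"
    proof (cases "c \<in> nerve ?D n")
      case True
      then have "inv_into (nerve ?D n) (nerve_word C) (nerve_word C c) = c"
        using bij_betw_nerve_word by (metis bij_betw_inv_into_left)
      then have "word_pullback C n (push n \<phi>) c = (rev_sign n * rev_sign n) * \<phi> c"
        using True nerve_word_closed[OF True] by (simp add: word_pullback_def push_def)
      then show ?thesis by (simp add: rev_sign_square)
    next
      case False
      then show ?thesis using that by (cases c) (auto simp: word_pullback_def fun_space_def)
    qed
  qed
  have eq_on_closed: "\<Phi> w = \<Psi> w"
    if eq: "word_pullback C n \<Phi> = word_pullback C n \<Psi>" and w: "w \<in> closed_words C n" for n w and \<Phi> \<Psi> :: "_ \<Rightarrow> 'k"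
  proof -
    obtain c where c: "c \<in> nerve ?D n" "w = nerve_word C c"
      using w bij_betw_nerve_word by (metis bij_betw_imp_surj_on imageE)
    have "rev_sign n * \<Phi> w = rev_sign n * \<Psi> w"
      using fun_cong[OF eq, of c] c by (simp add: word_pullback_def)
    moreover have "rev_sign n \<noteq> (0 :: 'k)" using rev_sign_square[of n] by (metis mult_zero_left zero_neq_one)
    ultimately show ?thesis by simp
  qed
  have push_closed: "push n \<phi> w = 0" if "w \<notin> closed_words C n" for n \<phi> w
    using that by (simp add: push_def)
  have push_carr: "push n \<phi> \<in> carr (?K n)" for n \<phi>
    by (auto simp: push_def fun_space_def closed_words_def)
  have diff_push: "word_pullback C (Suc n) (word_diff C n (push n \<phi>)) = nerve_fun_diff ?D n \<phi>"
    if "\<phi> \<in> carr (?N n)" for n \<phi>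
    by (simp add: word_pullback_diff pull_push[OF that])
  show "linear_map (?K n) (?N n) (word_pullback C n)" for n
    by (auto simp: linear_map_def fun_space_def word_pullback_def fun_eq_iff distrib_left)
  show "word_pullback C (Suc n) (word_diff C n \<Phi>) = nerve_fun_diff ?D n (word_pullback C n \<Phi>)"
    if "\<Phi> \<in> carr (?K n)" for n \<Phi> by (rule word_pullback_diff)
  show "\<exists>v\<in>carr (?K n). word_diff C n v = 0 \<and> word_pullback C n v = \<phi>"
    if \<phi>: "\<phi> \<in> carr (?N n)" "nerve_fun_diff ?D n \<phi> = 0" for n \<phi>
  proof (intro bexI[OF _ push_carr] conjI)
    show "word_pullback C n (push n \<phi>) = \<phi>" by (rule pull_push[OF \<phi>(1)])
    \<comment> \<open>On closed words this is read off the pullback, elsewhere it follows from the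
      support of \<open>push n \<phi>\<close>.\<close>
    show "word_diff C n (push n \<phi>) = 0"
    proof
      fix w
      have "word_pullback C (Suc n) (word_diff C n (push n \<phi>)) = word_pullback C (Suc n) 0"
        unfolding diff_push[OF \<phi>(1)] \<phi>(2) by (auto simp: word_pullback_def fun_eq_iff)
      then show "word_diff C n (push n \<phi>) w = 0 w"
        using eq_on_closed[of "Suc n" "word_diff C n (push n \<phi>)" 0 w]
          word_diff_closed_support[where w = w and n = n, OF push_closed]
        by (cases "w \<in> closed_words C (Suc n)") auto
    qed
  qed
  show "\<Phi> \<in> coboundaries ?K (word_diff C) n"
    if \<Phi>: "\<Phi> \<in> carr (?K n)" "word_diff C n \<Phi> = 0"
      and b: "word_pullback C n \<Phi> \<in> coboundaries ?N (nerve_fun_diff ?D) n" for n \<Phi>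
  proof (cases n)
    case 0
    \<comment> \<open>The only coboundary in degree 0 is 0, so the cocycle must vanish everywhere:
      on closed words its pullback is 0, on the others \<open>word_cocycle_0\<close>
      applies.\<close>
    have "\<Phi> w = 0" for w
    proof (cases "w \<in> word_dom C 0 \<and> w \<notin> closed_words C 0")
      case True
      then show ?thesis using word_cocycle_0[of w \<Phi>] \<Phi> 0 by simp
    next
      case False
      have "word_pullback C 0 \<Phi> = word_pullback C 0 0"
        using b 0 by (auto simp: coboundaries_def word_pullback_def fun_eq_iff)
      then show ?thesis
        using False \<Phi> 0 eq_on_closed[of 0 \<Phi> 0 w] by (cases w) (auto simp: fun_space_def)
    qed
    then show ?thesis using 0 by (auto simp: coboundaries_def)
  next
    case (Suc m)
    then obtain \<psi> where \<psi>: "\<psi> \<in> carr (?N m)" "word_pullback C (Suc m) \<Phi> = nerve_fun_diff ?D m \<psi>"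
      using b by (auto simp: coboundaries_def)
    \<comment> \<open>The primitive of \<open>\<Phi>\<close> is
      \<open>?\<Theta> + push m \<psi>\<close>. The homotopy accounts for the words with a gap and
      \<open>push m \<psi>\<close> for the closed ones; neither disturbs the other, as the
      differential respects the splitting.\<close>
    let ?\<Theta> = "word_htpy C m \<Phi>"
    have \<Theta>: "?\<Theta> \<in> carr (?K m)" by (auto simp: fun_space_def word_htpy_def)
    have vK: "vspace_on (?K m)" by (rule vspace_on_fun_space)
    have "word_diff C m (?\<Theta> + push m \<psi>) = word_diff C m ?\<Theta> + word_diff C m (push m \<psi>)"
      using cochain_complex_word[of C] \<Theta> push_carr[of m \<psi>] unfolding cochain_complex_def linear_map_def by blast
    moreover have "word_diff C m ?\<Theta> w + word_diff C m (push m \<psi>) w = \<Phi> w" for w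
    proof -
      consider "w \<notin> word_dom C (Suc m)" | "w \<in> closed_words C (Suc m)"
        | "w \<in> word_dom C (Suc m)" "w \<notin> closed_words C (Suc m)" by blast
      then show ?thesis
      proof cases
        case 1
        then show ?thesis using \<Phi>(1) Suc dom0[OF 1] by (cases w) (auto simp: fun_space_def)
      next
        case 2
        have "word_diff C m (push m \<psi>) w = \<Phi> w"
          using eq_on_closed[OF _ 2, of "word_diff C m (push m \<psi>)" \<Phi>] diff_push[OF \<psi>(1)] \<psi>(2) by simp
        moreover have "word_diff C m ?\<Theta> w = 0"
          using word_diff_closed_zero[OF word_htpy_closed 2] .
        ultimately show ?thesis by simp
      next
        case 3
        obtain gs h where w: "w = (gs, h)" by (cases w)
        obtain i where "first_gap C (gs, h) i" using first_gap_exists[OF 3] w by blast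
        then have "word_diff C m ?\<Theta> w = \<Phi> w"
          using word_htpy_homotopy[of gs h m i \<Phi>] 3 \<Phi>(2) Suc w by simp
        moreover have "word_diff C m (push m \<psi>) w = 0"
          using word_diff_closed_support[OF push_closed 3(2)] .
        ultimately show ?thesis by simp
      qed
    qed
    ultimately have "\<Phi> = word_diff C m (?\<Theta> + push m \<psi>)" by (auto simp: fun_eq_iff)
    moreover have "?\<Theta> + push m \<psi> \<in> carr (?K m)"
      using \<Theta> push_carr[of m \<psi>] vK unfolding vspace_on_def by blast
    ultimately show ?thesis using Suc by (auto simp: coboundaries_def)
  qed
qed

end

section \<open>Free vector spaces and the nerve complex\<close>

lemma linear_map_add: "linear_map V W f \<Longrightarrow> x \<in> carr V \<Longrightarrow> y \<in> carr V \<Longrightarrow> f (x + y) = f x + f y"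
  unfolding linear_map_def by blast

lemma linear_map_scl: "linear_map V W f \<Longrightarrow> x \<in> carr V \<Longrightarrow> f (scl V c x) = scl W c (f x)"
  unfolding linear_map_def by blast

lemma vspace_on_closed:
  assumes "vspace_on V" "x \<in> carr V"
  shows "y \<in> carr V \<Longrightarrow> x + y \<in> carr V" "y \<in> carr V \<Longrightarrow> x - y \<in> carr V" "scl V c x \<in> carr V"
    "y \<in> carr V \<Longrightarrow> scl V c (x + y) = scl V c x + scl V c y"
  using assms unfolding vspace_on_def by blast+

lemma vspace_on_zero: "vspace_on V \<Longrightarrow> 0 \<in> carr V"
  unfolding vspace_on_def by blast

lemma sum_in_carr:
  assumes "vspace_on V" "\<And>i. i \<in> S \<Longrightarrow> g i \<in> carr V"
  shows "sum g S \<in> carr V"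
  using assms(2) by (induction S rule: infinite_finite_induct) (auto intro: vspace_on_closed vspace_on_zero assms(1))

lemma linear_map_sum:
  fixes f :: "'v::ab_group_add \<Rightarrow> 'w::ab_group_add"
  assumes "vspace_on V" "linear_map V W f" "\<And>i. i \<in> S \<Longrightarrow> g i \<in> carr V"
  shows "f (sum g S) = (\<Sum>i\<in>S. f (g i))"
  using assms(3)
proof (induction S rule: infinite_finite_induct)
  case (insert i S)
  then have "sum g S \<in> carr V" "g i \<in> carr V" by (auto intro: sum_in_carr[OF assms(1)])
  then show ?case using insert linear_map_add[OF assms(2)] by simp
qed (simp_all add: linear_map_zero[OF assms(1,2)])

lemma lookup_map_times: "Poly_Mapping.lookup (Poly_Mapping.map ((*) c) v) x = c * (Poly_Mapping.lookup v x :: 'k::field)"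
  by (simp add: Poly_Mapping.map.rep_eq when_def)

lemma carr_free_space: "carr (free_space X) = {v. Poly_Mapping.keys v \<subseteq> X}"
  by (simp add: free_space_def)

lemma scl_free_space: "scl (free_space X) c v = Poly_Mapping.map ((*) c) v"
  by (simp add: free_space_def)

lemma vspace_on_free_space:
  fixes X :: "'x set"
  shows "vspace_on (free_space X :: ('k::field, 'x \<Rightarrow>\<^sub>0 'k) vspace)"
  unfolding vspace_on_def carr_free_space scl_free_space
proof (intro conjI allI ballI)
  fix u v :: "'x \<Rightarrow>\<^sub>0 'k" and c
  assume "u \<in> {v. Poly_Mapping.keys v \<subseteq> X}"
  then have u: "Poly_Mapping.keys u \<subseteq> X" by simp
  then show "Poly_Mapping.map ((*) c) u \<in> {v. Poly_Mapping.keys v \<subseteq> X}"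
    by (auto simp: in_keys_iff lookup_map_times)
  assume "v \<in> {v. Poly_Mapping.keys v \<subseteq> X}"
  then show "u + v \<in> {v. Poly_Mapping.keys v \<subseteq> X}" "u - v \<in> {v. Poly_Mapping.keys v \<subseteq> X}"
    using u keys_add[of u v] keys_diff[of u v] by auto
  show "Poly_Mapping.map ((*) c) (u + v) = Poly_Mapping.map ((*) c) u + Poly_Mapping.map ((*) c) v"
    by (rule poly_mapping_eqI) (simp add: lookup_map_times lookup_add distrib_left)
qed simp

lemma single_eq_scl: "Poly_Mapping.single x c = scl (free_space X) c (Poly_Mapping.single x (1 :: 'k::field))"
  by (rule poly_mapping_eqI) (simp add: scl_free_space lookup_map_times lookup_single when_def)

text \<open>The range \<open>keys v\<close> changes under addition and scaling; over a common finite
  range the sums become visibly linear in \<open>v\<close>.\<close>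

lemma sum_keys_eq:
  assumes "finite S" "Poly_Mapping.keys v \<subseteq> S" "\<And>x. g x 0 = 0"
  shows "(\<Sum>x\<in>Poly_Mapping.keys v. g x (Poly_Mapping.lookup v x)) = (\<Sum>x\<in>S. g x (Poly_Mapping.lookup v x))"
  using assms by (intro sum.mono_neutral_left) (auto simp: in_keys_iff)

lemma sum_singles: "(\<Sum>x\<in>Poly_Mapping.keys v. Poly_Mapping.single x (Poly_Mapping.lookup v x)) = v"
proof (rule poly_mapping_eqI)
  fix y
  have "(\<Sum>x\<in>Poly_Mapping.keys v. Poly_Mapping.lookup v x when x = y) = Poly_Mapping.lookup v y"
    by (cases "y \<in> Poly_Mapping.keys v") (auto simp: when_def in_keys_iff)
  then show "Poly_Mapping.lookup (\<Sum>x\<in>Poly_Mapping.keys v. Poly_Mapping.single x (Poly_Mapping.lookup v x)) y =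
      Poly_Mapping.lookup v y"
    by (simp add: lookup_sum lookup_single)
qed

lemma linear_map_free_space_expand:
  fixes f :: "('x \<Rightarrow>\<^sub>0 'k::field) \<Rightarrow> 'w::ab_group_add"
  assumes "linear_map (free_space X) W f" "Poly_Mapping.keys v \<subseteq> X"
  shows "f v = (\<Sum>x\<in>Poly_Mapping.keys v. scl W (Poly_Mapping.lookup v x) (f (Poly_Mapping.single x 1)))"
proof -
  have s: "Poly_Mapping.single x c \<in> carr (free_space X)" if "x \<in> Poly_Mapping.keys v" for x and c :: 'k
    using that assms(2) by (auto simp: carr_free_space)
  have "f v = f (\<Sum>x\<in>Poly_Mapping.keys v. Poly_Mapping.single x (Poly_Mapping.lookup v x))"
    by (simp add: sum_singles)
  also have "\<dots> = (\<Sum>x\<in>Poly_Mapping.keys v. f (Poly_Mapping.single x (Poly_Mapping.lookup v x)))"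
    by (rule linear_map_sum[OF vspace_on_free_space assms(1) s])
  also have "\<dots> = (\<Sum>x\<in>Poly_Mapping.keys v. scl W (Poly_Mapping.lookup v x) (f (Poly_Mapping.single x 1)))"
  proof (rule sum.cong)
    fix x assume "x \<in> Poly_Mapping.keys v"
    then show "f (Poly_Mapping.single x (Poly_Mapping.lookup v x)) = scl W (Poly_Mapping.lookup v x) (f (Poly_Mapping.single x 1))"
      using linear_map_scl[OF assms(1) s[of x 1], of "Poly_Mapping.lookup v x"]
      by (simp flip: single_eq_scl)
  qed simp
  finally show ?thesis .
qed

text \<open>Inverse to restricting a functional to the basis. The value 0 off the span of
  \<open>X\<close> follows the convention of \<open>hom_space\<close>.\<close>

definition linear_ext :: "'x set \<Rightarrow> ('x \<Rightarrow> 'k) \<Rightarrow> ('x \<Rightarrow>\<^sub>0 'k) \<Rightarrow> 'k::field"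
  where "linear_ext X \<phi> v =
    (if Poly_Mapping.keys v \<subseteq> X then \<Sum>x\<in>Poly_Mapping.keys v. Poly_Mapping.lookup v x * \<phi> x else 0)"

lemma linear_map_linear_ext:
  fixes \<phi> :: "'x \<Rightarrow> 'k::field"
  shows "linear_map (free_space X) ground_space (linear_ext X \<phi>)"
  unfolding linear_map_def carr_free_space scl_free_space
proof (intro conjI allI ballI)
  fix u v :: "'x \<Rightarrow>\<^sub>0 'k" and c
  assume "u \<in> {v. Poly_Mapping.keys v \<subseteq> X}"
  then have u: "Poly_Mapping.keys u \<subseteq> X" by simp
  have s: "linear_ext X \<phi> w = (\<Sum>x\<in>S. Poly_Mapping.lookup w x * \<phi> x)"
    if "Poly_Mapping.keys w \<subseteq> S" "finite S" "S \<subseteq> X" for w S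
    using that sum_keys_eq[of S w "\<lambda>x c. c * \<phi> x"] by (auto simp: linear_ext_def)
  have "Poly_Mapping.keys (Poly_Mapping.map ((*) c) u) \<subseteq> Poly_Mapping.keys u"
    by (auto simp: in_keys_iff lookup_map_times)
  then show "linear_ext X \<phi> (Poly_Mapping.map ((*) c) u) = scl ground_space c (linear_ext X \<phi> u)"
    using s[of _ "Poly_Mapping.keys u"] u
    by (simp add: lookup_map_times ground_space_def sum_distrib_left mult.assoc)
  assume "v \<in> {v. Poly_Mapping.keys v \<subseteq> X}"
  then have v: "Poly_Mapping.keys v \<subseteq> X" by simp
  show "linear_ext X \<phi> (u + v) = linear_ext X \<phi> u + linear_ext X \<phi> v"
    using s[of _ "Poly_Mapping.keys u \<union> Poly_Mapping.keys v"] u v keys_add[of u v]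
    by (simp add: lookup_add distrib_right sum.distrib)
qed (simp add: ground_space_def)

lemma linear_ext_in_hom_space: "linear_ext X \<phi> \<in> carr (hom_space (free_space X) ground_space)"
  by (simp add: hom_space_def linear_map_linear_ext carr_free_space) (simp add: linear_ext_def)

lemma linear_ext_single: "x \<in> X \<Longrightarrow> linear_ext X \<phi> (Poly_Mapping.single x 1) = \<phi> x"
  by (simp add: linear_ext_def)

lemma linear_iso_linear_ext:
  "linear_iso (fun_space X :: ('k::field, _) vspace) (hom_space (free_space X) ground_space) (linear_ext X)"
  unfolding linear_iso_def
proof
  show "linear_map (fun_space X :: ('k, _) vspace) (hom_space (free_space X) ground_space) (linear_ext X)"
    unfolding linear_map_def
  proof (intro conjI allI ballI)
    show "linear_ext X \<in> carr (fun_space X :: ('k, _) vspace) \<rightarrow> carr (hom_space (free_space X) ground_space)"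
      using linear_ext_in_hom_space by blast
    show "linear_ext X (\<phi> + \<psi>) = linear_ext X \<phi> + linear_ext X \<psi>" for \<phi> \<psi> :: "_ \<Rightarrow> 'k"
      by (auto simp: linear_ext_def fun_eq_iff distrib_left sum.distrib)
    show "linear_ext X (scl (fun_space X) c \<phi>) = scl (hom_space (free_space X) ground_space) c (linear_ext X \<phi>)"
      for c and \<phi> :: "_ \<Rightarrow> 'k"
      by (auto simp: linear_ext_def fun_eq_iff fun_space_def hom_space_def ground_space_def sum_distrib_left
        mult.left_commute)
  qed
  show "bij_betw (linear_ext X) (carr (fun_space X :: ('k, _) vspace)) (carr (hom_space (free_space X) ground_space))"
  proof (rule bij_betw_imageI)
    show "inj_on (linear_ext X) (carr (fun_space X :: ('k, _) vspace))"
    proof (rule inj_onI, rule ext)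
      fix \<phi> \<psi> :: "_ \<Rightarrow> 'k" and x
      assume c: "\<phi> \<in> carr (fun_space X)" "\<psi> \<in> carr (fun_space X)" and eq: "linear_ext X \<phi> = linear_ext X \<psi>"
      show "\<phi> x = \<psi> x"
      proof (cases "x \<in> X")
        case True
        show ?thesis
          using fun_cong[OF eq, of "Poly_Mapping.single x 1"] unfolding linear_ext_single[OF True] .
      qed (use c in \<open>simp add: fun_space_def\<close>)
    qed
    show "linear_ext X ` carr (fun_space X :: ('k, _) vspace) = carr (hom_space (free_space X) ground_space)"
    proof (intro equalityI subsetI)
      fix f :: "_ \<Rightarrow> 'k" assume f: "f \<in> carr (hom_space (free_space X) ground_space)"
      let ?\<phi> = "\<lambda>x. if x \<in> X then f (Poly_Mapping.single x 1) else 0"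
      have lin: "linear_map (free_space X) ground_space f" using f by (simp add: hom_space_def)
      have "f v = linear_ext X ?\<phi> v" for v
      proof (cases "Poly_Mapping.keys v \<subseteq> X")
        case True
        show ?thesis using linear_map_free_space_expand[OF lin True] True
          by (auto simp: linear_ext_def ground_space_def intro!: sum.cong)
      next
        case False
        then show ?thesis using f by (simp add: hom_space_def carr_free_space linear_ext_def)
      qed
      then have "f = linear_ext X ?\<phi>" by blast
      moreover have "?\<phi> \<in> carr (fun_space X)" by (simp add: fun_space_def)
      ultimately show "f \<in> linear_ext X ` carr (fun_space X)" by blast
    qed (use linear_ext_in_hom_space in blast)
  qed
qed

lemma free_map_linear_ext:
  assumes "Poly_Mapping.keys v \<subseteq> Y" "\<And>y. y \<in> Y \<Longrightarrow> h y \<in> X"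
  shows "linear_ext X \<phi> (free_map h v) = (\<Sum>y\<in>Poly_Mapping.keys v. Poly_Mapping.lookup v y * \<phi> (h y))"
proof -
  have h: "h y \<in> X" if "y \<in> Poly_Mapping.keys v" for y using that assms by blast
  have s: "Poly_Mapping.single (h y) c \<in> carr (free_space X)" if "y \<in> Poly_Mapping.keys v" for y c
    using h[OF that] by (simp add: carr_free_space)
  have "linear_ext X \<phi> (free_map h v) =
      (\<Sum>y\<in>Poly_Mapping.keys v. linear_ext X \<phi> (Poly_Mapping.single (h y) (Poly_Mapping.lookup v y)))"
    unfolding free_map_def by (rule linear_map_sum[OF vspace_on_free_space linear_map_linear_ext s])
  also have "\<dots> = (\<Sum>y\<in>Poly_Mapping.keys v. Poly_Mapping.lookup v y * \<phi> (h y))"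
    using h by (intro sum.cong) (auto simp: linear_ext_def)
  finally show ?thesis .
qed

lemma (in category) nerve_diff_linear_ext:
  "linear_ext (nerve C (Suc n)) (nerve_fun_diff C n \<phi>) = nerve_diff C n (linear_ext (nerve C n) \<phi>)"
proof
  fix v
  show "linear_ext (nerve C (Suc n)) (nerve_fun_diff C n \<phi>) v = nerve_diff C n (linear_ext (nerve C n) \<phi>) v"
  proof (cases "Poly_Mapping.keys v \<subseteq> nerve C (Suc n)")
    case True
    have "linear_ext (nerve C n) \<phi> (free_map (face C n i) v) =
        (\<Sum>c\<in>Poly_Mapping.keys v. Poly_Mapping.lookup v c * \<phi> (face C n i c))" if "i \<le> n + 1" for i
      using face_nerve that by (intro free_map_linear_ext[OF True]) auto
    then have "nerve_diff C n (linear_ext (nerve C n) \<phi>) v =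
        (\<Sum>i=0..n + 1. (-1) ^ i * (\<Sum>c\<in>Poly_Mapping.keys v. Poly_Mapping.lookup v c * \<phi> (face C n i c)))"
      using True by (simp add: nerve_diff_def carr_free_space)
    also have "\<dots> = (\<Sum>c\<in>Poly_Mapping.keys v. \<Sum>i=0..n + 1. Poly_Mapping.lookup v c * ((-1) ^ i * \<phi> (face C n i c)))"
      unfolding sum_distrib_left by (subst sum.swap) (simp add: mult.left_commute)
    also have "\<dots> = (\<Sum>c\<in>Poly_Mapping.keys v. Poly_Mapping.lookup v c * nerve_fun_diff C n \<phi> c)"
      using True by (intro sum.cong) (auto simp: nerve_fun_diff_def sum_distrib_left right_diff_distrib)
    finally show ?thesis using True by (simp add: linear_ext_def)
  qed (simp add: linear_ext_def nerve_diff_def carr_free_space)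
qed

lemma vspace_on_hom_space: "vspace_on (hom_space (free_space X :: ('k::field, _) vspace) ground_space)"
  unfolding vspace_on_def
proof (intro conjI allI ballI)
  let ?H = "hom_space (free_space X :: ('k, _) vspace) ground_space"
  show "0 \<in> carr ?H" by (simp add: hom_space_def linear_map_def ground_space_def)
  fix f g c assume f: "f \<in> carr ?H"
  show "scl ?H c f \<in> carr ?H"
    using f by (auto simp: hom_space_def linear_map_def ground_space_def distrib_left)
  assume g: "g \<in> carr ?H"
  show "f + g \<in> carr ?H" "f - g \<in> carr ?H"
    using f g by (auto simp: hom_space_def linear_map_def ground_space_def algebra_simps)
  show "scl ?H c (f + g) = scl ?H c f + scl ?H c g"
    by (auto simp: hom_space_def ground_space_def distrib_left fun_eq_iff)
qed

text \<open>Every cochain of \<open>W n\<close> has the form \<open>F n v\<close>, so linearity of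
  \<open>dW\<close> is inherited from \<open>dV\<close>; for the nerve this replaces a computation
  with \<open>free_map\<close>.\<close>

lemma cochain_complex_of_iso:
  assumes "cochain_complex V dV" "\<And>n. vspace_on (W n)" "\<And>n. linear_iso (V n) (W n) (F n)"
    and "\<And>n x. x \<in> carr (V n) \<Longrightarrow> F (Suc n) (dV n x) = dW n (F n x)"
  shows "cochain_complex W dW"
  unfolding cochain_complex_def linear_map_def
proof (intro allI conjI ballI assms(2))
  fix n
  have V: "vspace_on (V n)" and L: "linear_map (V n) (V (Suc n)) (dV n)"
    using assms(1) by (auto simp: cochain_complex_def)
  have F: "linear_map (V m) (W m) (F m)" for m using assms(3) by (simp add: linear_iso_def)
  have ex: "\<exists>v\<in>carr (V n). w = F n v" if "w \<in> carr (W n)" for w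
    using that assms(3)[of n] by (auto simp: linear_iso_def bij_betw_def)
  note c = linear_map_closed[OF L]
  show "dW n \<in> carr (W n) \<rightarrow> carr (W (Suc n))"
  proof
    fix w assume "w \<in> carr (W n)"
    then obtain v where "v \<in> carr (V n)" "w = F n v" using ex by blast
    then show "dW n w \<in> carr (W (Suc n))" using assms(4) c linear_map_closed[OF F] by metis
  qed
  show "dW n (x + y) = dW n x + dW n y" if xy: "x \<in> carr (W n)" "y \<in> carr (W n)" for x y
  proof -
    obtain u v where u: "u \<in> carr (V n)" "x = F n u" and v: "v \<in> carr (V n)" "y = F n v"
      using ex[OF xy(1)] ex[OF xy(2)] by blast
    have "dW n (x + y) = dW n (F n (u + v))" using linear_map_add[OF F u(1) v(1)] u v by simp
    also have "\<dots> = F (Suc n) (dV n (u + v))" using assms(4) vspace_on_closed(1)[OF V u(1) v(1)] by simp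
    also have "\<dots> = dW n x + dW n y"
      using linear_map_add[OF L u(1) v(1)] linear_map_add[OF F c[OF u(1)] c[OF v(1)]] assms(4) u v by simp
    finally show ?thesis .
  qed
  show "dW n (scl (W n) a x) = scl (W (Suc n)) a (dW n x)" if x: "x \<in> carr (W n)" for a x
  proof -
    obtain u where u: "u \<in> carr (V n)" "x = F n u" using ex[OF x] by blast
    have "dW n (scl (W n) a x) = dW n (F n (scl (V n) a u))" using linear_map_scl[OF F u(1)] u by simp
    also have "\<dots> = F (Suc n) (dV n (scl (V n) a u))" using assms(4) vspace_on_closed(3)[OF V u(1)] by simp
    also have "\<dots> = scl (W (Suc n)) a (dW n x)"
      using linear_map_scl[OF L u(1)] linear_map_scl[OF F c[OF u(1)]] assms(4) u by simp
    finally show ?thesis .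
  qed
qed

lemma (in category) nerve_fun_cohomology_iso:
  "graded_isomorphic
    (cohomology (\<lambda>n. fun_space (nerve C n) :: ('k::field, _) vspace) (nerve_fun_diff C))
    (simplicial_cohomology TYPE('k) C)"
  unfolding simplicial_cohomology_def
proof (rule cohomology_linear_iso_of_complex_iso[where F = "\<lambda>n. linear_ext (nerve C n)", OF cochain_complex_nerve])
  show iso: "linear_iso (fun_space (nerve C n) :: ('k, _) vspace) (nerve_cochains TYPE('k) C n) (linear_ext (nerve C n))" for n
    unfolding nerve_cochains_def by (rule linear_iso_linear_ext)
  show "cochain_complex (nerve_cochains TYPE('k) C) (nerve_diff C)"
  proof (rule cochain_complex_of_iso[OF cochain_complex_nerve])
    show "vspace_on (nerve_cochains TYPE('k) C n)" for n
      unfolding nerve_cochains_def by (rule vspace_on_hom_space)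
  qed (rule iso, rule nerve_diff_linear_ext)
qed (rule nerve_diff_linear_ext)

section \<open>The Hochschild complex of an algebra\<close>

lemma linear_map_cong:
  assumes "vspace_on V" "linear_map V W g" "\<And>x. x \<in> carr V \<Longrightarrow> f x = g x"
  shows "linear_map V W f"
  using assms(2) vspace_on_closed(1,3)[OF assms(1)] assms(3) unfolding linear_map_def by (simp add: Pi_iff)

lemma linear_map_comp: "linear_map U V f \<Longrightarrow> linear_map V W g \<Longrightarrow> linear_map U W (\<lambda>x. g (f x))"
  unfolding linear_map_def by (simp add: Pi_iff)

lemma linear_map_plus:
  assumes "vspace_on W" "linear_map V W f" "linear_map V W g"
  shows "linear_map V W (\<lambda>x. f x + g x)"
  unfolding linear_map_def
proof (intro conjI allI ballI)
  note f = linear_map_closed[OF assms(2)] and g = linear_map_closed[OF assms(3)]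
  show "(\<lambda>x. f x + g x) \<in> carr V \<rightarrow> carr W" using f g vspace_on_closed(1)[OF assms(1)] by blast
  show "f (x + y) + g (x + y) = f x + g x + (f y + g y)" if "x \<in> carr V" "y \<in> carr V" for x y
    using linear_map_add[OF assms(2) that] linear_map_add[OF assms(3) that] by (simp add: ac_simps)
  show "f (scl V c x) + g (scl V c x) = scl W c (f x + g x)" if "x \<in> carr V" for c x
    using linear_map_scl[OF assms(2) that] linear_map_scl[OF assms(3) that]
      vspace_on_closed(4)[OF assms(1) f[OF that] g[OF that]] by simp
qed

lemma linear_map_0: "vspace_on W \<Longrightarrow> linear_map V W (\<lambda>x. 0)"
  unfolding linear_map_def by (simp add: scl_zero vspace_on_zero)

lemma linear_map_sum_fun:
  assumes "vspace_on W" "\<And>i. i \<in> S \<Longrightarrow> linear_map V W (f i)"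
  shows "linear_map V W (\<lambda>x. \<Sum>i\<in>S. f i x)"
  using assms(2)
  by (induction S rule: infinite_finite_induct) (simp_all add: linear_map_0 linear_map_plus assms(1))

lemma scl_minus:
  fixes V :: "('k, 'v::ab_group_add, 'x) vspace_scheme"
  assumes "vspace_on V" "x \<in> carr V" "y \<in> carr V"
  shows "scl V c (x - y) = scl V c x - scl V c y"
  using vspace_on_closed(4)[OF assms(1) vspace_on_closed(2)[OF assms] assms(3), of c] by (simp add: algebra_simps)

lemma scl_sum:
  assumes "vspace_on V" "\<And>i. i \<in> S \<Longrightarrow> g i \<in> carr V"
  shows "scl V c (sum g S) = (\<Sum>i\<in>S. scl V c (g i))"
  using assms(2)
proof (induction S rule: infinite_finite_induct)
  case (insert i S)
  then have "sum g S \<in> carr V" "g i \<in> carr V" by (auto intro: sum_in_carr[OF assms(1)])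
  then show ?case using insert vspace_on_closed(4)[OF assms(1)] by simp
qed (simp_all add: scl_zero[OF assms(1)])

text \<open>Bilinearity of the product keeps the terms of \<open>hochschild_diff\<close>
  multilinear, and \<open>scl_scl\<close> lets two scalings commute, so that a scalar multiple of a
  linear map is again linear.\<close>

locale algebra_space =
  fixes A :: "('k::field, 'a::ab_group_add, 'x) alg_scheme"
  assumes vspace: "vspace_on A"
    and scl_scl: "x \<in> carr A \<Longrightarrow> scl A c (scl A d x) = scl A (c * d) x"
    and mul_linear_left: "v \<in> carr A \<Longrightarrow> linear_map A A (\<lambda>u. mul A u v)"
    and mul_linear_right: "u \<in> carr A \<Longrightarrow> linear_map A A (\<lambda>v. mul A u v)"
begin

lemma linear_map_scl_fun:
  assumes "linear_map A A f"
  shows "linear_map A A (\<lambda>x. scl A c (f x))"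
  unfolding linear_map_def
proof (intro conjI allI ballI)
  note f = linear_map_closed[OF assms]
  show "(\<lambda>x. scl A c (f x)) \<in> carr A \<rightarrow> carr A" using f vspace_on_closed(3)[OF vspace] by blast
  show "scl A c (f (x + y)) = scl A c (f x) + scl A c (f y)" if "x \<in> carr A" "y \<in> carr A" for x y
    using linear_map_add[OF assms that] vspace_on_closed(4)[OF vspace f[OF that(1)] f[OF that(2)]] by simp
  show "scl A c (f (scl A d x)) = scl A d (scl A c (f x))" if "x \<in> carr A" for d x
    using linear_map_scl[OF assms that] scl_scl[OF f[OF that]] by (simp add: mult.commute)
qed

lemma mul_closed: "u \<in> carr A \<Longrightarrow> v \<in> carr A \<Longrightarrow> mul A u v \<in> carr A"
  using linear_map_closed[OF mul_linear_left] .

lemma multilinear_closed: "multilinear A n f \<Longrightarrow> xs \<in> hochschild_dom A n \<Longrightarrow> f xs \<in> carr A"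
  by (simp add: multilinear_def)

lemma multilinear_linear:
  "multilinear A n f \<Longrightarrow> xs \<in> hochschild_dom A n \<Longrightarrow> i < n \<Longrightarrow> linear_map A A (\<lambda>x. f (xs[i := x]))"
  by (simp add: multilinear_def)

lemma hochschild_dom_faces:
  assumes "xs \<in> hochschild_dom A (Suc n)"
  shows "hd xs \<in> carr A" "last xs \<in> carr A" "tl xs \<in> hochschild_dom A n" "butlast xs \<in> hochschild_dom A n"
    "1 \<le> j \<Longrightarrow> j \<le> n \<Longrightarrow> merge (mul A) j xs \<in> hochschild_dom A n"
proof -
  have xs: "length xs = Suc n" "set xs \<subseteq> carr A" "xs \<noteq> []" using assms by (auto simp: hochschild_dom_def)
  show "hd xs \<in> carr A" "last xs \<in> carr A" using xs by auto
  show "tl xs \<in> hochschild_dom A n" using xs by (cases xs) (auto simp: hochschild_dom_def)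
  show "butlast xs \<in> hochschild_dom A n" using xs by (auto simp: hochschild_dom_def dest: in_set_butlastD)
  show "merge (mul A) j xs \<in> hochschild_dom A n" if "1 \<le> j" "j \<le> n"
  proof -
    have "xs ! (j - 1) \<in> carr A" "xs ! j \<in> carr A" using xs that by auto
    then have "mul A (xs ! (j - 1)) (xs ! j) \<in> carr A" by (rule mul_closed)
    then show ?thesis
      using xs that by (auto simp: hochschild_dom_def merge_def dest: in_set_takeD in_set_dropD)
  qed
qed

text \<open>Prepares linearity of the inner terms in argument \<open>i\<close>: a merged entry
  enters through one factor of the product at position \<open>j - 1\<close>, any other entry stays
  an argument, shifted by one if it lies behind the merge.\<close>

lemma merge_update:
  assumes "length xs = Suc n" "i \<le> n" "1 \<le> j" "j \<le> n"
  shows "merge f j (xs[i := x]) =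
    (if i = j - 1 then (merge f j xs)[j - 1 := f x (xs ! j)]
     else if i = j then (merge f j xs)[j - 1 := f (xs ! (j - 1)) x]
     else (merge f j xs)[(if i < j then i else i - 1) := x])" (is "_ = ?r")
proof (rule nth_equalityI)
  obtain j' where j: "j = Suc j'" using assms by (cases j) auto
  have len: "length (merge f j xs) = n" using assms by (simp add: length_merge)
  show "length (merge f j (xs[i := x])) = length ?r" using assms len by (simp add: length_merge)
  fix k assume "k < length (merge f j (xs[i := x]))"
  then have k: "k < n" using assms by (simp add: length_merge)
  consider "i < j'" | "i = j'" | "i = j" | "j < i" using j by linarith
  then show "merge f j (xs[i := x]) ! k = ?r ! k"
    using assms len k nth_merge[of j "xs[i := x]" k f] nth_merge[of j xs k f] unfolding j
    by cases (auto simp: nth_list_update)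
qed

lemma multilinear_hochschild_diff:
  assumes f: "multilinear A n f"
  shows "multilinear A (Suc n) (hochschild_diff A n f)"
  unfolding multilinear_def
proof (intro ballI conjI allI impI)
  fix xs assume xs: "xs \<in> hochschild_dom A (Suc n)"
  note faces = hochschild_dom_faces[OF xs]
  have len: "length xs = Suc n" and set: "set xs \<subseteq> carr A" and ne: "xs \<noteq> []"
    using xs by (auto simp: hochschild_dom_def)
  have nth: "xs ! k \<in> carr A" if "k \<le> n" for k using set len that by auto
  note cl = multilinear_closed[OF f] and lin = multilinear_linear[OF f] and vs = vspace_on_closed[OF vspace]
  have "(\<Sum>i=1..n. scl A ((-1) ^ i) (f (merge (mul A) i xs))) \<in> carr A"
    using faces(5) cl vs(3) by (intro sum_in_carr[OF vspace]) auto
  moreover have "mul A (hd xs) (f (tl xs)) \<in> carr A" "mul A (f (butlast xs)) (last xs) \<in> carr A"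
    using mul_closed faces cl by blast+
  ultimately show "hochschild_diff A n f xs \<in> carr A"
    using xs vs(1,3) by (simp add: hochschild_diff_def)
  fix i assume i: "i < Suc n"
  have up: "xs[i := x] \<in> hochschild_dom A (Suc n)" if "x \<in> carr A" for x
    using xs that set_update_subset_insert[of xs i x] by (auto simp: hochschild_dom_def)
  have first: "linear_map A A (\<lambda>x. mul A (hd (xs[i := x])) (f (tl (xs[i := x]))))"
  proof (cases i)
    case 0
    then have "hd (xs[i := x]) = x" "tl (xs[i := x]) = tl xs" for x using ne by (cases xs; simp)+
    then show ?thesis using mul_linear_left[OF cl[OF faces(3)]] by simp
  next
    case (Suc i')
    then have "hd (xs[i := x]) = hd xs" "tl (xs[i := x]) = (tl xs)[i' := x]" for x using ne by (cases xs; simp)+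
    then show ?thesis
      using linear_map_comp[OF lin[OF faces(3), of i'] mul_linear_right[OF faces(1)]] Suc i by simp
  qed
  have last: "linear_map A A (\<lambda>x. mul A (f (butlast (xs[i := x]))) (last (xs[i := x])))"
  proof (cases "i = n")
    case True
    then have "last (xs[i := x]) = x" "butlast (xs[i := x]) = butlast xs" for x
      using ne len by (simp_all add: last_list_update butlast_list_update)
    then show ?thesis using mul_linear_right[OF cl[OF faces(4)]] by simp
  next
    case False
    then have "last (xs[i := x]) = last xs" "butlast (xs[i := x]) = (butlast xs)[i := x]" for x
      using ne len by (simp_all add: last_list_update butlast_list_update)
    then show ?thesis
      using linear_map_comp[OF lin[OF faces(4), of i] mul_linear_left[OF faces(2)]] False i by simp
  qed
  have inner: "linear_map A A (\<lambda>x. f (merge (mul A) j (xs[i := x])))" if j: "1 \<le> j" "j \<le> n" for j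
  proof -
    note u = merge_update[OF len _ j, of i "mul A"] and d = faces(5)[OF j]
    have i': "i \<le> n" using i by simp
    consider "i = j - 1" | "i = j" | "i \<noteq> j - 1" "i \<noteq> j" by blast
    then show ?thesis
    proof cases
      case 1
      show ?thesis
        using linear_map_comp[OF mul_linear_left[OF nth[OF j(2)]] lin[OF d, of "j - 1"]] u[OF i'] 1 j by simp
    next
      case 2
      have "xs ! (j - 1) \<in> carr A" "j \<noteq> j - 1" using nth j by simp_all
      then show ?thesis
        using linear_map_comp[OF mul_linear_right lin[OF d, of "j - 1"]] u[OF i'] 2 j by simp
    next
      case 3
      have "(if i < j then i else i - 1) < n" using 3 i j by auto
      then show ?thesis using lin[OF d] u[OF i'] 3 by simp
    qed
  qed
  show "linear_map A A (\<lambda>x. hochschild_diff A n f (xs[i := x]))"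
  \<comment> \<open>The formula describes the differential only for \<open>x\<close> in
    \<open>carr A\<close>, while outside it is 0 by convention; hence a congruence restricted to the
    carrier.\<close>
  proof (rule linear_map_cong[OF vspace])
    show "linear_map A A (\<lambda>x. mul A (hd (xs[i := x])) (f (tl (xs[i := x])))
       + (\<Sum>j=1..n. scl A ((-1) ^ j) (f (merge (mul A) j (xs[i := x]))))
       + scl A ((-1) ^ (n + 1)) (mul A (f (butlast (xs[i := x]))) (last (xs[i := x]))))"
      using first last inner by (intro linear_map_plus linear_map_sum_fun linear_map_scl_fun vspace) auto
  qed (use up in \<open>simp add: hochschild_diff_def\<close>)
qed

lemma carr_hochschild_cochains:
  "f \<in> carr (hochschild_cochains A n) \<longleftrightarrow> multilinear A n f \<and> (\<forall>xs. xs \<notin> hochschild_dom A n \<longrightarrow> f xs = 0)"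
  by (simp add: hochschild_cochains_def)

lemma scl_hochschild_cochains: "scl (hochschild_cochains A n) c f = (\<lambda>xs. scl A c (f xs))"
  by (simp add: hochschild_cochains_def)

lemma multilinear_plus: "multilinear A n f \<Longrightarrow> multilinear A n g \<Longrightarrow> multilinear A n (f + g)"
  using linear_map_plus[OF vspace, of A] vspace_on_closed(1)[OF vspace] by (simp add: multilinear_def plus_fun_def)

lemma multilinear_scl: "multilinear A n f \<Longrightarrow> multilinear A n (\<lambda>xs. scl A c (f xs))"
  using linear_map_scl_fun vspace_on_closed(3)[OF vspace] by (simp add: multilinear_def)

lemma linear_map_minus:
  assumes "linear_map A A f" "linear_map A A g"
  shows "linear_map A A (\<lambda>x. f x - g x)"
  unfolding linear_map_def
proof (intro conjI allI ballI)
  note f = linear_map_closed[OF assms(1)] and g = linear_map_closed[OF assms(2)]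
  show "(\<lambda>x. f x - g x) \<in> carr A \<rightarrow> carr A" using f g vspace_on_closed(2)[OF vspace] by blast
  show "f (x + y) - g (x + y) = f x - g x + (f y - g y)" if "x \<in> carr A" "y \<in> carr A" for x y
    using linear_map_add[OF assms(1) that] linear_map_add[OF assms(2) that] by (simp add: algebra_simps)
  show "f (scl A c x) - g (scl A c x) = scl A c (f x - g x)" if "x \<in> carr A" for c x
    using linear_map_scl[OF assms(1) that] linear_map_scl[OF assms(2) that]
      scl_minus[OF vspace f[OF that] g[OF that]] by simp
qed

lemma multilinear_minus: "multilinear A n f \<Longrightarrow> multilinear A n g \<Longrightarrow> multilinear A n (f - g)"
  using linear_map_minus vspace_on_closed(2)[OF vspace] by (simp add: multilinear_def fun_diff_def)

lemma vspace_on_hochschild_cochains: "vspace_on (hochschild_cochains A n)"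
  unfolding vspace_on_def
proof (intro conjI allI ballI)
  let ?H = "hochschild_cochains A n"
  show "0 \<in> carr ?H"
    using linear_map_0[OF vspace, of A] vspace_on_zero[OF vspace] by (simp add: carr_hochschild_cochains multilinear_def)
  fix f g c assume f: "f \<in> carr ?H"
  show "scl ?H c f \<in> carr ?H"
    using f multilinear_scl scl_zero[OF vspace] by (simp add: carr_hochschild_cochains scl_hochschild_cochains)
  assume g: "g \<in> carr ?H"
  show "f + g \<in> carr ?H" "f - g \<in> carr ?H"
    using f g multilinear_plus multilinear_minus by (simp_all add: carr_hochschild_cochains)
  show "scl ?H c (f + g) = scl ?H c f + scl ?H c g"
  proof
    fix xs
    show "scl ?H c (f + g) xs = (scl ?H c f + scl ?H c g) xs"
    proof (cases "xs \<in> hochschild_dom A n")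
      case True
      then show ?thesis using f g vspace_on_closed(4)[OF vspace]
        by (simp add: carr_hochschild_cochains scl_hochschild_cochains multilinear_def)
    next
      case False
      then show ?thesis using f g scl_zero[OF vspace]
        by (simp add: carr_hochschild_cochains scl_hochschild_cochains)
    qed
  qed
qed

lemma cochain_complex_hochschild: "cochain_complex (hochschild_cochains A) (hochschild_diff A)"
  unfolding cochain_complex_def linear_map_def
proof (intro allI conjI ballI vspace_on_hochschild_cochains)
  fix n
  note vs = vspace_on_closed[OF vspace]
  show "hochschild_diff A n \<in> carr (hochschild_cochains A n) \<rightarrow> carr (hochschild_cochains A (Suc n))"
    using multilinear_hochschild_diff by (auto simp: carr_hochschild_cochains hochschild_diff_def)
  fix f assume "f \<in> carr (hochschild_cochains A n)"
  then have f: "multilinear A n f" by (simp add: carr_hochschild_cochains)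
  show "hochschild_diff A n (f + g) = hochschild_diff A n f + hochschild_diff A n g"
    if "g \<in> carr (hochschild_cochains A n)" for g
  proof
    fix xs
    have g: "multilinear A n g" using that by (simp add: carr_hochschild_cochains)
    note cl = multilinear_closed[OF f] multilinear_closed[OF g]
    show "hochschild_diff A n (f + g) xs = (hochschild_diff A n f + hochschild_diff A n g) xs"
    proof (cases "xs \<in> hochschild_dom A (Suc n)")
      case True
      note fa = hochschild_dom_faces[OF True]
      have "mul A (hd xs) (f (tl xs) + g (tl xs)) = mul A (hd xs) (f (tl xs)) + mul A (hd xs) (g (tl xs))"
        using linear_map_add[OF mul_linear_right[OF fa(1)]] cl fa(3) by blast
      moreover have "mul A (f (butlast xs) + g (butlast xs)) (last xs) =
          mul A (f (butlast xs)) (last xs) + mul A (g (butlast xs)) (last xs)"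
        using linear_map_add[OF mul_linear_left[OF fa(2)]] cl fa(4) by blast
      moreover have "(\<Sum>i=1..n. scl A ((-1) ^ i) (f (merge (mul A) i xs) + g (merge (mul A) i xs))) =
          (\<Sum>i=1..n. scl A ((-1) ^ i) (f (merge (mul A) i xs)) + scl A ((-1) ^ i) (g (merge (mul A) i xs)))"
        using vs(4) cl fa(5) by (intro sum.cong) auto
      moreover have "mul A (f (butlast xs)) (last xs) \<in> carr A" "mul A (g (butlast xs)) (last xs) \<in> carr A"
        using mul_closed cl fa by blast+
      ultimately show ?thesis
        using True vs(4) by (simp add: hochschild_diff_def sum.distrib ac_simps)
    qed (simp add: hochschild_diff_def)
  qed
  show "hochschild_diff A n (scl (hochschild_cochains A n) c f) =
      scl (hochschild_cochains A (Suc n)) c (hochschild_diff A n f)" for c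
  proof
    fix xs
    note cl = multilinear_closed[OF f]
    show "hochschild_diff A n (scl (hochschild_cochains A n) c f) xs =
        scl (hochschild_cochains A (Suc n)) c (hochschild_diff A n f) xs"
    proof (cases "xs \<in> hochschild_dom A (Suc n)")
      case True
      note fa = hochschild_dom_faces[OF True]
      let ?S = "\<Sum>i=1..n. scl A ((-1) ^ i) (f (merge (mul A) i xs))"
      let ?a = "mul A (hd xs) (f (tl xs))" and ?b = "mul A (f (butlast xs)) (last xs)"
      have ab: "?a \<in> carr A" "?b \<in> carr A" using mul_closed cl fa by blast+
      have m: "f (merge (mul A) i xs) \<in> carr A" if "i \<in> {1..n}" for i using cl fa(5) that by simp
      then have S: "?S \<in> carr A" using vs(3) by (intro sum_in_carr[OF vspace]) auto
      have "mul A (hd xs) (scl A c (f (tl xs))) = scl A c ?a"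
        using linear_map_scl[OF mul_linear_right[OF fa(1)] cl[OF fa(3)]] .
      moreover have "mul A (scl A c (f (butlast xs))) (last xs) = scl A c ?b"
        using linear_map_scl[OF mul_linear_left[OF fa(2)] cl[OF fa(4)]] .
      moreover have "(\<Sum>i=1..n. scl A ((-1) ^ i) (scl A c (f (merge (mul A) i xs)))) = scl A c ?S"
        using m vs(3) by (subst scl_sum[OF vspace]) (auto simp: scl_scl mult.commute intro!: sum.cong)
      moreover have "scl A d (scl A c ?b) = scl A c (scl A d ?b)" for d
        using ab by (simp add: scl_scl mult.commute)
      moreover have "scl A c (?a + ?S + scl A d ?b) = scl A c ?a + scl A c ?S + scl A c (scl A d ?b)" for d
        using ab S vs by simp
      ultimately show ?thesis
        using True by (simp add: hochschild_diff_def scl_hochschild_cochains)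
    qed (simp add: hochschild_diff_def scl_hochschild_cochains scl_zero[OF vspace])
  qed
qed

end

section \<open>The category algebra\<close>

lemma (in finite_category) finite_Mor: "finite (Mor C)"
proof -
  have "Mor C = (\<Union>x\<in>Ob C. \<Union>y\<in>Ob C. Hom C x y)"
    using src_in_Ob tgt_in_Ob by (auto simp: Hom_def)
  then show ?thesis using finite_Ob finite_Hom by simp
qed

abbreviation basis_elem :: "'m \<Rightarrow> 'm \<Rightarrow>\<^sub>0 'k::field"
  where "basis_elem g \<equiv> Poly_Mapping.single g 1"

lemma carr_category_algebra: "carr (category_algebra K C) = {v. Poly_Mapping.keys v \<subseteq> Mor C}"
  by (simp add: category_algebra_def free_space_def)

lemma scl_category_algebra: "scl (category_algebra K C) c v = Poly_Mapping.map ((*) c) v"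
  by (simp add: category_algebra_def free_space_def)

lemma lookup_outside: "v \<in> carr (category_algebra K C) \<Longrightarrow> x \<notin> Mor C \<Longrightarrow> Poly_Mapping.lookup v x = 0"
  by (auto simp: carr_category_algebra in_keys_iff)

lemma mul_basis_elem:
  "mul (category_algebra K C) (basis_elem a) (basis_elem b) =
    (if src C a = tgt C b then basis_elem (cmp C a b) else 0)"
  by (simp add: category_algebra_def)

context finite_category
begin

text \<open>Summing over all morphisms instead of the supports of \<open>u\<close> and
  \<open>v\<close> gives a range independent of both, so that bilinearity can be read off term by
  term.\<close>

lemma lookup_mul:
  fixes K :: "'k::field itself"
  assumes "u \<in> carr (category_algebra K C)" "v \<in> carr (category_algebra K C)"
  shows "Poly_Mapping.lookup (mul (category_algebra K C) u v) h =
    (\<Sum>a\<in>Mor C. \<Sum>b\<in>Mor C. if src C a = tgt C b \<and> cmp C a b = h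
      then Poly_Mapping.lookup u a * Poly_Mapping.lookup v b else 0)"
proof -
  have k: "Poly_Mapping.keys u \<subseteq> Mor C" "Poly_Mapping.keys v \<subseteq> Mor C"
    using assms by (auto simp: carr_category_algebra)
  have "Poly_Mapping.lookup (mul (category_algebra K C) u v) h =
    (\<Sum>a\<in>Poly_Mapping.keys u. \<Sum>b\<in>Poly_Mapping.keys v. if src C a = tgt C b \<and> cmp C a b = h
      then Poly_Mapping.lookup u a * Poly_Mapping.lookup v b else 0)"
    by (auto simp: category_algebra_def lookup_sum lookup_single when_def intro!: sum.cong)
  also have "\<dots> = (\<Sum>a\<in>Poly_Mapping.keys u. \<Sum>b\<in>Mor C. if src C a = tgt C b \<and> cmp C a b = h
      then Poly_Mapping.lookup u a * Poly_Mapping.lookup v b else 0)"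
    using k finite_Mor by (intro sum.cong sum.mono_neutral_left) (auto simp: in_keys_iff)
  also have "\<dots> = (\<Sum>a\<in>Mor C. \<Sum>b\<in>Mor C. if src C a = tgt C b \<and> cmp C a b = h
      then Poly_Mapping.lookup u a * Poly_Mapping.lookup v b else 0)"
    using k finite_Mor by (intro sum.mono_neutral_left) (auto simp: in_keys_iff intro!: sum.neutral)
  finally show ?thesis .
qed

lemma mul_in_carr:
  assumes "u \<in> carr (category_algebra K C)" "v \<in> carr (category_algebra K C)"
  shows "mul (category_algebra K C) u v \<in> carr (category_algebra K C)"
proof -
  have "Poly_Mapping.lookup (mul (category_algebra K C) u v) h = 0" if "h \<notin> Mor C" for h
    unfolding lookup_mul[OF assms] using that cmp_ends(1) by (intro sum.neutral ballI) auto
  then show ?thesis by (auto simp: carr_category_algebra in_keys_iff)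
qed

lemma vspace_on_category_algebra: "vspace_on (category_algebra K C)"
  using vspace_on_free_space[of "Mor C"]
  by (simp add: vspace_on_def carr_free_space scl_free_space carr_category_algebra scl_category_algebra)

lemma algebra_space_category_algebra: "algebra_space (category_algebra (K :: 'k::field itself) C)"
proof
  let ?A = "category_algebra K C"
  note vs = vspace_on_closed[OF vspace_on_category_algebra]
  have sc: "Poly_Mapping.lookup (scl ?A c v) x = c * Poly_Mapping.lookup v x" for c v x
    by (simp add: scl_category_algebra lookup_map_times)
  show "vspace_on ?A" by (rule vspace_on_category_algebra)
  show "scl ?A c (scl ?A d x) = scl ?A (c * d) x" for c d x
    by (rule poly_mapping_eqI) (simp add: sc)
  show "linear_map ?A ?A (\<lambda>u. mul ?A u v)" if v: "v \<in> carr ?A" for v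
    unfolding linear_map_def
  proof (intro conjI allI ballI)
    show "(\<lambda>u. mul ?A u v) \<in> carr ?A \<rightarrow> carr ?A" using mul_in_carr v by blast
    show "mul ?A (x + y) v = mul ?A x v + mul ?A y v" if "x \<in> carr ?A" "y \<in> carr ?A" for x y
      using that v vs(1)[OF that]
      by (intro poly_mapping_eqI) (auto simp: lookup_mul lookup_add distrib_right simp flip: sum.distrib intro!: sum.cong)
    show "mul ?A (scl ?A c x) v = scl ?A c (mul ?A x v)" if "x \<in> carr ?A" for c x
      using that v vs(3)[OF that]
      by (intro poly_mapping_eqI) (auto simp: lookup_mul sc sum_distrib_left intro!: sum.cong)
  qed
  show "linear_map ?A ?A (\<lambda>v. mul ?A u v)" if u: "u \<in> carr ?A" for u
    unfolding linear_map_def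
  proof (intro conjI allI ballI)
    show "(\<lambda>v. mul ?A u v) \<in> carr ?A \<rightarrow> carr ?A" using mul_in_carr u by blast
    show "mul ?A u (x + y) = mul ?A u x + mul ?A u y" if "x \<in> carr ?A" "y \<in> carr ?A" for x y
      using that u vs(1)[OF that]
      by (intro poly_mapping_eqI) (auto simp: lookup_mul lookup_add distrib_left simp flip: sum.distrib intro!: sum.cong)
    show "mul ?A u (scl ?A c x) = scl ?A c (mul ?A u x)" if "x \<in> carr ?A" for c x
      using that u vs(3)[OF that]
      by (intro poly_mapping_eqI) (auto simp: lookup_mul sc sum_distrib_left intro!: sum.cong)
  qed
qed

lemma basis_elem_in_carr: "g \<in> Mor C \<Longrightarrow> basis_elem g \<in> carr (category_algebra K C)"
  by (simp add: carr_category_algebra)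

lemma basis_dom: "set gs \<subseteq> Mor C \<Longrightarrow> map basis_elem gs \<in> hochschild_dom (category_algebra K C) (length gs)"
  by (auto simp: hochschild_dom_def intro!: basis_elem_in_carr)

lemma linear_map_category_algebra_zero:
  fixes K :: "'k::field itself"
  assumes L: "linear_map (category_algebra K C) (category_algebra K C) L"
    and z: "\<And>g. g \<in> Mor C \<Longrightarrow> L (basis_elem g) = 0" and v: "v \<in> carr (category_algebra K C)"
  shows "L v = 0"
proof -
  let ?A = "category_algebra K C"
  have L': "linear_map (free_space (Mor C)) ?A L"
    using L by (simp add: linear_map_def carr_free_space scl_free_space carr_category_algebra scl_category_algebra)
  have k: "Poly_Mapping.keys v \<subseteq> Mor C" using v by (simp add: carr_category_algebra)
  show ?thesis
    unfolding linear_map_free_space_expand[OF L' k]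
    using k z by (intro sum.neutral) (auto simp: scl_zero[OF vspace_on_category_algebra])
qed

text \<open>Arguments are freed one at a time: the induction allows the first \<open>k\<close> of
  them to be arbitrary while the rest are basis elements, and its step uses linearity in argument
  \<open>k\<close>.\<close>

lemma multilinear_zero:
  fixes K :: "'k::field itself"
  defines "A \<equiv> category_algebra K C"
  assumes f: "multilinear A n f"
    and z: "\<And>gs. set gs \<subseteq> Mor C \<Longrightarrow> length gs = n \<Longrightarrow> f (map basis_elem gs) = 0"
    and xs: "xs \<in> hochschild_dom A n"
  shows "f xs = 0"
proof -
  have "f xs = 0"
    if "xs \<in> hochschild_dom A n" "k \<le> n" "\<forall>i<n. k \<le> i \<longrightarrow> (\<exists>g\<in>Mor C. xs ! i = basis_elem g)" for xs k
    using that
  proof (induction k arbitrary: xs)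
    case 0
    then have len: "length xs = n" by (simp add: hochschild_dom_def)
    obtain G where G: "\<And>i. i < n \<Longrightarrow> G i \<in> Mor C \<and> xs ! i = basis_elem (G i)" using 0(3) by (metis le0)
    have "xs = map basis_elem (map G [0..<n])"
      using G len by (intro nth_equalityI) auto
    moreover have "set (map G [0..<n]) \<subseteq> Mor C" using G by auto
    ultimately show ?case using z[of "map G [0..<n]"] by simp
  next
    case (Suc k)
    then have len: "length xs = n" and set: "set xs \<subseteq> carr A" and k: "k < n" by (auto simp: hochschild_dom_def)
    have "f (xs[k := basis_elem g]) = 0" if "g \<in> Mor C" for g
    proof (rule Suc.IH)
      have "basis_elem g \<in> carr A" unfolding A_def by (rule basis_elem_in_carr[OF that])
      then show "xs[k := basis_elem g] \<in> hochschild_dom A n"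
        using Suc.prems(1) set_update_subset_insert[of xs k "basis_elem g"] by (auto simp: hochschild_dom_def)
      show "\<forall>i<n. k \<le> i \<longrightarrow> (\<exists>g'\<in>Mor C. xs[k := basis_elem g] ! i = basis_elem g')"
      proof (intro allI impI)
        fix i assume i: "i < n" "k \<le> i"
        show "\<exists>g'\<in>Mor C. xs[k := basis_elem g] ! i = basis_elem g'"
          using Suc.prems(3) that i len by (cases "i = k") auto
      qed
    qed (use k in simp)
    moreover have "linear_map A A (\<lambda>x. f (xs[k := x]))" using f Suc.prems(1) k by (simp add: multilinear_def)
    moreover have "xs ! k \<in> carr A" using set len k by auto
    ultimately have "f (xs[k := xs ! k]) = 0"
      unfolding A_def using linear_map_category_algebra_zero[of K "\<lambda>x. f (xs[k := x])" "xs ! k"] by simp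
    then show ?case by simp
  qed
  from this[of xs n] show ?thesis using xs by simp
qed

end

section \<open>Coordinates of Hochschild cochains\<close>

definition basis_eval :: "('o, 'm) cat \<Rightarrow> nat \<Rightarrow> (('m \<Rightarrow>\<^sub>0 'k) list \<Rightarrow> ('m \<Rightarrow>\<^sub>0 'k)) \<Rightarrow> 'm list \<times> 'm \<Rightarrow> 'k::field"
  where "basis_eval C n f = (\<lambda>(gs, h). if (gs, h) \<in> word_dom C n
    then Poly_Mapping.lookup (f (map basis_elem gs)) h else 0)"

text \<open>The multilinear map with structure constants \<open>\<Phi>\<close>. Both sums are
  genuine because \<open>Mor C\<close> is finite; over an infinite range they would collapse to
  0.\<close>

definition multilinear_ext :: "'k::field itself \<Rightarrow> ('o, 'm) cat \<Rightarrow> nat \<Rightarrow> ('m list \<times> 'm \<Rightarrow> 'k)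
    \<Rightarrow> ('m \<Rightarrow>\<^sub>0 'k) list \<Rightarrow> ('m \<Rightarrow>\<^sub>0 'k)"
  where "multilinear_ext K C n \<Phi> xs = (if xs \<in> hochschild_dom (category_algebra K C) n
    then \<Sum>h\<in>Mor C. Poly_Mapping.single h (\<Sum>gs | set gs \<subseteq> Mor C \<and> length gs = n.
      (\<Prod>i<n. Poly_Mapping.lookup (xs ! i) (gs ! i)) * \<Phi> (gs, h)) else 0)"

context finite_category
begin

lemma lookup_multilinear_ext:
  fixes K :: "'k::field itself"
  assumes "xs \<in> hochschild_dom (category_algebra K C) n"
  shows "Poly_Mapping.lookup (multilinear_ext K C n \<Phi> xs) h = (if h \<in> Mor C then
    \<Sum>gs | set gs \<subseteq> Mor C \<and> length gs = n. (\<Prod>i<n. Poly_Mapping.lookup (xs ! i) (gs ! i)) * \<Phi> (gs, h) else 0)"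
  using assms finite_Mor by (simp add: multilinear_ext_def lookup_sum lookup_single when_def)

lemma multilinear_multilinear_ext:
  fixes K :: "'k::field itself"
  shows "multilinear (category_algebra K C) n (multilinear_ext K C n \<Phi>)"
  unfolding multilinear_def
proof (intro ballI conjI allI impI)
  let ?A = "category_algebra K C" and ?f = "multilinear_ext K C n \<Phi>"
  fix xs assume xs: "xs \<in> hochschild_dom ?A n"
  have cl: "?f ys \<in> carr ?A" if "ys \<in> hochschild_dom ?A n" for ys
    using lookup_multilinear_ext[OF that] by (auto simp: carr_category_algebra in_keys_iff split: if_splits)
  then show "?f xs \<in> carr ?A" using xs .
  fix j assume j: "j < n"
  have len: "length xs = n" using xs by (simp add: hochschild_dom_def)
  have up: "xs[j := x] \<in> hochschild_dom ?A n" if "x \<in> carr ?A" for x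
    using xs that set_update_subset_insert[of xs j x] by (auto simp: hochschild_dom_def)
  \<comment> \<open>Isolates the only factor that depends on \<open>x\<close>, which makes linearity
    in argument \<open>j\<close> visible.\<close>
  have P: "(\<Prod>i<n. Poly_Mapping.lookup (xs[j := x] ! i) (gs ! i)) =
      Poly_Mapping.lookup x (gs ! j) * (\<Prod>i\<in>{..<n} - {j}. Poly_Mapping.lookup (xs ! i) (gs ! i))" for x gs
  proof -
    have "(\<Prod>i<n. Poly_Mapping.lookup (xs[j := x] ! i) (gs ! i)) =
        Poly_Mapping.lookup x (gs ! j) * (\<Prod>i\<in>{..<n} - {j}. Poly_Mapping.lookup (xs[j := x] ! i) (gs ! i))"
      using j len by (subst prod.remove[of _ j]) auto
    also have "(\<Prod>i\<in>{..<n} - {j}. Poly_Mapping.lookup (xs[j := x] ! i) (gs ! i)) =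
        (\<Prod>i\<in>{..<n} - {j}. Poly_Mapping.lookup (xs ! i) (gs ! i))"
      by (intro prod.cong) auto
    finally show ?thesis .
  qed
  note vs = vspace_on_closed[OF vspace_on_category_algebra]
  show "linear_map ?A ?A (\<lambda>x. ?f (xs[j := x]))"
    unfolding linear_map_def
  proof (intro conjI allI ballI)
    show "(\<lambda>x. ?f (xs[j := x])) \<in> carr ?A \<rightarrow> carr ?A" using cl up by blast
    show "?f (xs[j := x + y]) = ?f (xs[j := x]) + ?f (xs[j := y])" if "x \<in> carr ?A" "y \<in> carr ?A" for x y
      using up[OF that(1)] up[OF that(2)] up[OF vs(1)[OF that]]
      by (intro poly_mapping_eqI) (simp add: lookup_multilinear_ext lookup_add P distrib_right sum.distrib)
    show "?f (xs[j := scl ?A c x]) = scl ?A c (?f (xs[j := x]))" if "x \<in> carr ?A" for c x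
      using up[OF that] up[OF vs(3)[OF that]]
      by (intro poly_mapping_eqI)
        (simp add: lookup_multilinear_ext scl_category_algebra lookup_map_times P sum_distrib_left mult.assoc)
  qed
qed

lemma basis_eval_multilinear_ext:
  fixes K :: "'k::field itself"
  assumes "\<Phi> \<in> carr (fun_space (word_dom C n))"
  shows "basis_eval C n (multilinear_ext K C n \<Phi>) = \<Phi>"
proof
  fix w :: "'b list \<times> 'b"
  obtain gs h where w: "w = (gs, h)" by (cases w)
  show "basis_eval C n (multilinear_ext K C n \<Phi>) w = \<Phi> w"
  proof (cases "w \<in> word_dom C n")
    case True
    then have gs: "length gs = n" "set gs \<subseteq> Mor C" "h \<in> Mor C" by (auto simp: w word_dom_def)
    \<comment> \<open>On basis elements the product of coordinates is a Kronecker delta on lists,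
      which picks a single summand.\<close>
    have P: "(\<Prod>i<n. Poly_Mapping.lookup (map basis_elem gs ! i) (gs' ! i)) = (if gs' = gs then 1 else 0 :: 'k)"
      if l: "length gs' = n" for gs'
    proof (cases "gs' = gs")
      case False
      then obtain i where "i < n" "gs' ! i \<noteq> gs ! i" using gs(1) l nth_equalityI[of gs' gs] by auto
      then have "\<exists>i\<in>{..<n}. Poly_Mapping.lookup (map basis_elem gs ! i) (gs' ! i) = (0 :: 'k)"
        using gs(1) by (intro bexI[of _ i]) (auto simp: lookup_single when_def)
      then show ?thesis using False by (simp add: prod_zero)
    qed (use gs in \<open>simp add: lookup_single\<close>)
    have fin: "finite {gs. set gs \<subseteq> Mor C \<and> length gs = n}" by (rule finite_lists_length_eq[OF finite_Mor])
    have "(\<Sum>gs' | set gs' \<subseteq> Mor C \<and> length gs' = n.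
        (\<Prod>i<n. Poly_Mapping.lookup (map basis_elem gs ! i) (gs' ! i)) * \<Phi> (gs', h)) =
        (\<Sum>gs' | set gs' \<subseteq> Mor C \<and> length gs' = n. if gs' = gs then \<Phi> (gs', h) else 0)"
      by (intro sum.cong) (auto simp: P)
    also have "\<dots> = \<Phi> (gs, h)" using gs fin by simp
    finally show ?thesis
      using True gs basis_dom[OF gs(2), of K] by (simp add: basis_eval_def lookup_multilinear_ext w)
  next
    case False
    then show ?thesis using assms by (simp add: basis_eval_def w fun_space_def)
  qed
qed

text \<open>A multilinear map is determined by its values on basis elements
  (\<open>multilinear_zero\<close>), and these can be prescribed freely
  (\<open>multilinear_ext\<close>).\<close>

lemma linear_iso_basis_eval:
  fixes K :: "'k::field itself"
  shows "linear_iso (hochschild_cochains (category_algebra K C) n) (fun_space (word_dom C n)) (basis_eval C n)"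
proof -
  let ?A = "category_algebra K C"
  interpret A: algebra_space ?A by (rule algebra_space_category_algebra)
  let ?H = "hochschild_cochains ?A n" and ?W = "fun_space (word_dom C n) :: ('k, _) vspace"
  have lin: "linear_map ?H ?W (basis_eval C n)"
    by (auto simp: linear_map_def basis_eval_def fun_space_def fun_eq_iff lookup_add
      A.scl_hochschild_cochains scl_category_algebra lookup_map_times)
  have inj: "f = 0" if f: "f \<in> carr ?H" and z: "basis_eval C n f = 0" for f
  proof
    fix xs
    have m: "multilinear ?A n f" using f by (simp add: A.carr_hochschild_cochains)
    have "f (map basis_elem gs) = 0" if gs: "set gs \<subseteq> Mor C" "length gs = n" for gs
    proof (rule poly_mapping_eqI)
      fix h
      have c: "f (map basis_elem gs) \<in> carr ?A"
        using A.multilinear_closed[OF m] basis_dom[OF gs(1), of K] gs(2) by simp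
      show "Poly_Mapping.lookup (f (map basis_elem gs)) h = Poly_Mapping.lookup 0 h"
      proof (cases "h \<in> Mor C")
        case True
        then show ?thesis using fun_cong[OF z, of "(gs, h)"] gs by (simp add: basis_eval_def word_dom_def)
      next
        case False
        then show ?thesis using lookup_outside[OF c] by simp
      qed
    qed
    then show "f xs = 0 xs"
      using multilinear_zero[OF m] f by (cases "xs \<in> hochschild_dom ?A n") (auto simp: A.carr_hochschild_cochains)
  qed
  have "bij_betw (basis_eval C n) (carr ?H) (carr ?W)"
  proof (rule bij_betw_imageI)
    show "inj_on (basis_eval C n) (carr ?H)"
    proof (rule inj_onI)
      fix f g assume fg: "f \<in> carr ?H" "g \<in> carr ?H" and eq: "basis_eval C n f = basis_eval C n g"
      have "basis_eval C n (f - g) = 0"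
        using linear_map_diff[OF A.vspace_on_hochschild_cochains lin fg] eq by simp
      then have "f - g = 0" by (rule inj[OF vspace_on_closed(2)[OF A.vspace_on_hochschild_cochains fg]])
      then show "f = g" by simp
    qed
    show "basis_eval C n ` carr ?H = carr ?W"
    proof (intro equalityI subsetI)
      fix \<Phi> assume \<Phi>: "\<Phi> \<in> carr ?W"
      have "multilinear_ext K C n \<Phi> \<in> carr ?H"
        using multilinear_multilinear_ext by (simp add: A.carr_hochschild_cochains multilinear_ext_def)
      then show "\<Phi> \<in> basis_eval C n ` carr ?H"
        using basis_eval_multilinear_ext[OF \<Phi>, of K] by (metis imageI)
    qed (use linear_map_closed[OF lin] in blast)
  qed
  then show ?thesis using lin by (simp add: linear_iso_def)
qed

text \<open>In a general category several \<open>h'\<close> may satisfy \<open>g h' = h\<close>, so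
  a coefficient of the product collects all of them; this is the origin of the outer sums in
  \<open>word_diff\<close>.\<close>

lemma lookup_mul_basis_left:
  assumes "g \<in> Mor C" "v \<in> carr (category_algebra K C)"
  shows "Poly_Mapping.lookup (mul (category_algebra K C) (basis_elem g) v) h =
    (\<Sum>h' | h' \<in> Mor C \<and> src C g = tgt C h' \<and> cmp C g h' = h. Poly_Mapping.lookup v h')"
proof -
  have "Poly_Mapping.lookup (mul (category_algebra K C) (basis_elem g) v) h =
    (\<Sum>a\<in>Mor C. if a = g then \<Sum>b\<in>Mor C. if src C g = tgt C b \<and> cmp C g b = h
      then Poly_Mapping.lookup v b else 0 else 0)"
    unfolding lookup_mul[OF basis_elem_in_carr[OF assms(1)] assms(2)]
    by (intro sum.cong) (auto simp: lookup_single when_def intro!: sum.neutral sum.cong)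
  also have "\<dots> = (\<Sum>b\<in>Mor C. if src C g = tgt C b \<and> cmp C g b = h then Poly_Mapping.lookup v b else 0)"
    using assms(1) finite_Mor by simp
  also have "\<dots> = (\<Sum>h' | h' \<in> Mor C \<and> src C g = tgt C h' \<and> cmp C g h' = h. Poly_Mapping.lookup v h')"
    using finite_Mor by (intro sum.mono_neutral_cong_right) auto
  finally show ?thesis .
qed

lemma lookup_mul_basis_right:
  assumes "g \<in> Mor C" "v \<in> carr (category_algebra K C)"
  shows "Poly_Mapping.lookup (mul (category_algebra K C) v (basis_elem g)) h =
    (\<Sum>h' | h' \<in> Mor C \<and> src C h' = tgt C g \<and> cmp C h' g = h. Poly_Mapping.lookup v h')"
proof -
  have "Poly_Mapping.lookup (mul (category_algebra K C) v (basis_elem g)) h =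
    (\<Sum>a\<in>Mor C. \<Sum>b\<in>Mor C. if b = g then if src C a = tgt C g \<and> cmp C a g = h
      then Poly_Mapping.lookup v a else 0 else 0)"
    unfolding lookup_mul[OF assms(2) basis_elem_in_carr[OF assms(1)]]
    by (intro sum.cong) (auto simp: lookup_single when_def)
  also have "\<dots> = (\<Sum>a\<in>Mor C. if src C a = tgt C g \<and> cmp C a g = h then Poly_Mapping.lookup v a else 0)"
    using assms(1) finite_Mor by simp
  also have "\<dots> = (\<Sum>h' | h' \<in> Mor C \<and> src C h' = tgt C g \<and> cmp C h' g = h. Poly_Mapping.lookup v h')"
    using finite_Mor by (intro sum.mono_neutral_cong_right) auto
  finally show ?thesis .
qed

lemma basis_eval_diff:
  fixes K :: "'k::field itself"
  assumes f: "f \<in> carr (hochschild_cochains (category_algebra K C) n)"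
  shows "basis_eval C (Suc n) (hochschild_diff (category_algebra K C) n f) = word_diff C n (basis_eval C n f)"
proof
  fix w :: "'b list \<times> 'b"
  let ?A = "category_algebra K C"
  interpret A: algebra_space ?A by (rule algebra_space_category_algebra)
  have m: "multilinear ?A n f" using f by (simp add: A.carr_hochschild_cochains)
  obtain gs h where w: "w = (gs, h)" by (cases w)
  show "basis_eval C (Suc n) (hochschild_diff ?A n f) w = word_diff C n (basis_eval C n f) w"
  proof (cases "w \<in> word_dom C (Suc n)")
    case True
    then have dom: "(gs, h) \<in> word_dom C (Suc n)" and gs: "length gs = Suc n" "set gs \<subseteq> Mor C" "h \<in> Mor C" "gs \<noteq> []"
      by (auto simp: w word_dom_def)
    let ?xs = "map basis_elem gs :: ('b \<Rightarrow>\<^sub>0 'k) list"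
    have xs: "?xs \<in> hochschild_dom ?A (Suc n)" using basis_dom[OF gs(2), of K] gs(1) by simp
    note fa = A.hochschild_dom_faces[OF xs] and cl = A.multilinear_closed[OF m]
    have hd: "hd ?xs = basis_elem (hd gs)" "tl ?xs = map basis_elem (tl gs)" "hd gs \<in> Mor C"
      and la: "last ?xs = basis_elem (last gs)" "butlast ?xs = map basis_elem (butlast gs)" "last gs \<in> Mor C"
      using gs by (auto simp: hd_map last_map map_tl map_butlast)
    have tl_dom: "(tl gs, h') \<in> word_dom C n" and bl_dom: "(butlast gs, h') \<in> word_dom C n" if "h' \<in> Mor C" for h'
      using gs that by (auto simp: word_dom_def dest: in_set_butlastD list.set_sel(2))
    have 1: "Poly_Mapping.lookup (mul ?A (hd ?xs) (f (tl ?xs))) h =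
        (\<Sum>h' | h' \<in> Mor C \<and> src C (hd gs) = tgt C h' \<and> cmp C (hd gs) h' = h. basis_eval C n f (tl gs, h'))"
      using lookup_mul_basis_left[OF hd(3) cl[OF fa(3)]] tl_dom
      by (auto simp: hd basis_eval_def intro!: sum.cong)
    have 3: "Poly_Mapping.lookup (mul ?A (f (butlast ?xs)) (last ?xs)) h =
        (\<Sum>h' | h' \<in> Mor C \<and> src C h' = tgt C (last gs) \<and> cmp C h' (last gs) = h. basis_eval C n f (butlast gs, h'))"
      using lookup_mul_basis_right[OF la(3) cl[OF fa(4)]] bl_dom
      by (auto simp: la basis_eval_def intro!: sum.cong)
    have 2: "Poly_Mapping.lookup (f (merge (mul ?A) i ?xs)) h =
        (if src C (gs ! (i - 1)) = tgt C (gs ! i) then basis_eval C n f (merge (cmp C) i gs, h) else 0)"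
      if i: "1 \<le> i" "i \<le> n" for i
    proof -
      have "i < length gs" using i gs(1) by simp
      then obtain us p q vs where s: "gs = us @ p # q # vs" "i = Suc (length us)"
        using split_at_merge[OF i(1)] by blast
      have mg: "merge (mul ?A) i ?xs = map basis_elem us @ mul ?A (basis_elem p) (basis_elem q) # map basis_elem vs"
        using merge_append[of "mul ?A" "map basis_elem us" "basis_elem p" "basis_elem q" "map basis_elem vs"]
        by (simp add: s)
      have mc: "merge (cmp C) i gs = us @ cmp C p q # vs"
        unfolding s by (rule merge_append)
      have pq: "gs ! (i - 1) = p" "gs ! i = q" by (simp_all add: s nth_append)
      show ?thesis
      proof (cases "src C p = tgt C q")
        case True
        have "(merge (cmp C) i gs, h) \<in> word_dom C n"
          using merge_word[OF dom i] True pq by simp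
        then show ?thesis
          unfolding pq using True by (simp add: basis_eval_def mc mg mul_basis_elem)
      next
        case False
        \<comment> \<open>Non-composable neighbours multiply to 0, and \<open>f\<close> vanishes
          when one of its arguments is 0; this matches the default 0 in
          \<open>word_diff\<close>.\<close>
        let ?ys = "map basis_elem us @ 0 # map basis_elem vs :: ('b \<Rightarrow>\<^sub>0 'k) list"
        have e: "merge (mul ?A) i ?xs = ?ys" using False by (simp add: mg mul_basis_elem)
        have ys: "?ys \<in> hochschild_dom ?A n" using fa(5)[OF i] e by simp
        have "length us < n" using i s by simp
        then have "linear_map ?A ?A (\<lambda>x. f (?ys[length us := x]))" by (rule A.multilinear_linear[OF m ys])
        from linear_map_zero[OF A.vspace this] have "f ?ys = 0"
          by (simp add: list_update_append)
        then show ?thesis unfolding pq e using False by simp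
      qed
    qed
    have sc: "Poly_Mapping.lookup (scl ?A c v) x = c * Poly_Mapping.lookup v x" for c v x
      by (simp add: scl_category_algebra lookup_map_times)
    have "Poly_Mapping.lookup (hochschild_diff ?A n f ?xs) h =
        Poly_Mapping.lookup (mul ?A (hd ?xs) (f (tl ?xs))) h
        + (\<Sum>i=1..n. (-1) ^ i * Poly_Mapping.lookup (f (merge (mul ?A) i ?xs)) h)
        + (-1) ^ (n + 1) * Poly_Mapping.lookup (mul ?A (f (butlast ?xs)) (last ?xs)) h"
      using xs by (simp only: hochschild_diff_def if_True lookup_add lookup_sum sc)
    also have "(\<Sum>i=1..n. (-1) ^ i * Poly_Mapping.lookup (f (merge (mul ?A) i ?xs)) h) =
        (\<Sum>i=1..n. (-1) ^ i * (if src C (gs ! (i - 1)) = tgt C (gs ! i)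
          then basis_eval C n f (merge (cmp C) i gs, h) else 0))"
      by (intro sum.cong) (simp_all add: 2)
    finally have "Poly_Mapping.lookup (hochschild_diff ?A n f ?xs) h = word_diff C n (basis_eval C n f) (gs, h)"
      unfolding 1 3 using dom by (simp add: word_diff_def)
    then show ?thesis using dom by (simp add: w basis_eval_def)
  qed (simp add: w basis_eval_def word_diff_def)
qed

lemma HH_iso_word_cohomology:
  "graded_isomorphic (HH (category_algebra TYPE('k::field) C))
    (cohomology (\<lambda>n. fun_space (word_dom C n) :: ('k, _) vspace) (word_diff C))"
proof -
  interpret A: algebra_space "category_algebra TYPE('k) C" by (rule algebra_space_category_algebra)
  show ?thesis
    unfolding HH_def
    by (rule cohomology_linear_iso_of_complex_iso[where F = "basis_eval C", OF A.cochain_complex_hochschild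
      cochain_complex_word linear_iso_basis_eval basis_eval_diff])
qed

end

theorem corollary2:
  fixes C :: "('o, 'm) cat"
  assumes "finite_category C"
    and "groupoid C \<or> poset_category C"
  shows "graded_isomorphic (HH (category_algebra TYPE('k::field) C))
    (simplicial_cohomology TYPE('k) (adjoint_category C))"
proof -
  interpret finite_category C by fact
  \<comment> \<open>From here on groupoids and posets are treated alike.\<close>
  interpret torsor_category C using assms(2) groupoid_torsor poset_torsor by blast
  interpret D: category "adjoint_category C" by (rule category_adjoint_category)
  show ?thesis
    using HH_iso_word_cohomology word_cohomology_iso_nerve D.nerve_fun_cohomology_iso
    by (blast intro: graded_isomorphic_trans)
qed

end
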